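(* Let $\Omega\subset\mathbb{R}^N$ be a connected, open and bounded set. Let $g_1,\dots,g_N:[0,+\infty)\to[0,+\infty)$ be continuous functions satisfying assumptions (L) and (G), and assume that $G(\xi)=+\infty$ for every $\xi>0$, where $$G(\xi)=\int_0^\xi \frac{g_N(\zeta^2/N)}{\zeta}\,d\zeta=\lim_{\hat\xi\to0^+}\int_{\hat\xi}^{\xi}\frac{g_N(\zeta^2/N)}{\zeta}\,d\zeta .$$ Let $u\in W^{1,2}(\Omega)\cap C(\overline{\Omega})$ be a weak supersolution to $$\sum_{i=1}^N g_i(u_{x_i}^2)\,u_{x_ix_i}=0\quad\text{in }\Omega .$$ Then, if $u$ attains its minimum in $\Omega$, it is a constant.
   Context: Throughout $N\ge 2$. Assumptions (L): there exists $\overline t>0$ such that (i) on $[0,\overline t]$, for every $i=1,\dots,N-1$, $0\le g_N(t)\le g_i(t)\le 1$; (ii) $g_N$ is continuous on $[0,\overline t]$, and positive and differentiable on $(0,\overline t]$; (iii) on $(0,\overline t]$ the function $t\mapsto g_N(t)+g_N'(t)t$ is non-decreasing. For each $i$, let $f_i$ be a solution on $[0,+\infty)$ of the differential equation $g_i(t)=f_i(t)+5tf_i'(t)+2t^2f_i''(t)$. Assumption (G): each $f_i$ is bounded, and the function $s\mapsto f_i(s^2)s^2$ is strictly convex on $\mathbb{R}$. Set $L(p)=\frac12\sum_{i=1}^N f_i(p_i^2)p_i^2$ for $p\in\mathbb{R}^N$; then $\partial^2L/\partial p_i^2=g_i(p_i^2)$, so formally $\operatorname{div}\nabla L(\nabla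 u)=\sum_i g_i(u_{x_i}^2)u_{x_ix_i}$. A function $u\in W^{1,2}(\Omega)$ is a weak supersolution to $\sum_{i=1}^N g_i(u_{x_i}^2)u_{x_ix_i}=0$ if $\int_\Omega\langle\nabla L(\nabla u(x)),\nabla\eta(x)\rangle\,dx\ge0$ for every $\eta\in C_0^\infty(\Omega)$ with $\eta\ge0$. *)

theory Defs
  imports "HOL-Analysis.Analysis"
begin

definition partial_deriv :: "'n::finite \<Rightarrow> (real ^ 'n \<Rightarrow> real) \<Rightarrow> real ^ 'n \<Rightarrow> real" where
  "partial_deriv i F x = frechet_derivative F (at x) (axis i 1)"

definition grad :: "(real ^ 'n::finite \<Rightarrow> real) \<Rightarrow> real ^ 'n \<Rightarrow> real ^ 'n" where
  "grad F x = (\<chi> i. partial_deriv i F x)"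

primrec C_k :: "nat \<Rightarrow> (real ^ 'n::finite \<Rightarrow> real) \<Rightarrow> bool" where
  "C_k 0 F \<longleftrightarrow> continuous_on UNIV F"
| "C_k (Suc k) F \<longleftrightarrow> (\<forall>x. F differentiable at x) \<and> (\<forall>i. C_k k (partial_deriv i F))"

text \<open>The space \<open>C\<^sub>0\<^sup>\<infinity>(\<Omega>)\<close>; its elements are represented by their extension by zero
  to the whole space.\<close>

definition test_fun :: "(real ^ 'n::finite) set \<Rightarrow> (real ^ 'n \<Rightarrow> real) \<Rightarrow> bool" where
  "test_fun \<Omega> \<eta> \<longleftrightarrow> (\<forall>k. C_k k \<eta>) \<and>
     compact (closure (support_on UNIV \<eta>)) \<and> closure (support_on UNIV \<eta>) \<subseteq> \<Omega>"

definition square_integrable_on ::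
    "('a::euclidean_space \<Rightarrow> 'b::euclidean_space) \<Rightarrow> 'a set \<Rightarrow> bool"
    (infix "square'_integrable'_on" 50) where
  "v square_integrable_on \<Omega> \<longleftrightarrow> v \<in> borel_measurable (lebesgue_on \<Omega>) \<and>
     integrable (lebesgue_on \<Omega>) (\<lambda>x. (norm (v x))\<^sup>2)"

text \<open>\<open>has_L2_gradient \<Omega> u v\<close>: \<open>u\<close> is in \<open>L\<^sup>2(\<Omega>)\<close> and \<open>v\<close> is a representative in \<open>L\<^sup>2(\<Omega>)\<close>
  of its weak (distributional) gradient, which is unique up to null sets.\<close>

definition has_L2_gradient ::
    "(real ^ 'n::finite) set \<Rightarrow> (real ^ 'n \<Rightarrow> real) \<Rightarrow> (real ^ 'n \<Rightarrow> real ^ 'n) \<Rightarrow> bool" where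
  "has_L2_gradient \<Omega> u v \<longleftrightarrow> u square_integrable_on \<Omega> \<and> v square_integrable_on \<Omega> \<and>
     (\<forall>\<phi> i. test_fun \<Omega> \<phi> \<longrightarrow>
        (\<integral>x. u x * partial_deriv i \<phi> x \<partial>lebesgue_on \<Omega>)
          = - (\<integral>x. v x $ i * \<phi> x \<partial>lebesgue_on \<Omega>))"

definition W12 :: "(real ^ 'n::finite) set \<Rightarrow> (real ^ 'n \<Rightarrow> real) set" where
  "W12 \<Omega> = {u. \<exists>v. has_L2_gradient \<Omega> u v}"

definition strictly_convex :: "(real \<Rightarrow> real) \<Rightarrow> bool" where
  "strictly_convex F \<longleftrightarrow> (\<forall>x y t. x \<noteq> y \<and> 0 < t \<and> t < 1 \<longrightarrow>
     F ((1 - t) * x + t * y) < (1 - t) * F x + t * F y)"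

text \<open>The equation \<open>g(t) = f(t) + 5 t f'(t) + 2 t\<^sup>2 f''(t)\<close> is singular at \<open>t = 0\<close>, and in the
  degenerate case \<open>f'(0)\<close> typically does not exist (for \<open>g(t) = \<surd>t\<close> the bounded
  solution is \<open>f(t) = \<surd>t / 3\<close>). Hence \<open>f\<close> is required to be continuous on \<open>[0, \<infinity>)\<close> and twice
  differentiable on \<open>(0, \<infinity>)\<close> only. At \<open>t = 0\<close> the equation reads \<open>g(0) = f(0)\<close>.\<close>

definition solves_ode :: "(real \<Rightarrow> real) \<Rightarrow> (real \<Rightarrow> real) \<Rightarrow> bool" where
  "solves_ode g f \<longleftrightarrow> continuous_on {0..} f \<and>
     (\<exists>f' f''. (\<forall>t>0. (f has_real_derivative f' t) (at t) \<and> (f' has_real_derivative f'' t) (at t)) \<and>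
        (\<forall>t\<ge>0. g t = f t + 5 * t * f' t + 2 * t\<^sup>2 * f'' t))"

text \<open>The coordinates are indexed by a finite type; \<open>m\<close> is the index that plays the
  role of \<open>N\<close>. The derivative of \<open>g m\<close> is one-sided at the right endpoint.\<close>

definition assumption_L :: "('n::finite \<Rightarrow> real \<Rightarrow> real) \<Rightarrow> 'n \<Rightarrow> bool" where
  "assumption_L g m \<longleftrightarrow> (\<exists>T>0.
     (\<forall>t\<in>{0..T}. \<forall>i. i \<noteq> m \<longrightarrow> 0 \<le> g m t \<and> g m t \<le> g i t \<and> g i t \<le> 1) \<and>
     continuous_on {0..T} (g m) \<and>
     (\<forall>t\<in>{0<..T}. 0 < g m t) \<and>
     (\<exists>g'. (\<forall>t\<in>{0<..T}. (g m has_real_derivative g' t) (at t within {0<..T})) \<and>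
           mono_on {0<..T} (\<lambda>t. g m t + g' t * t)))"

definition assumption_G :: "('n::finite \<Rightarrow> real \<Rightarrow> real) \<Rightarrow> bool" where
  "assumption_G f \<longleftrightarrow> (\<forall>i. bounded (f i ` {0..}) \<and> strictly_convex (\<lambda>s. f i (s\<^sup>2) * s\<^sup>2))"

definition Lagr :: "('n::finite \<Rightarrow> real \<Rightarrow> real) \<Rightarrow> real ^ 'n \<Rightarrow> real" where
  "Lagr f p = 1 / 2 * (\<Sum>i\<in>UNIV. f i ((p $ i)\<^sup>2) * (p $ i)\<^sup>2)"

text \<open>Since \<open>g m\<close> is nonnegative, the integral is monotone in \<open>e\<close> and the limit exists in \<open>[0, \<infinity>]\<close>.\<close>

definition G_int :: "('n::finite \<Rightarrow> real \<Rightarrow> real) \<Rightarrow> 'n \<Rightarrow> real \<Rightarrow> ereal" where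
  "G_int g m \<xi> = Lim (at_right 0)
     (\<lambda>e. ereal (integral {e..\<xi>} (\<lambda>\<zeta>. g m (\<zeta>\<^sup>2 / real CARD('n)) / \<zeta>)))"

text \<open>Weak supersolutions of \<open>\<Sum>\<^sub>i g\<^sub>i(u\<^sub>x\<^sub>i\<^sup>2) u\<^sub>x\<^sub>i\<^sub>x\<^sub>i = 0\<close>, which is formally
  \<open>div \<nabla>L(\<nabla>u) = 0\<close> for \<open>L = Lagr f\<close>.\<close>

definition weak_supersolution ::
    "(real ^ 'n::finite) set \<Rightarrow> ('n \<Rightarrow> real \<Rightarrow> real) \<Rightarrow> (real ^ 'n \<Rightarrow> real) \<Rightarrow> bool" where
  "weak_supersolution \<Omega> f u \<longleftrightarrow> (\<exists>Du. has_L2_gradient \<Omega> u Du \<and>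
     (\<forall>\<eta>. test_fun \<Omega> \<eta> \<and> (\<forall>x. 0 \<le> \<eta> x) \<longrightarrow>
        0 \<le> (\<integral>x. grad (Lagr f) (Du x) \<bullet> grad \<eta> x \<partial>lebesgue_on \<Omega>)))"

end

(* Strong maximum principle by comparison with radial barriers.  If the set where u attains its
   minimum is not open, some ball B(y, R) inside the domain meets it in a single boundary point a.
   Near a consider w(x) = Phi(|x - y|^2 / 2) with Phi' = -v < 0 and w = 0 on the sphere |x - y| = R.
   Writing h(t) = t g_N(t), which is convex by (L), and using g_N <= g_i <= 1, the function w is a
   strict classical subsolution on both sides of that sphere as soon as -v' g_N(c^2 v^2 / N) c^2 > N v
   with c = R / 2.  The ODE -z' g_N(z^2 / N) = K z for z = c v is solved by inverting an antiderivative
   of g_N(z^2 / N) / z; since G diverges at 0, the solution stays positive on any prescribed interval,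
   however small its initial value.  So w can be made so small that u > u(a) + w on a small sphere
   around a: outside B(y, R) because w < 0, inside because u - u(a) has a positive lower bound there.
   The comparison principle then gives u(a) > u(a) + w(a) = u(a).

   The comparison principle itself is proved by testing with a smooth function of the mollified
   difference w + const - u; the error of mollifying the L^2 gradients tends to 0, whereas the strict
   subsolution property contributes a positive amount that does not depend on the mollification. *)

theory Submission
  imports Defs "HOL-Computational_Algebra.Polynomial"
begin

section \<open>Smooth functions\<close>

text \<open>The natural test function, the positive part of w + const - u, is merely Sobolev, while
  the definition of a supersolution admits only smooth ones. Mollifying the difference and then
  applying a smooth function that vanishes on a half-line keeps every chain rule classical; the
  price is that the test function has a mollified gradient, whereas monotonicity of the flux speaks
  about the original one. No normal derivative at the contact point is compared: the comparison ball
  is centred at that point, which is why the barrier must be a strict subsolution on both sides of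
  the sphere where it vanishes. The argument zeta^2 / N in G comes from Jensen's inequality for h,
  as the squared partial derivatives of w have mean |grad w|^2 / N. Divergence of G says that the
  profile equation needs infinite time to reach 0; this allows arbitrarily small barriers whose
  gradient never vanishes. The equation for f_i means that half the derivative of f_i(s^2) s^2 has
  derivative g_i(s^2).\<close>

lemma partial_deriv_eqI:
  "(F has_derivative F') (at x) \<Longrightarrow> partial_deriv i F x = F' (axis i 1)"
  unfolding partial_deriv_def by (drule frechet_derivative_at) simp

lemmas frechet_derivative_worksI = frechet_derivative_works[THEN iffD1]

lemma partial_deriv_zero_outside:
  fixes F :: "real ^ 'n::finite \<Rightarrow> real"
  assumes "closed K" "\<And>x. x \<notin> K \<Longrightarrow> F x = 0" "x \<notin> K"
  shows "partial_deriv i F x = 0"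
proof -
  have "((\<lambda>_. 0) has_derivative (\<lambda>_. 0)) (at x)" by simp
  then have "(F has_derivative (\<lambda>_. 0)) (at x)"
    by (rule has_derivative_transform_within_open[where s="- K"]) (use assms in auto)
  then show ?thesis by (simp add: partial_deriv_eqI)
qed

lemma has_derivative_partial_deriv:
  fixes F :: "real ^ 'n::finite \<Rightarrow> real"
  assumes "F differentiable at x"
  shows "(F has_derivative (\<lambda>h. \<Sum>i\<in>UNIV. h $ i * partial_deriv i F x)) (at x)"
proof -
  have D: "(F has_derivative frechet_derivative F (at x)) (at x)"
    using assms frechet_derivative_works by blast
  interpret bounded_linear "frechet_derivative F (at x)"
    using D by (rule has_derivative_bounded_linear)
  have "frechet_derivative F (at x) h = (\<Sum>i\<in>UNIV. h $ i * partial_deriv i F x)" for h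
  proof -
    have "(\<Sum>i\<in>UNIV. h $ i *\<^sub>R axis i 1) = h"
      by (simp add: basis_expansion flip: scalar_mult_eq_scaleR)
    then have "frechet_derivative F (at x) h = frechet_derivative F (at x) (\<Sum>i\<in>UNIV. h $ i *\<^sub>R axis i 1)"
      by simp
    also have "\<dots> = (\<Sum>i\<in>UNIV. h $ i *\<^sub>R frechet_derivative F (at x) (axis i 1))"
      by (simp only: sum scaleR)
    finally have "frechet_derivative F (at x) h = \<dots>" .
    then show ?thesis by (simp add: partial_deriv_def)
  qed
  then have "frechet_derivative F (at x) = (\<lambda>h. \<Sum>i\<in>UNIV. h $ i * partial_deriv i F x)"
    by (rule ext)
  then show ?thesis using D by simp
qed

text \<open>The recursion for \<open>C_k\<close> records only the top order; the lower one has to be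
  recovered because the product and chain rules keep undifferentiated factors. The bottom case is
  continuity of differentiable functions.\<close>

lemma C_k_SucD: "C_k (Suc k) F \<Longrightarrow> C_k k F"
proof (induction k arbitrary: F)
  case 0
  then show ?case
    by (auto simp: continuous_on_eq_continuous_at intro: differentiable_imp_continuous_within)
next
  case (Suc k)
  have "C_k k (partial_deriv i F)" for i
    using Suc.IH[of "partial_deriv i F"] Suc.prems by simp
  then show ?case using Suc.prems by simp
qed

section \<open>Closure properties of the classes \<open>C_k\<close>\<close>

lemma C_k_const: "C_k k (\<lambda>_ :: real ^ 'a::finite. c)"
proof (induction k arbitrary: c)
  case (Suc k)
  have "partial_deriv i (\<lambda>_. c) = (\<lambda>_. 0)" for i :: "'a::finite"
    by (rule ext) (simp add: partial_deriv_eqI[OF has_derivative_const])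
  then show ?case using Suc by simp
qed simp

lemma C_k_nth: "C_k k (\<lambda>x :: real ^ 'n::finite. x $ i)"
proof (cases k)
  case (Suc j)
  have D: "((\<lambda>x. x $ i) has_derivative (\<lambda>x. x $ i)) (at x)" for x :: "real ^ 'n"
    by (rule bounded_linear_imp_has_derivative) (rule bounded_linear_vec_nth)
  have "partial_deriv l (\<lambda>x::real^'n. x $ i) = (\<lambda>_. axis l 1 $ i)" for l
    by (rule ext) (simp add: partial_deriv_eqI[OF D])
  then show ?thesis using Suc D by (auto simp: C_k_const differentiable_def)
qed (simp add: continuous_on_component)

lemma partial_deriv_add:
  assumes "F differentiable at x" "G differentiable at x"
  shows "partial_deriv i (\<lambda>x. F x + G x) x = partial_deriv i F x + partial_deriv i G x"
  using partial_deriv_eqI[OF has_derivative_add[OF assms[THEN frechet_derivative_worksI]], of i]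
  by (simp add: partial_deriv_def)

lemma C_k_add: "C_k k F \<Longrightarrow> C_k k G \<Longrightarrow> C_k k (\<lambda>x. F x + G x)"
proof (induction k arbitrary: F G)
  case (Suc k)
  have "partial_deriv i (\<lambda>x. F x + G x) = (\<lambda>x. partial_deriv i F x + partial_deriv i G x)" for i
    using Suc.prems by (intro ext partial_deriv_add) auto
  then show ?case using Suc by auto
qed (auto intro: continuous_on_add)

lemma partial_deriv_mult:
  assumes "F differentiable at x" "G differentiable at x"
  shows "partial_deriv i (\<lambda>x. F x * G x) x = F x * partial_deriv i G x + partial_deriv i F x * G x"
  using partial_deriv_eqI[OF has_derivative_mult[OF assms[THEN frechet_derivative_worksI]], of i]
  by (simp add: partial_deriv_def)

lemma C_k_mult: "C_k k F \<Longrightarrow> C_k k G \<Longrightarrow> C_k k (\<lambda>x. F x * G x)"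
proof (induction k arbitrary: F G)
  case (Suc k)
  have "partial_deriv i (\<lambda>x. F x * G x) = (\<lambda>x. F x * partial_deriv i G x + partial_deriv i F x * G x)" for i
    using Suc.prems by (intro ext partial_deriv_mult) auto
  then show ?case using Suc C_k_SucD[OF Suc.prems(1)] C_k_SucD[OF Suc.prems(2)]
    by (auto intro!: C_k_add)
qed (auto intro: continuous_on_mult)

lemma C_k_sum: "finite I \<Longrightarrow> (\<And>i. i \<in> I \<Longrightarrow> C_k k (F i)) \<Longrightarrow> C_k k (\<lambda>x. \<Sum>i\<in>I. F i x)"
  by (induction I rule: finite_induct) (auto intro: C_k_const C_k_add)

text \<open>With the prefactor ranging over polynomials in \<open>1 / x\<close>, the class of functions built on
  \<open>exp (- 1 / x)\<close> is closed under differentiation, so smoothness follows by induction.\<close>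

definition expoly :: "real poly \<Rightarrow> real \<Rightarrow> real" where
  "expoly p x = (if x > 0 then poly p (1 / x) * exp (- (1 / x)) else 0)"

text \<open>The power \<open>y ^ k\<close> is carried along to close the induction on the
  coefficients: \<open>pCons a p\<close> leaves \<open>a * y ^ k\<close> plus the same expression
  for \<open>p\<close> with exponent \<open>Suc k\<close>.\<close>

lemma poly_exp_tendsto_0: "((\<lambda>y. y ^ k * poly p y * exp (- y)) \<longlongrightarrow> (0::real)) at_top"
proof (induction p arbitrary: k)
  case (pCons a p)
  have "((\<lambda>y. a * (y ^ k / exp y) + y ^ Suc k * poly p y * exp (- y)) \<longlongrightarrow> a * 0 + 0) at_top"
    by (intro tendsto_add tendsto_mult tendsto_const tendsto_power_div_exp_0 pCons)
  moreover have "a * (y ^ k / exp y) + y ^ Suc k * poly p y * exp (- y) = y ^ k * poly (pCons a p) y * exp (- y)" for y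
    by (simp add: exp_minus divide_inverse algebra_simps)
  ultimately show ?case by simp
qed simp

text \<open>With y = 1 / x and dy/dx = - y^2, differentiating p(y) exp (-y) produces y^2 (p - p')(y)
  exp (-y), which explains the polynomial. At 0 the right difference quotient is y p(y) exp (-y) for
  y tending to infinity, and the left one vanishes identically.\<close>

lemma expoly_deriv:
  "(expoly p has_real_derivative expoly (monom 1 2 * (p - pderiv p)) x) (at x)"
proof (cases "x = 0")
  case False
  have *: "((\<lambda>x. if x > 0 then poly p (1 / x) * exp (- (1 / x)) else 0) has_real_derivative
          expoly (monom 1 2 * (p - pderiv p)) x) (at x)"
  proof (cases "x > 0")
    case True
    have "((\<lambda>x. poly p (1 / x)) has_real_derivative poly (pderiv p) (1 / x) * (- (1 / x\<^sup>2))) (at x)"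
      using True by (intro DERIV_chain2[OF poly_DERIV])
        (auto intro!: derivative_eq_intros simp: power2_eq_square)
    moreover have "((\<lambda>x. exp (- (1 / x))) has_real_derivative exp (- (1 / x)) * (1 / x\<^sup>2)) (at x)"
      using True by (auto intro!: derivative_eq_intros simp: power2_eq_square)
    ultimately have "((\<lambda>x. poly p (1 / x) * exp (- (1 / x))) has_real_derivative
      poly (pderiv p) (1 / x) * (- (1 / x\<^sup>2)) * exp (- (1 / x)) +
      exp (- (1 / x)) * (1 / x\<^sup>2) * poly p (1 / x)) (at x)"
      by (rule DERIV_mult)
    also have "poly (pderiv p) (1 / x) * (- (1 / x\<^sup>2)) * exp (- (1 / x)) +
        exp (- (1 / x)) * (1 / x\<^sup>2) * poly p (1 / x) = expoly (monom 1 2 * (p - pderiv p)) x"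
      using True by (simp add: expoly_def poly_monom power_one_over algebra_simps)
    finally have "((\<lambda>x. poly p (1 / x) * exp (- (1 / x))) has_real_derivative
        expoly (monom 1 2 * (p - pderiv p)) x) (at x)" .
    then show ?thesis
      by (rule has_field_derivative_transform_within_open[where S="{0<..}"]) (use True in auto)
  next
    case nx: False
    have "((\<lambda>x. 0) has_real_derivative 0) (at x)" by simp
    then have "((\<lambda>x. if x > 0 then poly p (1 / x) * exp (- (1 / x)) else 0) has_real_derivative 0) (at x)"
      by (rule has_field_derivative_transform_within_open[where S="{..<0}"]) (use False nx in auto)
    then show ?thesis using nx by (simp add: expoly_def)
  qed
  then show ?thesis by (simp add: expoly_def[abs_def])
next
  case True
  have "((\<lambda>x. expoly p x / x) \<longlongrightarrow> 0) (at 0)"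
  proof (rule filterlim_split_at_real)
    show "((\<lambda>x. expoly p x / x) \<longlongrightarrow> 0) (at_left 0)"
      by (rule tendsto_eventually) (auto simp: eventually_at_filter expoly_def)
    have "((\<lambda>x. (1 / x) ^ 1 * poly p (1 / x) * exp (- (1 / x))) \<longlongrightarrow> 0) (at_right (0::real))"
      using filterlim_compose[OF poly_exp_tendsto_0[of 1 p] filterlim_inverse_at_top_right]
      by (simp add: inverse_eq_divide)
    then show "((\<lambda>x. expoly p x / x) \<longlongrightarrow> 0) (at_right 0)"
      by (rule Lim_transform_eventually) (auto simp: eventually_at_filter expoly_def)
  qed
  then show ?thesis using True by (simp add: has_field_derivative_iff expoly_def)
qed

lemma expoly_has_derivative_compose:
  assumes "F differentiable at x"
  shows "((\<lambda>x. expoly p (F x)) has_derivative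
      (\<lambda>h. expoly (monom 1 2 * (p - pderiv p)) (F x) * frechet_derivative F (at x) h)) (at x)"
  by (rule has_derivative_compose[where g="expoly p",
      OF frechet_derivative_worksI[OF assms] expoly_deriv[unfolded has_field_derivative_def]])

lemma partial_deriv_expoly:
  "F differentiable at x \<Longrightarrow> partial_deriv i (\<lambda>x. expoly p (F x)) x =
     expoly (monom 1 2 * (p - pderiv p)) (F x) * partial_deriv i F x"
  using partial_deriv_eqI[OF expoly_has_derivative_compose, of F x i p]
  by (simp add: partial_deriv_def)

lemma C_k_expoly: "C_k k F \<Longrightarrow> C_k k (\<lambda>x. expoly p (F x))"
proof (induction k arbitrary: p)
  case 0
  have "continuous_on UNIV (expoly p)"
    by (meson expoly_deriv DERIV_isCont continuous_at_imp_continuous_on)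
  then show ?case using 0 by (auto intro: continuous_on_compose2)
next
  case (Suc k)
  then have d: "F differentiable at x" for x by simp
  have "partial_deriv i (\<lambda>x. expoly p (F x)) =
      (\<lambda>x. expoly (monom 1 2 * (p - pderiv p)) (F x) * partial_deriv i F x)" for i
    using partial_deriv_expoly[OF d] by blast
  moreover have "(\<lambda>x. expoly p (F x)) differentiable at x" for x
    using expoly_has_derivative_compose[OF d] differentiable_def by blast
  ultimately show ?case using Suc C_k_SucD[OF Suc.prems]
    by (auto intro!: C_k_mult)
qed

text \<open>\<open>expoly (monom 1 2)\<close> is the derivative of \<open>expoly 1\<close>, so the
  last two claims make the latter nondecreasing and Lipschitz with constant 2. The 2 comes from y^2
  / 2 \<le> exp y at y = 1 / s.\<close>

lemma expoly_bounds:
  "0 \<le> expoly 1 s" "s > 0 \<Longrightarrow> 0 < expoly 1 s" "s \<le> 0 \<Longrightarrow> expoly p s = 0"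
  "0 \<le> expoly (monom 1 2) s" "expoly (monom 1 2) s \<le> 2"
proof -
  show "expoly (monom 1 2) s \<le> 2"
  proof (cases "s > 0")
    case True
    define y where "y = 1 / s"
    have "y\<^sup>2 / 2 \<le> exp y"
      using exp_lower_Taylor_quadratic[of y] True
      by (smt (verit) y_def zero_less_divide_1_iff)
    then have "y\<^sup>2 * exp (- y) \<le> (2 * exp y) * exp (- y)" by (intro mult_right_mono) auto
    also have "\<dots> = 2 * (exp y * exp (- y))" by (rule mult.assoc)
    finally have "y\<^sup>2 * exp (- y) \<le> 2" by (simp only: exp_minus_inverse)
    then show ?thesis using True by (simp add: expoly_def poly_monom y_def)
  qed (simp add: expoly_def)
qed (simp_all add: expoly_def poly_monom)

section \<open>Test functions and bumps\<close>

lemma test_funI: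
  assumes "\<And>k. C_k k F" "compact K" "K \<subseteq> \<Omega>" "\<And>x. x \<notin> K \<Longrightarrow> F x = 0"
  shows "test_fun \<Omega> F"
proof -
  have "support_on UNIV F \<subseteq> K" using assms(4) by (auto simp: support_on_def)
  then have c: "closure (support_on UNIV F) \<subseteq> K"
    by (simp add: assms(2) closure_minimal compact_imp_closed)
  then have "compact (closure (support_on UNIV F))"
    by (metis assms(2) closed_closure compact_Int_closed inf.absorb_iff2)
  then show ?thesis using assms c unfolding test_fun_def by auto
qed

lemma test_funE:
  assumes "test_fun \<Omega> F"
  obtains K where "compact K" "K \<subseteq> \<Omega>" "\<And>x. x \<notin> K \<Longrightarrow> F x = 0"
proof
  show "compact (closure (support_on UNIV F))" "closure (support_on UNIV F) \<subseteq> \<Omega>"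
    using assms by (auto simp: test_fun_def)
  show "F x = 0" if "x \<notin> closure (support_on UNIV F)" for x
    using that closure_subset[of "support_on UNIV F"] by (auto simp: support_on_def)
qed

lemma test_fun_C_k: "test_fun \<Omega> F \<Longrightarrow> C_k k F"
  by (simp add: test_fun_def)

lemma test_fun_partial_deriv:
  assumes "test_fun \<Omega> F" shows "test_fun \<Omega> (partial_deriv i F)"
proof -
  obtain K where K: "compact K" "K \<subseteq> \<Omega>" "\<And>x. x \<notin> K \<Longrightarrow> F x = 0"
    using assms test_funE by blast
  have "C_k k (partial_deriv i F)" for k
    using test_fun_C_k[OF assms, of "Suc k"] by simp
  then show ?thesis
    by (rule test_funI[OF _ K(1,2)]) (use K partial_deriv_zero_outside compact_imp_closed in blast)
qed

lemma test_fun_differentiable: "test_fun \<Omega> F \<Longrightarrow> F differentiable at x"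
  using test_fun_C_k[of \<Omega> F "Suc 0"] by simp

lemma test_fun_continuous: "test_fun \<Omega> F \<Longrightarrow> continuous_on UNIV F"
  using test_fun_C_k[of \<Omega> F 0] by simp

lemma test_fun_mono: "test_fun A F \<Longrightarrow> A \<subseteq> B \<Longrightarrow> test_fun B F"
  unfolding test_fun_def by auto

text \<open>The standard bump exp (- 1 / (e^2 - |x|^2)). With the squared norm the inner function is
  a polynomial in the coordinates, so smoothness follows from the closure rules of
  \<open>C_k\<close> alone.\<close>

definition bump :: "real \<Rightarrow> real ^ 'n::finite \<Rightarrow> real" where
  "bump e x = expoly 1 (e\<^sup>2 - (norm x)\<^sup>2)"

lemma norm_sq_vec: "(norm (x :: real ^ 'n::finite))\<^sup>2 = (\<Sum>i\<in>UNIV. x $ i * x $ i)"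
  by (simp add: power2_norm_eq_inner inner_vec_def)

lemma C_k_bump_shift: "C_k k (\<lambda>y::real^'n::finite. bump e (y - x))"
proof -
  have "C_k k (\<lambda>y::real^'n. e\<^sup>2 + (\<Sum>i\<in>UNIV. (-1) * ((y $ i + - (x $ i)) * (y $ i + - (x $ i)))))"
    by (intro C_k_add C_k_sum C_k_mult C_k_const C_k_nth) auto
  moreover have "e\<^sup>2 + (\<Sum>i\<in>UNIV. (-1) * ((y $ i + - (x $ i)) * (y $ i + - (x $ i)))) = e\<^sup>2 - (norm (y - x))\<^sup>2"
    for y :: "real ^ 'n"
    by (simp add: norm_sq_vec sum_negf)
  ultimately show ?thesis unfolding bump_def by (metis (no_types, lifting) C_k_expoly ext)
qed

lemma bump_nonneg: "0 \<le> bump e x" by (simp add: bump_def expoly_bounds)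

lemma bump_pos_iff: "e > 0 \<Longrightarrow> 0 < bump e x \<longleftrightarrow> norm x < e"
proof -
  assume "e > 0"
  then have "e\<^sup>2 - (norm x)\<^sup>2 > 0 \<longleftrightarrow> norm x < e"
    by (simp add: power_mono_iff not_le[symmetric])
  then show ?thesis unfolding bump_def
    by (metis expoly_bounds(2,3) linorder_not_le order_less_irrefl)
qed

lemma bump_zero: "e > 0 \<Longrightarrow> e \<le> norm x \<Longrightarrow> bump e x = 0"
  using bump_pos_iff[of e x] bump_nonneg[of e x] by linarith

lemma test_fun_bump_shift:
  assumes "e > 0" "cball x e \<subseteq> \<Omega>"
  shows "test_fun \<Omega> (\<lambda>y::real^'n::finite. bump e (y - x))"
  using assms
  by (intro test_funI[where K="cball x e"] C_k_bump_shift)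
     (auto simp: dist_norm norm_minus_commute intro!: bump_zero)

section \<open>Mollification and integration by parts\<close>

lemma integral_lborel_shift:
  fixes f :: "'a::euclidean_space \<Rightarrow> real"
  assumes "f \<in> borel_measurable borel"
  shows "(\<integral>x. f (a + x) \<partial>lborel) = (\<integral>x. f x \<partial>lborel)"
  using integral_distr[of "(+) a" lborel borel f] assms by (simp add: lborel_distr_plus)

lemma integrable_lborel_shift:
  fixes f :: "'a::euclidean_space \<Rightarrow> real"
  assumes "integrable lborel f"
  shows "integrable lborel (\<lambda>x. f (a + x))"
  using integrable_distr_eq[of "(+) a" lborel borel f] assms by (simp add: lborel_distr_plus)

lemma continuous_on_extend_zero:
  fixes G :: "'a::t2_space \<Rightarrow> real"
  assumes "open B" "compact K" "K \<subseteq> B" "continuous_on B G" "\<And>x. x \<in> B - K \<Longrightarrow> G x = 0"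
  shows "continuous_on UNIV (\<lambda>x. if x \<in> B then G x else 0)"
proof -
  have "continuous_on (- K) (\<lambda>x. if x \<in> B then G x else 0)"
    by (rule continuous_on_eq[of _ "\<lambda>_. 0"]) (use assms in auto)
  moreover have "continuous_on B (\<lambda>x. if x \<in> B then G x else 0)"
    by (rule continuous_on_eq[OF assms(4)]) auto
  ultimately have "continuous_on (B \<union> - K) (\<lambda>x. if x \<in> B then G x else 0)"
    using assms by (intro continuous_on_open_Un) (auto intro: compact_imp_closed)
  moreover have "B \<union> - K = UNIV" using assms by auto
  ultimately show ?thesis by metis
qed

lemma integrable_compact_support:
  fixes G :: "'a::euclidean_space \<Rightarrow> real"
  assumes "continuous_on UNIV G" "compact K" "\<And>x. x \<notin> K \<Longrightarrow> G x = 0"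
  shows "integrable lborel G"
proof -
  have "integrable lborel (\<lambda>x. indicator K x *\<^sub>R G x)"
    using assms by (intro borel_integrable_compact) (auto intro: continuous_on_subset)
  moreover have "(\<lambda>x. indicator K x *\<^sub>R G x) = G"
    using assms(3) by (auto simp: indicator_def fun_eq_iff)
  ultimately show ?thesis by simp
qed

lemma bounded_compact_support:
  fixes G :: "'a::euclidean_space \<Rightarrow> real"
  assumes "continuous_on UNIV G" "compact K" "\<And>x. x \<notin> K \<Longrightarrow> G x = 0"
  shows "\<exists>B\<ge>0. \<forall>x. \<bar>G x\<bar> \<le> B"
proof -
  have "compact (G ` K)" using assms by (intro compact_continuous_image) (auto intro: continuous_on_subset)
  then obtain B where "\<And>y. y \<in> G ` K \<Longrightarrow> norm y \<le> B"
    using compact_imp_bounded bounded_iff by metis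
  then have "\<bar>G x\<bar> \<le> max B 0" for x
    using assms(3)[of x] by (cases "x \<in> K") (force simp: le_max_iff_disj)+
  then show ?thesis by (intro exI[of _ "max B 0"]) auto
qed

text \<open>Enlarging \<open>K\<close> by the closed unit ball gives a compact set containing both
  points whenever one of them lies in \<open>K\<close> and their distance is below 1; if neither
  lies in \<open>K\<close>, both values are 0.\<close>

lemma uniformly_continuous_compact_support:
  fixes G :: "'a::euclidean_space \<Rightarrow> real"
  assumes G: "continuous_on UNIV G" "compact K" "\<And>x. x \<notin> K \<Longrightarrow> G x = 0" and "e > 0"
  shows "\<exists>d>0. \<forall>x y. dist x y < d \<longrightarrow> \<bar>G x - G y\<bar> < e"
proof -
  let ?K = "{x + y |x y. x \<in> K \<and> y \<in> cball 0 1}"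
  have "compact ?K" using assms by (intro compact_sums) auto
  then have "uniformly_continuous_on ?K G"
    using G(1) by (intro compact_uniformly_continuous) (auto intro: continuous_on_subset)
  then obtain d where d: "d > 0" "\<forall>x\<in>?K. \<forall>y\<in>?K. dist y x < d \<longrightarrow> dist (G y) (G x) < e"
    using \<open>e > 0\<close> unfolding uniformly_continuous_on_def by blast
  have near: "x \<in> ?K \<and> y \<in> ?K" if "x \<in> K" "dist x y < 1" for x y :: 'a
  proof -
    have "x = x + 0" "y = x + (y - x)" by auto
    moreover have "y - x \<in> cball 0 1" "0 \<in> cball (0::'a) 1"
      using that by (auto simp: dist_norm norm_minus_commute)
    ultimately show ?thesis using that(1) by blast
  qed
  show ?thesis
  proof (intro exI[of _ "min d 1"] conjI allI impI)
    fix x y :: 'a assume xy: "dist x y < min d 1"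
    consider "x \<in> K" | "y \<in> K" | "x \<notin> K" "y \<notin> K" by blast
    then show "\<bar>G x - G y\<bar> < e"
    proof cases
      case 1 then show ?thesis using near[of x y] bspec[OF bspec[OF d(2)], of y x] xy by (simp add: dist_real_def)
    next
      case 2 then show ?thesis using near[of y x] bspec[OF bspec[OF d(2)], of y x] xy by (simp add: dist_real_def dist_commute)
    next
      case 3 then show ?thesis using G(3) \<open>e > 0\<close> by simp
    qed
  qed (use d in auto)
qed

lemma test_fun_along_line:
  assumes "test_fun \<Omega> \<eta>"
  shows "((\<lambda>t. \<eta> (x + t *\<^sub>R h)) has_real_derivative (\<Sum>i\<in>UNIV. h $ i * partial_deriv i \<eta> (x + t *\<^sub>R h))) (at t)"
proof -
  have "((\<lambda>t. x + t *\<^sub>R h) has_derivative (\<lambda>s. s *\<^sub>R h)) (at t)"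
    by (auto intro!: derivative_eq_intros)
  from has_derivative_compose[OF this has_derivative_partial_deriv[OF test_fun_differentiable[OF assms]]]
  show ?thesis
    by (rule has_derivative_imp_has_field_derivative) (simp add: sum_distrib_left mult_ac)
qed

text \<open>The mean value theorem on the segment from \<open>a\<close> to \<open>a + h\<close>
  reduces the remainder to the oscillation of the partial derivatives, which is uniformly small
  because they are again test functions. Having one \<open>d\<close> for all \<open>a\<close> later
  permits an estimate under the integral sign.\<close>

lemma test_fun_remainder:
  fixes \<rho> :: "real ^ 'n::finite \<Rightarrow> real"
  assumes t: "test_fun \<Omega> \<rho>" and "e > 0"
  obtains d where "d > 0"
    "\<And>a h. norm h < d \<Longrightarrow> \<bar>\<rho> (a + h) - \<rho> a - (\<Sum>i\<in>UNIV. h $ i * partial_deriv i \<rho> a)\<bar> \<le> e * norm h"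
proof -
  define N where "N = real CARD('n)"
  have N: "N > 0" by (simp add: N_def)
  have "\<exists>d>0. \<forall>x y. dist x y < d \<longrightarrow> \<bar>partial_deriv i \<rho> x - partial_deriv i \<rho> y\<bar> < e / N" for i
  proof -
    have T: "test_fun \<Omega> (partial_deriv i \<rho>)" using t by (rule test_fun_partial_deriv)
    obtain K where K: "compact K" "K \<subseteq> \<Omega>" "\<And>x. x \<notin> K \<Longrightarrow> partial_deriv i \<rho> x = 0"
      using T by (rule test_funE) blast
    have "e / N > 0" using N \<open>e > 0\<close> by simp
    then show ?thesis
      by (intro uniformly_continuous_compact_support[OF test_fun_continuous[OF T] K(1)] K(3))
  qed
  then have "\<forall>i. \<exists>d>0. \<forall>x y. dist x y < d \<longrightarrow> \<bar>partial_deriv i \<rho> x - partial_deriv i \<rho> y\<bar> < e / N" ..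
  then obtain d where "\<forall>i. d i > 0 \<and> (\<forall>x y. dist x y < d i \<longrightarrow> \<bar>partial_deriv i \<rho> x - partial_deriv i \<rho> y\<bar> < e / N)"
    unfolding choice_iff by blast
  then have d: "\<And>i. d i > 0"
      "\<And>i x y. dist x y < d i \<Longrightarrow> \<bar>partial_deriv i \<rho> x - partial_deriv i \<rho> y\<bar> < e / N"
    by blast+
  define D where "D = Min (range d)"
  have D: "D > 0" "\<And>i. D \<le> d i" using d(1) by (auto simp: D_def)
  show ?thesis
  proof (rule that[OF D(1)])
    fix a h :: "real ^ 'n" assume h: "norm h < D"
    obtain z where z: "0 < z" "z < 1"
      "\<rho> (a + 1 *\<^sub>R h) - \<rho> (a + 0 *\<^sub>R h) = (1 - 0) * (\<Sum>i\<in>UNIV. h $ i * partial_deriv i \<rho> (a + z *\<^sub>R h))"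
      using MVT2[of 0 1 "\<lambda>t. \<rho> (a + t *\<^sub>R h)" "\<lambda>t. \<Sum>i\<in>UNIV. h $ i * partial_deriv i \<rho> (a + t *\<^sub>R h)"]
        test_fun_along_line[OF t] by auto
    have "\<bar>h $ i * partial_deriv i \<rho> (a + z *\<^sub>R h) - h $ i * partial_deriv i \<rho> a\<bar> \<le> norm h * (e / N)" for i
    proof -
      have "dist (a + z *\<^sub>R h) a < d i"
        using z h D(2)[of i] mult_right_mono[of z 1 "norm h"] by (simp add: dist_norm)
      from d(2)[OF this] have "\<bar>h $ i\<bar> * \<bar>partial_deriv i \<rho> (a + z *\<^sub>R h) - partial_deriv i \<rho> a\<bar> \<le> norm h * (e / N)"
        by (intro mult_mono component_le_norm_cart) auto
      then show ?thesis by (simp add: abs_mult right_diff_distrib flip: abs_mult)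
    qed
    then have "\<bar>\<Sum>i\<in>UNIV. h $ i * partial_deriv i \<rho> (a + z *\<^sub>R h) - h $ i * partial_deriv i \<rho> a\<bar> \<le> (\<Sum>i\<in>(UNIV::'n set). norm h * (e / N))"
      by (intro order_trans[OF sum_abs] sum_mono)
    also have "\<dots> = e * norm h" using N by (simp add: N_def)
    finally show "\<bar>\<rho> (a + h) - \<rho> a - (\<Sum>i\<in>UNIV. h $ i * partial_deriv i \<rho> a)\<bar> \<le> e * norm h"
      using z(3) by (simp add: sum_subtractf)
  qed
qed

text \<open>Correlation in place of convolution needs translations only, no reflections.\<close>

definition correlate :: "('a::euclidean_space \<Rightarrow> real) \<Rightarrow> ('a \<Rightarrow> real) \<Rightarrow> 'a \<Rightarrow> real" where
  "correlate Z \<rho> x = (\<integral>y. Z y * \<rho> (y - x) \<partial>lborel)"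

lemma integrable_mult_bounded:
  fixes Z \<rho> :: "'a::euclidean_space \<Rightarrow> real"
  assumes "integrable lborel Z" "continuous_on UNIV \<rho>" "\<And>x. \<bar>\<rho> x\<bar> \<le> B"
  shows "integrable lborel (\<lambda>y. Z y * \<rho> y)"
proof (rule Bochner_Integration.integrable_bound[where f="\<lambda>y. B * Z y"])
  show "integrable lborel (\<lambda>y. B * Z y)" using assms by simp
  have [measurable]: "\<rho> \<in> borel_measurable borel" using assms(2) by (rule borel_measurable_continuous_onI)
  show "(\<lambda>y. Z y * \<rho> y) \<in> borel_measurable lborel" using assms(1) by measurable
  have "0 \<le> B" using assms(3)[of 0] by linarith
  moreover have "\<bar>Z x\<bar> * \<bar>\<rho> x\<bar> \<le> B * \<bar>Z x\<bar>" for x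
    using mult_right_mono[OF assms(3)[of x], of "\<bar>Z x\<bar>"] by (simp add: mult.commute)
  ultimately show "AE x in lborel. norm (Z x * \<rho> x) \<le> norm (B * Z x)"
    by (simp add: abs_mult)
qed

lemma integrable_correlate:
  fixes Z :: "real ^ 'n::finite \<Rightarrow> real"
  assumes "integrable lborel Z" "test_fun \<Omega> \<rho>"
  shows "integrable lborel (\<lambda>y. Z y * \<rho> (y - x))"
proof -
  obtain K where K: "compact K" "K \<subseteq> \<Omega>" "\<And>x. x \<notin> K \<Longrightarrow> \<rho> x = 0"
    using assms(2) by (rule test_funE) blast
  have c: "continuous_on UNIV \<rho>" using assms(2) by (rule test_fun_continuous)
  have "\<exists>B\<ge>0. \<forall>x. \<bar>\<rho> x\<bar> \<le> B"
    by (intro bounded_compact_support[OF c K(1)] K(3))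
  then obtain B where "\<And>x. \<bar>\<rho> x\<bar> \<le> B" by blast
  moreover have "continuous_on UNIV (\<lambda>y. \<rho> (y - x))"
    by (intro continuous_on_compose2[OF c] continuous_intros) auto
  ultimately show ?thesis by (intro integrable_mult_bounded assms(1))
qed

text \<open>\<open>Z\<close> is only integrable, so the derivative falls on the kernel; the minus
  sign arises because \<open>x\<close> enters through \<open>y - x\<close>. The uniform Taylor
  remainder of \<open>\<rho>\<close> is integrated against |Z|, and the tolerance
  \<open>e / (I + 1)\<close>, with \<open>I\<close> the L1 norm of \<open>Z\<close>, stays
  meaningful for I = 0.\<close>

lemma correlate_has_derivative:
  fixes Z :: "real ^ 'n::finite \<Rightarrow> real"
  assumes Z: "integrable lborel Z" and t: "test_fun \<Omega> \<rho>"
  shows "(correlate Z \<rho> has_derivative (\<lambda>h. - (\<Sum>i\<in>UNIV. h $ i * correlate Z (partial_deriv i \<rho>) x))) (at x)"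
  unfolding has_derivative_at_alt
proof (intro conjI allI impI)
  show "bounded_linear (\<lambda>h. - (\<Sum>i\<in>UNIV. h $ i * correlate Z (partial_deriv i \<rho>) x))"
    by (intro bounded_linear_minus bounded_linear_sum bounded_linear_mult_const bounded_linear_vec_nth)
  fix e :: real assume "e > 0"
  define I where "I = (\<integral>y. \<bar>Z y\<bar> \<partial>lborel)"
  have I: "I \<ge> 0" by (simp add: I_def)
  obtain d where d: "d > 0"
    "\<And>a h. norm h < d \<Longrightarrow> \<bar>\<rho> (a + h) - \<rho> a - (\<Sum>i\<in>UNIV. h $ i * partial_deriv i \<rho> a)\<bar> \<le> e / (I + 1) * norm h"
    using test_fun_remainder[OF t, of "e / (I + 1)"] I \<open>e > 0\<close> by auto
  have int: "integrable lborel (\<lambda>y. Z y * \<rho> (y - x))" for x using integrable_correlate[OF Z t] .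
  have inti: "integrable lborel (\<lambda>y. Z y * partial_deriv i \<rho> (y - x))" for i x
    using integrable_correlate[OF Z test_fun_partial_deriv[OF t]] .
  have "norm (correlate Z \<rho> y - correlate Z \<rho> x - - (\<Sum>i\<in>UNIV. (y - x) $ i * correlate Z (partial_deriv i \<rho>) x)) \<le> e * norm (y - x)"
    if y: "norm (y - x) < d" for y
  proof -
    let ?R = "\<lambda>w. Z w * (\<rho> (w - y) - \<rho> (w - x) - (\<Sum>i\<in>UNIV. (x - y) $ i * partial_deriv i \<rho> (w - x)))"
    have Req: "?R = (\<lambda>w. Z w * \<rho> (w - y) - Z w * \<rho> (w - x) - (\<Sum>i\<in>UNIV. (x - y) $ i * (Z w * partial_deriv i \<rho> (w - x))))"
      by (auto simp: fun_eq_iff right_diff_distrib sum_distrib_left mult_ac)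
    have Ri: "integrable lborel ?R" unfolding Req by (intro Bochner_Integration.integrable_diff int Bochner_Integration.integrable_sum integrable_mult_right inti)
    have "integral\<^sup>L lborel ?R = correlate Z \<rho> y - correlate Z \<rho> x - (\<Sum>i\<in>UNIV. (x - y) $ i * correlate Z (partial_deriv i \<rho>) x)"
      unfolding Req correlate_def
      by (simp add: int inti Bochner_Integration.integral_diff Bochner_Integration.integral_sum)
    also have "\<dots> = correlate Z \<rho> y - correlate Z \<rho> x - - (\<Sum>i\<in>UNIV. (y - x) $ i * correlate Z (partial_deriv i \<rho>) x)"
      by (simp add: sum_negf[symmetric] algebra_simps sum_subtractf)
    finally have "norm (correlate Z \<rho> y - correlate Z \<rho> x - - (\<Sum>i\<in>UNIV. (y - x) $ i * correlate Z (partial_deriv i \<rho>) x)) = norm (integral\<^sup>L lborel ?R)" by simp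
    also have "\<dots> \<le> (\<integral>w. \<bar>Z w\<bar> * (e / (I + 1) * norm (x - y)) \<partial>lborel)"
    proof (rule Bochner_Integration.integral_norm_bound_integral[OF Ri])
      show "integrable lborel (\<lambda>w. \<bar>Z w\<bar> * (e / (I + 1) * norm (x - y)))" using Z by simp
      show "norm (?R w) \<le> \<bar>Z w\<bar> * (e / (I + 1) * norm (x - y))" for w
        using mult_left_mono[OF d(2)[of "x - y" "w - x"], of "\<bar>Z w\<bar>"] y
        by (simp add: abs_mult norm_minus_commute)
    qed
    also have "\<dots> = I / (I + 1) * (e * norm (y - x))" by (simp add: I_def norm_minus_commute)
    also have "\<dots> \<le> 1 * (e * norm (y - x))" using I \<open>e > 0\<close> by (intro mult_right_mono) auto
    finally show ?thesis by simp
  qed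
  then show "\<exists>d>0. \<forall>y. norm (y - x) < d \<longrightarrow> norm (correlate Z \<rho> y - correlate Z \<rho> x - - (\<Sum>i\<in>UNIV. (y - x) $ i * correlate Z (partial_deriv i \<rho>) x)) \<le> e * norm (y - x)"
    using d(1) by blast
qed

lemma partial_deriv_correlate:
  assumes "integrable lborel Z" "test_fun \<Omega> \<rho>"
  shows "partial_deriv i (correlate Z \<rho>) x = - correlate Z (partial_deriv i \<rho>) x"
  using partial_deriv_eqI[OF correlate_has_derivative[OF assms], of i]
  by (simp add: axis_def if_distrib[where f="\<lambda>x. x * _"] cong: if_cong)

text \<open>Up to sign, each partial derivative is again a correlation, with kernel
  \<open>partial_deriv i \<rho>\<close>; hence the induction over all kernels.\<close>

lemma C_k_correlate:
  fixes Z :: "real ^ 'n::finite \<Rightarrow> real"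
  assumes Z: "integrable lborel Z" and t: "test_fun \<Omega> \<rho>"
  shows "C_k k (correlate Z \<rho>)"
  using t
proof (induction k arbitrary: \<rho>)
  case 0
  then show ?case
    using has_derivative_continuous[OF correlate_has_derivative[OF Z]]
    by (auto simp: continuous_on_eq_continuous_at)
next
  case (Suc k)
  have "C_k k (\<lambda>x. (-1) * correlate Z (partial_deriv i \<rho>) x)" for i
    by (intro C_k_mult C_k_const Suc.IH test_fun_partial_deriv Suc.prems)
  moreover have "partial_deriv i (correlate Z \<rho>) = (\<lambda>x. (-1) * correlate Z (partial_deriv i \<rho>) x)" for i
    using partial_deriv_correlate[OF Z Suc.prems] by auto
  ultimately have "C_k k (partial_deriv i (correlate Z \<rho>))" for i by metis
  then show ?case using correlate_has_derivative[OF Z Suc.prems] by (auto simp: differentiable_def)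
qed

text \<open>Difference quotients of \<open>Q\<close> along \<open>v\<close> integrate to 0 by
  translation invariance and converge to \<open>q\<close>. The mean value theorem turns each of them
  into a value of \<open>q\<close> on the segment, so a bound for \<open>q\<close> on
  \<open>K\<close> enlarged by the ball of radius \<open>norm v\<close> dominates them. Derivatives
  along a single direction are the form in which those of the barrier are available.\<close>

lemma integral_directional_derivative:
  fixes Q q :: "'a::euclidean_space \<Rightarrow> real"
  assumes D: "\<And>x. ((\<lambda>t. Q (x + t *\<^sub>R v)) has_real_derivative q x) (at 0)"
    and Qc: "continuous_on UNIV Q" and qc: "continuous_on UNIV q"
    and K: "compact K" "\<And>x. x \<notin> K \<Longrightarrow> Q x = 0" "\<And>x. x \<notin> K \<Longrightarrow> q x = 0"
  shows "(\<integral>x. q x \<partial>lborel) = 0"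
proof -
  have D': "((\<lambda>t. Q (x + t *\<^sub>R v)) has_real_derivative q (x + t *\<^sub>R v)) (at t)" for x t
  proof -
    have "((\<lambda>s. Q (x + (s + t) *\<^sub>R v)) has_real_derivative q (x + t *\<^sub>R v)) (at 0)"
      using D[of "x + t *\<^sub>R v"] by (simp add: algebra_simps)
    then show ?thesis using DERIV_shift[of "\<lambda>t. Q (x + t *\<^sub>R v)" _ 0 t] by simp
  qed
  have "\<exists>B\<ge>0. \<forall>x. \<bar>q x\<bar> \<le> B"
    by (intro bounded_compact_support[OF qc K(1)] K(3))
  then obtain B where B: "B \<ge> 0" "\<And>x. \<bar>q x\<bar> \<le> B" by blast
  define s where "s n x = (Q (x + (1 / Suc n) *\<^sub>R v) - Q x) * Suc n" for n x
  let ?K = "{x + y |x y. x \<in> K \<and> y \<in> cball 0 (norm v)}"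
  have cK: "compact ?K" using K by (intro compact_sums) auto
  have [measurable]: "Q \<in> borel_measurable borel" "q \<in> borel_measurable borel"
    using Qc qc by (auto intro: borel_measurable_continuous_onI)
  have [measurable]: "s n \<in> borel_measurable borel" for n
    unfolding s_def by measurable
  have "(\<lambda>n. integral\<^sup>L lborel (s n)) \<longlonglongrightarrow> integral\<^sup>L lborel q"
  proof (rule integral_dominated_convergence[where w="\<lambda>x. B * indicator ?K x"])
    show "integrable lborel (\<lambda>x. B * indicator ?K x)"
      using emeasure_compact_finite[OF cK] borel_compact[OF cK] by (intro integrable_mult_right) simp
    show "AE x in lborel. (\<lambda>n. s n x) \<longlonglongrightarrow> q x"
    proof (rule AE_I2)
      fix x
      have "((\<lambda>t. (Q (x + t *\<^sub>R v) - Q x) / t) \<longlongrightarrow> q x) (at 0)"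
        using D[of x] by (simp add: has_field_derivative_iff)
      moreover have "filterlim (\<lambda>n. 1 / real (Suc n)) (at 0) sequentially"
        by (rule filterlim_atI) (use LIMSEQ_inverse_real_of_nat in \<open>auto simp: inverse_eq_divide\<close>)
      ultimately have "(\<lambda>n. (Q (x + (1 / real (Suc n)) *\<^sub>R v) - Q x) / (1 / real (Suc n))) \<longlonglongrightarrow> q x"
        by (rule filterlim_compose)
      then show "(\<lambda>n. s n x) \<longlonglongrightarrow> q x" by (simp add: s_def)
    qed
    show "AE x in lborel. norm (s n x) \<le> B * indicator ?K x" for n
    proof (rule AE_I2)
      fix x
      define h where "h = 1 / real (Suc n)"
      have h: "0 < h" "h \<le> 1" by (auto simp: h_def)
      obtain z where z: "0 < z" "z < h" "Q (x + h *\<^sub>R v) - Q (x + 0 *\<^sub>R v) = (h - 0) * q (x + z *\<^sub>R v)"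
        using MVT2[of 0 h "\<lambda>t. Q (x + t *\<^sub>R v)" "\<lambda>t. q (x + t *\<^sub>R v)"] h D' by auto
      then have "s n x = h * q (x + z *\<^sub>R v) * real (Suc n)" by (simp add: s_def h_def)
      also have "\<dots> = q (x + z *\<^sub>R v)" using h by (simp add: h_def)
      finally have seq: "s n x = q (x + z *\<^sub>R v)" .
      show "norm (s n x) \<le> B * indicator ?K x"
      proof (cases "x + z *\<^sub>R v \<in> K")
        case True
        have "x = (x + z *\<^sub>R v) + (- (z *\<^sub>R v))" by simp
        moreover have "- (z *\<^sub>R v) \<in> cball 0 (norm v)"
          using z h mult_right_mono[of z 1 "norm v"] by simp
        ultimately have "x \<in> ?K" using True by blast
        then show ?thesis using B seq by simp
      next
        case False
        then show ?thesis using B seq K by (simp add: indicator_def)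
      qed
    qed
  qed auto
  moreover have "integral\<^sup>L lborel (s n) = 0" for n
  proof -
    have i: "integrable lborel Q" by (rule integrable_compact_support[OF Qc K(1,2)])
    have i': "integrable lborel (\<lambda>x. Q (x + a))" for a
      using integrable_lborel_shift[OF i, of a] by (simp add: add.commute)
    have "(\<integral>x. Q (x + a) \<partial>lborel) = (\<integral>x. Q x \<partial>lborel)" for a
      using integral_lborel_shift[of Q a] by (simp add: add.commute)
    then show ?thesis unfolding s_def using i i' by simp
  qed
  ultimately show ?thesis by (simp add: LIMSEQ_const_iff)
qed

text \<open>The product of \<open>F\<close> and \<open>\<eta>\<close>, extended by 0, has a
  derivative along axis \<open>i\<close> whose integral is 0. Since only that axis is involved, the
  lemma covers both the barrier and the \<open>i\<close>-th component of its flux.\<close>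

lemma integral_by_parts:
  fixes F F' :: "real ^ 'n::finite \<Rightarrow> real"
  assumes B: "open B" and c: "continuous_on B F" "continuous_on B F'"
    and D: "\<And>x. x \<in> B \<Longrightarrow> ((\<lambda>t. F (x + t *\<^sub>R axis i 1)) has_real_derivative F' x) (at 0)"
    and t: "test_fun B \<eta>"
  shows "integrable lborel (\<lambda>x. if x \<in> B then F x * partial_deriv i \<eta> x else 0)"
    and "integrable lborel (\<lambda>x. if x \<in> B then F' x * \<eta> x else 0)"
    and "(\<integral>x. (if x \<in> B then F x * partial_deriv i \<eta> x else 0) \<partial>lborel) =
       - (\<integral>x. (if x \<in> B then F' x * \<eta> x else 0) \<partial>lborel)"
proof -
  obtain K where K: "compact K" "K \<subseteq> B" "\<And>x. x \<notin> K \<Longrightarrow> \<eta> x = 0"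
    using t by (rule test_funE) blast
  have K': "partial_deriv i \<eta> x = 0" if "x \<notin> K" for x
    using partial_deriv_zero_outside[OF compact_imp_closed] K that by blast
  have ce: "continuous_on A \<eta>" "continuous_on A (partial_deriv i \<eta>)" for A
    using test_fun_continuous[OF t] test_fun_continuous[OF test_fun_partial_deriv[OF t]]
    by (auto intro: continuous_on_subset)
  let ?g = "\<lambda>x. if x \<in> B then F x * partial_deriv i \<eta> x else 0"
  let ?h = "\<lambda>x. if x \<in> B then F' x * \<eta> x else 0"
  let ?Q = "\<lambda>x. if x \<in> B then F x * \<eta> x else 0"
  let ?q = "\<lambda>x. if x \<in> B then F x * partial_deriv i \<eta> x + F' x * \<eta> x else 0"
  have cont: "continuous_on UNIV ?g" "continuous_on UNIV ?h" "continuous_on UNIV ?Q" "continuous_on UNIV ?q"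
    by (rule continuous_on_extend_zero[OF B K(1,2)]; use c ce K(3) K' in \<open>auto intro!: continuous_intros\<close>)+
  show i1: "integrable lborel ?g" by (rule integrable_compact_support[OF cont(1) K(1)]) (simp add: K')
  show i2: "integrable lborel ?h" by (rule integrable_compact_support[OF cont(2) K(1)]) (simp add: K)
  have "(\<integral>x. ?q x \<partial>lborel) = 0"
  proof (rule integral_directional_derivative[where v="axis i 1" and Q="?Q", OF _ cont(3,4) K(1)])
    fix x :: "real ^ 'n"
    \<comment> \<open>For small parameters the line stays in the open set \<open>B\<close> or in the
      open complement of \<open>K\<close>, which resolves the case distinction in \<open>?Q\<close>
      locally.\<close>
    have ev: "eventually (\<lambda>t. x + t *\<^sub>R axis i 1 \<in> S) (nhds 0)" if "open S" "x \<in> S" for S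
    proof -
      have "((\<lambda>t. x + t *\<^sub>R axis i 1) \<longlongrightarrow> x + 0 *\<^sub>R axis i 1) (nhds (0::real))"
        by (intro tendsto_intros filterlim_ident)
      then show ?thesis using that unfolding tendsto_def by simp
    qed
    show "((\<lambda>t. ?Q (x + t *\<^sub>R axis i 1)) has_real_derivative ?q x) (at 0)"
    proof (cases "x \<in> B")
      case True
      have "((\<lambda>t. \<eta> (x + t *\<^sub>R axis i 1)) has_real_derivative partial_deriv i \<eta> x) (at 0)"
        using test_fun_along_line[OF t, of x "axis i 1" 0]
        by (simp add: axis_def if_distrib[where f="\<lambda>x. x * _"] cong: if_cong)
      from DERIV_mult[OF D[OF True] this]
      have "((\<lambda>t. F (x + t *\<^sub>R axis i 1) * \<eta> (x + t *\<^sub>R axis i 1)) has_real_derivative ?q x) (at 0)"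
        using True by (simp add: algebra_simps)
      then show ?thesis
        by (rule DERIV_cong_ev[THEN iffD1, rotated -1])
           (use ev[OF B True] in \<open>auto elim: eventually_mono\<close>)
    next
      case False
      then have "x \<in> - K" using K by auto
      have "((\<lambda>t. 0) has_real_derivative ?q x) (at 0)" using False by simp
      then show ?thesis
        by (rule DERIV_cong_ev[THEN iffD1, rotated -1])
           (use ev[OF _ \<open>x \<in> - K\<close>] K in \<open>auto elim: eventually_mono simp: compact_imp_closed open_Compl\<close>)
    qed
  qed (use K K' in auto)
  moreover have "?q x = ?g x + ?h x" for x by simp
  ultimately have "(\<integral>x. ?g x \<partial>lborel) + (\<integral>x. ?h x \<partial>lborel) = 0"
    using i1 i2 by (simp flip: Bochner_Integration.integral_add)
  then show "(\<integral>x. ?g x \<partial>lborel) = - (\<integral>x. ?h x \<partial>lborel)" by simp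
qed

section \<open>Mollification in \<open>L\<^sup>2\<close>\<close>

lemma sum_sq_le2: "((a::real) + b)\<^sup>2 \<le> 2 * a\<^sup>2 + 2 * b\<^sup>2"
  using sum_squares_bound[of a b] by (simp add: power2_sum)

lemma integrable_sq_add:
  fixes f g :: "'a \<Rightarrow> real"
  assumes [measurable]: "f \<in> borel_measurable M" "g \<in> borel_measurable M"
    and i: "integrable M (\<lambda>x. (f x)\<^sup>2)" "integrable M (\<lambda>x. (g x)\<^sup>2)"
  shows "integrable M (\<lambda>x. (f x + g x)\<^sup>2)"
    and "(\<integral>x. (f x + g x)\<^sup>2 \<partial>M) \<le> 2 * (\<integral>x. (f x)\<^sup>2 \<partial>M) + 2 * (\<integral>x. (g x)\<^sup>2 \<partial>M)"
proof -
  show *: "integrable M (\<lambda>x. (f x + g x)\<^sup>2)"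
    by (rule Bochner_Integration.integrable_bound[where f="\<lambda>x. 2 * (f x)\<^sup>2 + 2 * (g x)\<^sup>2"])
      (use i sum_sq_le2 in auto)
  have "(\<integral>x. (f x + g x)\<^sup>2 \<partial>M) \<le> (\<integral>x. 2 * (f x)\<^sup>2 + 2 * (g x)\<^sup>2 \<partial>M)"
    by (rule integral_mono[OF *]) (use i sum_sq_le2 in auto)
  then show "(\<integral>x. (f x + g x)\<^sup>2 \<partial>M) \<le> 2 * (\<integral>x. (f x)\<^sup>2 \<partial>M) + 2 * (\<integral>x. (g x)\<^sup>2 \<partial>M)"
    using i by simp
qed

text \<open>Two truncations make \<open>f\<close> bounded with bounded support: \<open>c k\<close>
  clamps the values to [-k, k], and \<open>\<theta> k\<close> cuts off between the radii
  \<open>k\<close> and \<open>k + 1\<close>. The same truncation of continuous functions converging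
  to \<open>f\<close> almost everywhere has a common integrable bound, so dominated convergence
  applies a second time.\<close>

lemma L2_dense_continuous:
  fixes f :: "'a::euclidean_space \<Rightarrow> real"
  assumes f[measurable]: "f \<in> borel_measurable borel" and i: "integrable lborel (\<lambda>x. (f x)\<^sup>2)" and "e > 0"
  shows "\<exists>\<phi> K. continuous_on UNIV \<phi> \<and> compact K \<and> (\<forall>x. x \<notin> K \<longrightarrow> \<phi> x = 0) \<and>
    integrable lborel (\<lambda>x. (f x - \<phi> x)\<^sup>2) \<and> (\<integral>x. (f x - \<phi> x)\<^sup>2 \<partial>lborel) < e"
proof -
  define c where "c k s = max (- real k) (min s (real k))" for k :: nat and s :: real
  define \<theta> where "\<theta> k x = max 0 (min 1 (real k + 1 - norm x))" for k :: nat and x :: 'a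
  have c: "\<bar>c k s\<bar> \<le> \<bar>s\<bar>" "\<bar>c k s\<bar> \<le> real k" "s * c k s \<ge> 0" for k s
    by (auto simp: c_def max_def min_def intro: mult_nonneg_nonneg mult_nonpos_nonneg)
  have \<theta>: "0 \<le> \<theta> k x" "\<theta> k x \<le> 1" for k x by (auto simp: \<theta>_def)
  have cc: "continuous_on UNIV (c k)" "continuous_on UNIV (\<theta> k)" for k
    unfolding c_def \<theta>_def by (auto intro!: continuous_intros)
  then have [measurable]: "c k \<in> borel_measurable borel" "\<theta> k \<in> borel_measurable borel" for k
    by (auto intro: borel_measurable_continuous_onI)
  have "(\<lambda>k. \<integral>x. (f x - \<theta> k x * c k (f x))\<^sup>2 \<partial>lborel) \<longlonglongrightarrow> (\<integral>x. 0 \<partial>(lborel :: 'a measure))"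
  proof (rule integral_dominated_convergence[where w="\<lambda>x. (f x)\<^sup>2"])
    show "AE x in lborel. (\<lambda>k. (f x - \<theta> k x * c k (f x))\<^sup>2) \<longlonglongrightarrow> 0"
    proof (rule AE_I2, rule tendsto_eventually)
      fix x
      have "\<theta> k x = 1" "c k (f x) = f x" if "nat \<lceil>norm x\<rceil> + nat \<lceil>\<bar>f x\<bar>\<rceil> \<le> k" for k
      proof -
        have "norm x \<le> real k" "\<bar>f x\<bar> \<le> real k" using that by linarith+
        then show "\<theta> k x = 1" "c k (f x) = f x" by (auto simp: \<theta>_def c_def)
      qed
      then show "\<forall>\<^sub>F k in sequentially. (f x - \<theta> k x * c k (f x))\<^sup>2 = 0"
        unfolding eventually_sequentially by (intro exI[of _ "nat \<lceil>norm x\<rceil> + nat \<lceil>\<bar>f x\<bar>\<rceil>"]) auto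
    qed
    show "AE x in lborel. norm ((f x - \<theta> k x * c k (f x))\<^sup>2) \<le> (f x)\<^sup>2" for k
    proof (rule AE_I2)
      fix x
      \<comment> \<open>Truncation keeps the sign and does not increase the modulus, so the error is
        dominated by |f|.\<close>
      have b: "\<bar>\<theta> k x * c k (f x)\<bar> \<le> \<bar>f x\<bar>"
        using mult_mono[OF \<theta>(2)[of k x] c(1)[of k "f x"]] \<theta>(1)[of k x] by (simp add: abs_mult)
      have s: "f x * (\<theta> k x * c k (f x)) \<ge> 0"
        using mult_nonneg_nonneg[OF \<theta>(1)[of k x] c(3)[of "f x" k]] by (simp add: mult_ac)
      have "\<bar>f x - \<theta> k x * c k (f x)\<bar> \<le> \<bar>f x\<bar>"
      proof (cases "f x \<ge> 0")
        case True
        then have "\<theta> k x * c k (f x) \<ge> 0" using s b by (cases "f x = 0") (auto simp: zero_le_mult_iff)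
        then show ?thesis using b True by linarith
      next
        case False
        then have "\<theta> k x * c k (f x) \<le> 0" using s by (auto simp: zero_le_mult_iff)
        then show ?thesis using b False by linarith
      qed
      then show "norm ((f x - \<theta> k x * c k (f x))\<^sup>2) \<le> (f x)\<^sup>2"
        by (simp add: abs_le_square_iff)
    qed
  qed (use i in auto)
  then have "eventually (\<lambda>k. (\<integral>x. (f x - \<theta> k x * c k (f x))\<^sup>2 \<partial>lborel) < e / 4) sequentially"
    by (rule order_tendstoD(2)) (use \<open>e > 0\<close> in simp)
  then obtain k where k: "(\<integral>x. (f x - \<theta> k x * c k (f x))\<^sup>2 \<partial>lborel) < e / 4"
    by (auto simp: eventually_sequentially)
  have "f measurable_on UNIV"
    by (rule lebesgue_measurable_imp_measurable_on_real) (auto simp: measurable_completion)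
  then obtain N g where N: "negligible N" and g: "\<And>n. continuous_on UNIV (g n)" "\<And>x. x \<notin> N \<Longrightarrow> (\<lambda>n. g n x) \<longlonglongrightarrow> f x"
    unfolding measurable_on_def by auto
  have [measurable]: "g n \<in> borel_measurable borel" for n
    using g(1) by (auto intro: borel_measurable_continuous_onI)
  have AEN: "AE x in lborel. x \<notin> N"
    by (rule AE_completion_iff[THEN iffD1], rule AE_not_in) (use N in \<open>simp add: negligible_iff_null_sets\<close>)
  have bnd: "\<bar>\<theta> k x * c k s\<bar> \<le> real k * indicator (cball 0 (real k + 1)) x" for x s
  proof (cases "norm x \<le> real k + 1")
    case True
    then show ?thesis using mult_mono[OF \<theta>(2)[of k x] c(2)[of k s]] \<theta>(1)[of k x] by (simp add: abs_mult)
  qed (auto simp: \<theta>_def)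
  let ?w = "\<lambda>x::'a. (2 * real k)\<^sup>2 * indicator (cball 0 (real k + 1)) x"
  have iw: "integrable lborel ?w"
    using emeasure_compact_finite[of "cball (0::'a) (real k + 1)"]
    by (intro integrable_mult_right integrable_real_indicator) auto
  have bnd2: "(\<theta> k x * c k s - \<theta> k x * c k t)\<^sup>2 \<le> ?w x" for x s t
  proof -
    have "\<bar>\<theta> k x * c k s - \<theta> k x * c k t\<bar> \<le> 2 * real k * indicator (cball 0 (real k + 1)) x"
      using bnd[of x s] bnd[of x t] by linarith
    then have "\<bar>\<theta> k x * c k s - \<theta> k x * c k t\<bar>\<^sup>2 \<le> (2 * real k * indicator (cball 0 (real k + 1)) x)\<^sup>2"
      by (intro power_mono) auto
    then show ?thesis by (cases "x \<in> cball 0 (real k + 1)") (simp_all add: power_mult_distrib)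
  qed
  have "(\<lambda>n. \<integral>x. (\<theta> k x * c k (f x) - \<theta> k x * c k (g n x))\<^sup>2 \<partial>lborel) \<longlonglongrightarrow> (\<integral>x. 0 \<partial>(lborel :: 'a measure))"
  proof (rule integral_dominated_convergence[where w="?w"])
    show "AE x in lborel. (\<lambda>n. (\<theta> k x * c k (f x) - \<theta> k x * c k (g n x))\<^sup>2) \<longlonglongrightarrow> 0"
      using AEN
    proof eventually_elim
      fix x assume "x \<notin> N"
      then have "(\<lambda>n. c k (g n x)) \<longlonglongrightarrow> c k (f x)"
        using cc(1)[of k] g(2) by (auto intro: continuous_on_tendsto_compose)
      then have "(\<lambda>n. (\<theta> k x * c k (f x) - \<theta> k x * c k (g n x))\<^sup>2) \<longlonglongrightarrow> (\<theta> k x * c k (f x) - \<theta> k x * c k (f x))\<^sup>2"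
        by (intro tendsto_intros)
      then show "(\<lambda>n. (\<theta> k x * c k (f x) - \<theta> k x * c k (g n x))\<^sup>2) \<longlonglongrightarrow> 0" by simp
    qed
    show "AE x in lborel. norm ((\<theta> k x * c k (f x) - \<theta> k x * c k (g n x))\<^sup>2) \<le> ?w x" for n
    proof (rule AE_I2)
      fix x show "norm ((\<theta> k x * c k (f x) - \<theta> k x * c k (g n x))\<^sup>2) \<le> ?w x"
        using bnd2[of x "f x" "g n x"] by simp
    qed
  qed (use iw in auto)
  then have "eventually (\<lambda>n. (\<integral>x. (\<theta> k x * c k (f x) - \<theta> k x * c k (g n x))\<^sup>2 \<partial>lborel) < e / 4) sequentially"
    by (rule order_tendstoD(2)) (use \<open>e > 0\<close> in simp)
  then obtain n where n: "(\<integral>x. (\<theta> k x * c k (f x) - \<theta> k x * c k (g n x))\<^sup>2 \<partial>lborel) < e / 4"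
    by (auto simp: eventually_sequentially)
  define \<phi> where "\<phi> x = \<theta> k x * c k (g n x)" for x
  have [measurable]: "\<phi> \<in> borel_measurable borel" unfolding \<phi>_def by measurable
  have "continuous_on UNIV \<phi>"
    unfolding \<phi>_def by (intro continuous_intros cc continuous_on_compose2[OF cc(1) g(1)]) auto
  moreover have "\<forall>x. x \<notin> cball 0 (real k + 1) \<longrightarrow> \<phi> x = 0" by (auto simp: \<phi>_def \<theta>_def)
  moreover have i1: "integrable lborel (\<lambda>x. (f x - \<theta> k x * c k (f x))\<^sup>2)"
  proof -
    have "integrable lborel (\<lambda>x. (\<theta> k x * c k (f x))\<^sup>2)"
    proof (rule Bochner_Integration.integrable_bound[OF iw])
      have "(\<theta> k x * c k (f x) - \<theta> k x * c k 0)\<^sup>2 \<le> ?w x" for x by (rule bnd2)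
      moreover have "c k 0 = 0" by (simp add: c_def)
      ultimately show "AE x in lborel. norm ((\<theta> k x * c k (f x))\<^sup>2) \<le> norm (?w x)" by auto
    qed auto
    then show ?thesis
      using integrable_sq_add(1)[of f lborel "\<lambda>x. - (\<theta> k x * c k (f x))"] i by simp
  qed
  moreover have i2: "integrable lborel (\<lambda>x. (\<theta> k x * c k (f x) - \<phi> x)\<^sup>2)"
  proof (rule Bochner_Integration.integrable_bound[OF iw])
    show "AE x in lborel. norm ((\<theta> k x * c k (f x) - \<phi> x)\<^sup>2) \<le> norm (?w x)"
    proof (rule AE_I2)
      fix x show "norm ((\<theta> k x * c k (f x) - \<phi> x)\<^sup>2) \<le> norm (?w x)"
        using bnd2[of x "f x" "g n x"] by (simp add: \<phi>_def)
    qed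
  qed auto
  moreover have "integrable lborel (\<lambda>x. ((f x - \<theta> k x * c k (f x)) + (\<theta> k x * c k (f x) - \<phi> x))\<^sup>2)"
    by (rule integrable_sq_add) (use i1 i2 in auto)
  \<comment> \<open>The square of a sum costs a factor 2, hence two errors below
    \<open>e / 4\<close> give less than \<open>e\<close>.\<close>
  moreover have "(\<integral>x. ((f x - \<theta> k x * c k (f x)) + (\<theta> k x * c k (f x) - \<phi> x))\<^sup>2 \<partial>lborel) < e"
  proof (rule order.strict_trans1[OF integrable_sq_add(2)])
    have "(\<integral>x. (\<theta> k x * c k (f x) - \<phi> x)\<^sup>2 \<partial>lborel) < e / 4" using n unfolding \<phi>_def .
    then show "2 * (\<integral>x. (f x - \<theta> k x * c k (f x))\<^sup>2 \<partial>lborel) +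
        2 * (\<integral>x. (\<theta> k x * c k (f x) - \<phi> x)\<^sup>2 \<partial>lborel) < e"
      using k by linarith
  qed (use i1 i2 in auto)
  ultimately show ?thesis
    by (intro exI[of _ \<phi>] exI[of _ "cball 0 (real k + 1)"]) auto
qed

text \<open>The difference splits into the approximation errors at \<open>h + x\<close> and at
  \<open>x\<close> and the increment of the continuous approximant \<open>\<phi>\<close>. The
  budgets are \<open>e / 16\<close> for each error and \<open>e / 4\<close> for the increment,
  because (a + b)^2 \<le> 2 a^2 + 2 b^2 is applied twice.\<close>

lemma L2_translation_continuous:
  fixes f :: "'a::euclidean_space \<Rightarrow> real"
  assumes f[measurable]: "f \<in> borel_measurable borel" and i: "integrable lborel (\<lambda>x. (f x)\<^sup>2)" and "e > 0"
  shows "\<exists>d>0. \<forall>h. norm h < d \<longrightarrow> (\<integral>x. (f (h + x) - f x)\<^sup>2 \<partial>lborel) \<le> e"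
proof -
  obtain \<phi> K where \<phi>: "continuous_on UNIV \<phi>" "compact K" "\<And>x. x \<notin> K \<Longrightarrow> \<phi> x = 0"
     "integrable lborel (\<lambda>x. (f x - \<phi> x)\<^sup>2)" "(\<integral>x. (f x - \<phi> x)\<^sup>2 \<partial>lborel) < e / 16"
    using L2_dense_continuous[OF f i, of "e / 16"] \<open>e > 0\<close> by auto
  have [measurable]: "\<phi> \<in> borel_measurable borel"
    using \<phi>(1) by (rule borel_measurable_continuous_onI)
  let ?K = "{x + y |x y. x \<in> K \<and> y \<in> cball 0 1}"
  have cK: "compact ?K" using \<phi> by (intro compact_sums) auto
  define V where "V = measure lborel ?K"
  have V: "V \<ge> 0" by (simp add: V_def)
  \<comment> \<open>\<open>V\<close> is the volume of the unit neighbourhood of \<open>K\<close>,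
    outside which the increment of \<open>\<phi>\<close> vanishes for shifts shorter than 1; an
    increment of at most \<open>\<delta>\<close> there contributes at most
    \<open>e / 4\<close>.\<close>
  define \<delta> where "\<delta> = sqrt (e / (4 * (V + 1)))"
  have \<delta>: "\<delta> > 0" "\<delta>\<^sup>2 * V \<le> e / 4"
  proof -
    show "\<delta> > 0" using V \<open>e > 0\<close> by (simp add: \<delta>_def)
    have "\<delta>\<^sup>2 * V = e / 4 * (V / (V + 1))" using V \<open>e > 0\<close> by (simp add: \<delta>_def)
    also have "\<dots> \<le> e / 4 * 1" using V \<open>e > 0\<close> by (intro mult_left_mono) auto
    finally show "\<delta>\<^sup>2 * V \<le> e / 4" by simp
  qed
  have "\<exists>d>0. \<forall>x y. dist x y < d \<longrightarrow> \<bar>\<phi> x - \<phi> y\<bar> < \<delta>"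
    by (intro uniformly_continuous_compact_support[OF \<phi>(1,2)] \<phi>(3) \<delta>)
  then obtain d where d: "d > 0" "\<And>x y. dist x y < d \<Longrightarrow> \<bar>\<phi> x - \<phi> y\<bar> < \<delta>" by blast
  have "(\<integral>x. (f (h + x) - f x)\<^sup>2 \<partial>lborel) \<le> e" if h: "norm h < min d 1" for h
  proof -
    have p: "(\<phi> (h + x) - \<phi> x)\<^sup>2 \<le> \<delta>\<^sup>2 * indicator ?K x" for x
    proof (cases "x \<in> ?K")
      case True
      have "\<bar>\<phi> (h + x) - \<phi> x\<bar> \<le> \<delta>" using d(2)[of "h + x" x] h by (simp add: dist_norm)
      then have "\<bar>\<phi> (h + x) - \<phi> x\<bar>\<^sup>2 \<le> \<delta>\<^sup>2" by (intro power_mono) auto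
      then show ?thesis using True by simp
    next
      case False
      have "x = x + 0" "0 \<in> cball (0::'a) 1" by auto
      then have "x \<notin> K" using False by blast
      moreover have "x = (h + x) + (- h)" "- h \<in> cball 0 1" using h by auto
      then have "h + x \<notin> K" using False by blast
      ultimately show ?thesis using \<phi>(3) by simp
    qed
    have iw: "integrable lborel (\<lambda>x. \<delta>\<^sup>2 * indicator ?K x)"
      using emeasure_compact_finite[OF cK] borel_compact[OF cK] by (intro integrable_mult_right) simp
    have i2: "integrable lborel (\<lambda>x. (\<phi> (h + x) - \<phi> x)\<^sup>2)"
      by (rule Bochner_Integration.integrable_bound[OF iw]) (use p in auto)
    have "(\<integral>x. (\<phi> (h + x) - \<phi> x)\<^sup>2 \<partial>lborel) \<le> (\<integral>x. \<delta>\<^sup>2 * indicator ?K x \<partial>lborel)"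
      by (rule integral_mono[OF i2 iw p])
    also have "\<dots> = \<delta>\<^sup>2 * V" using borel_compact[OF cK] by (simp add: V_def)
    finally have I2: "(\<integral>x. (\<phi> (h + x) - \<phi> x)\<^sup>2 \<partial>lborel) \<le> e / 4" using \<delta> by linarith
    have i1: "integrable lborel (\<lambda>x. (f (h + x) - \<phi> (h + x))\<^sup>2)"
      using integrable_lborel_shift[OF \<phi>(4)] by simp
    have I1: "(\<integral>x. (f (h + x) - \<phi> (h + x))\<^sup>2 \<partial>lborel) < e / 16"
      using integral_lborel_shift[of "\<lambda>x. (f x - \<phi> x)\<^sup>2" h] \<phi>(5) by simp
    have i3: "integrable lborel (\<lambda>x. (\<phi> x - f x)\<^sup>2)" and I3: "(\<integral>x. (\<phi> x - f x)\<^sup>2 \<partial>lborel) < e / 16"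
      using \<phi>(4,5) by (simp_all add: power2_commute)
    have i13: "integrable lborel (\<lambda>x. ((f (h + x) - \<phi> (h + x)) + (\<phi> x - f x))\<^sup>2)"
      by (rule integrable_sq_add) (use i1 i3 in auto)
    have I13: "(\<integral>x. ((f (h + x) - \<phi> (h + x)) + (\<phi> x - f x))\<^sup>2 \<partial>lborel) \<le> e / 4"
      by (rule order.trans[OF integrable_sq_add(2)]) (use i1 i3 I1 I3 in auto)
    have "(\<integral>x. (((f (h + x) - \<phi> (h + x)) + (\<phi> x - f x)) + (\<phi> (h + x) - \<phi> x))\<^sup>2 \<partial>lborel) \<le>
       2 * (\<integral>x. ((f (h + x) - \<phi> (h + x)) + (\<phi> x - f x))\<^sup>2 \<partial>lborel) + 2 * (\<integral>x. (\<phi> (h + x) - \<phi> x)\<^sup>2 \<partial>lborel)"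
      by (rule integrable_sq_add(2)) (use i13 i2 in auto)
    also have "\<dots> \<le> 2 * (e / 4) + 2 * (e / 4)" using I13 I2 by linarith
    also have "(\<lambda>x. (((f (h + x) - \<phi> (h + x)) + (\<phi> x - f x)) + (\<phi> (h + x) - \<phi> x))\<^sup>2) = (\<lambda>x. (f (h + x) - f x)\<^sup>2)"
      by (auto simp: fun_eq_iff)
    finally show ?thesis by simp
  qed
  then show ?thesis using d(1) by (intro exI[of _ "min d 1"]) auto
qed

lemma weighted_young: "\<theta> > 0 \<Longrightarrow> \<bar>a\<bar> * \<bar>b\<bar> \<le> \<theta> / 2 * a\<^sup>2 + b\<^sup>2 / (2 * \<theta>)" for a b \<theta> :: real
  using sum_squares_bound[of "\<theta> * \<bar>a\<bar>" "\<bar>b\<bar>"]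
  by (simp add: field_simps power2_eq_square)

text \<open>\<open>L\<^sup>2\<close> convergence of mollifications, in the integrated form that avoids Jensen's inequality:
  the weighted Young inequality is applied under the integral before Tonelli.\<close>

lemma mollify_L2:
  fixes A D :: "real ^ 'n::finite \<Rightarrow> real"
  assumes [measurable]: "A \<in> borel_measurable borel" "D \<in> borel_measurable borel"
    and iA: "integrable lborel (\<lambda>x. (A x)\<^sup>2)" and iD: "integrable lborel (\<lambda>x. (D x)\<^sup>2)"
    and D1: "integrable lborel D" and "e > 0"
  shows "\<exists>d>0. \<forall>\<rho>. test_fun UNIV \<rho> \<and> (\<forall>x. 0 \<le> \<rho> x) \<and> (\<forall>x. d \<le> norm x \<longrightarrow> \<rho> x = 0) \<and>
      (\<integral>x. \<rho> x \<partial>lborel) = 1 \<longrightarrow>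
      integrable lborel (\<lambda>x. A x * (correlate D \<rho> x - D x)) \<and>
      (\<integral>x. \<bar>A x * (correlate D \<rho> x - D x)\<bar> \<partial>lborel) \<le> e"
proof -
  define a where "a = (\<integral>x. (A x)\<^sup>2 \<partial>lborel)"
  have a: "a \<ge> 0" by (simp add: a_def)
  \<comment> \<open>The Young weight balances the bound: the term with \<open>A\<close> costs at
    most \<open>e / 2\<close>, and translation errors of at most \<open>e * \<theta>\<close> also
    cost \<open>e / 2\<close> after division by \<open>2 * \<theta>\<close>.\<close>
  define \<theta> where "\<theta> = e / (a + 1)"
  have \<theta>: "\<theta> > 0" using a \<open>e > 0\<close> by (simp add: \<theta>_def)
  have "\<theta> / 2 * a = e / 2 * (a / (a + 1))" by (simp add: \<theta>_def)
  also have "\<dots> \<le> e / 2 * 1" using a \<open>e > 0\<close> by (intro mult_left_mono) auto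
  finally have \<theta>a: "\<theta> / 2 * a \<le> e / 2" by simp
  obtain d where d: "d > 0" "\<And>h. norm h < d \<Longrightarrow> (\<integral>x. (D (h + x) - D x)\<^sup>2 \<partial>lborel) \<le> e * \<theta>"
    using L2_translation_continuous[OF assms(2) iD, of "e * \<theta>"] \<open>e > 0\<close> \<theta> by auto
  have "integrable lborel (\<lambda>x. A x * (correlate D \<rho> x - D x)) \<and>
      (\<integral>x. \<bar>A x * (correlate D \<rho> x - D x)\<bar> \<partial>lborel) \<le> e"
    if t: "test_fun UNIV \<rho>" and \<rho>: "\<And>x. 0 \<le> \<rho> x" "\<And>x. d \<le> norm x \<Longrightarrow> \<rho> x = 0"
      "(\<integral>x. \<rho> x \<partial>lborel) = 1" for \<rho>
  proof -
    have [measurable]: "\<rho> \<in> borel_measurable borel"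
      using test_fun_continuous[OF t] by (rule borel_measurable_continuous_onI)
    \<comment> \<open>A non-integrable function has integral 0 by convention, so the value 1 forces
      integrability.\<close>
    have i\<rho>: "integrable lborel \<rho>" using \<rho>(3) not_integrable_integral_eq by fastforce
    have "continuous_on UNIV (correlate D \<rho>)" using C_k_correlate[OF D1 t, of 0] by simp
    then have [measurable]: "correlate D \<rho> \<in> borel_measurable borel"
      by (rule borel_measurable_continuous_onI)
    \<comment> \<open>Substituting h = y - x and using total mass 1 writes the mollification error
      as an average of translation differences.\<close>
    have diff: "integrable lborel (\<lambda>h. (D (h + x) - D x) * \<rho> h)"
      "(\<integral>h. (D (h + x) - D x) * \<rho> h \<partial>lborel) = correlate D \<rho> x - D x" for x
    proof -
      have i: "integrable lborel (\<lambda>h. D (h + x) * \<rho> h)"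
        using integrable_lborel_shift[OF integrable_correlate[OF D1 t, of x], of x] by (simp add: add.commute)
      show "integrable lborel (\<lambda>h. (D (h + x) - D x) * \<rho> h)"
        using i i\<rho> by (simp add: left_diff_distrib)
      have "(\<integral>h. D (h + x) * \<rho> h \<partial>lborel) = correlate D \<rho> x"
        using integral_lborel_shift[of "\<lambda>y. D y * \<rho> (y - x)" x] by (simp add: correlate_def add.commute)
      then show "(\<integral>h. (D (h + x) - D x) * \<rho> h \<partial>lborel) = correlate D \<rho> x - D x"
        using i i\<rho> \<rho>(3) by (simp add: left_diff_distrib)
    qed
    let ?F = "\<lambda>x h. (\<theta> / 2 * (A x)\<^sup>2 + (D (h + x) - D x)\<^sup>2 / (2 * \<theta>)) * \<rho> h"
    have "ennreal \<bar>A x * (correlate D \<rho> x - D x)\<bar> \<le> (\<integral>\<^sup>+h. ennreal (?F x h) \<partial>lborel)" for x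
    proof -
      have "ennreal \<bar>A x * (correlate D \<rho> x - D x)\<bar> = ennreal (norm (\<integral>h. A x * ((D (h + x) - D x) * \<rho> h) \<partial>lborel))"
        by (simp add: diff)
      also have "\<dots> \<le> (\<integral>\<^sup>+h. ennreal (norm (A x * ((D (h + x) - D x) * \<rho> h))) \<partial>lborel)"
        by (rule integral_norm_bound_ennreal) (simp add: diff)
      also have "\<dots> \<le> (\<integral>\<^sup>+h. ennreal (?F x h) \<partial>lborel)"
      proof (intro nn_integral_mono ennreal_leI)
        fix h
        have "\<bar>A x\<bar> * \<bar>D (h + x) - D x\<bar> * \<rho> h \<le> ?F x h"
          by (intro mult_right_mono weighted_young \<theta> \<rho>)
        then show "norm (A x * ((D (h + x) - D x) * \<rho> h)) \<le> ?F x h"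
          using \<rho>(1)[of h] by (simp add: abs_mult mult.assoc)
      qed
      finally show ?thesis .
    qed
    then have "(\<integral>\<^sup>+x. ennreal \<bar>A x * (correlate D \<rho> x - D x)\<bar> \<partial>lborel)
        \<le> (\<integral>\<^sup>+x. (\<integral>\<^sup>+h. ennreal (?F x h) \<partial>lborel) \<partial>lborel)"
      by (intro nn_integral_mono)
    also have "\<dots> = (\<integral>\<^sup>+h. (\<integral>\<^sup>+x. ennreal (?F x h) \<partial>lborel) \<partial>lborel)"
      by (rule lborel_pair.Fubini') measurable
    also have "\<dots> \<le> (\<integral>\<^sup>+h. ennreal (e * \<rho> h) \<partial>lborel)"
    proof (intro nn_integral_mono)
      fix h
      have iDh: "integrable lborel (\<lambda>x. (D (h + x) - D x)\<^sup>2)"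
        using integrable_sq_add(1)[of "\<lambda>x. D (h + x)" lborel "\<lambda>x. - D x"] integrable_lborel_shift[OF iD, of h] iD by simp
      have "(\<integral>\<^sup>+x. ennreal (?F x h) \<partial>lborel) = ennreal (\<integral>x. ?F x h \<partial>lborel)"
        by (rule nn_integral_eq_integral) (use iA iDh \<theta> \<rho> in auto)
      also have "(\<integral>x. ?F x h \<partial>lborel) = (\<theta> / 2 * a + (\<integral>x. (D (h + x) - D x)\<^sup>2 \<partial>lborel) / (2 * \<theta>)) * \<rho> h"
        using iA iDh by (simp add: a_def)
      also have "\<dots> \<le> e * \<rho> h"
      proof (cases "norm h < d")
        case True
        have "(\<integral>x. (D (h + x) - D x)\<^sup>2 \<partial>lborel) / (2 * \<theta>) \<le> e * \<theta> / (2 * \<theta>)"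
          using d(2)[OF True] \<theta> by (intro divide_right_mono) auto
        also have "\<dots> = e / 2" using \<theta> by simp
        finally show ?thesis using \<theta>a \<rho>(1) by (intro mult_right_mono) auto
      qed (use \<rho>(2)[of h] in auto)
      finally show "(\<integral>\<^sup>+x. ennreal (?F x h) \<partial>lborel) \<le> ennreal (e * \<rho> h)" by (simp add: ennreal_leI)
    qed
    also have "\<dots> = ennreal (\<integral>h. e * \<rho> h \<partial>lborel)"
      by (rule nn_integral_eq_integral) (use i\<rho> \<rho> \<open>e > 0\<close> in auto)
    also have "\<dots> = ennreal e" using \<rho>(3) by simp
    finally have le: "(\<integral>\<^sup>+x. ennreal \<bar>A x * (correlate D \<rho> x - D x)\<bar> \<partial>lborel) \<le> ennreal e" .
    have int: "integrable lborel (\<lambda>x. A x * (correlate D \<rho> x - D x))"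
    proof (rule integrableI_bounded)
      show "(\<lambda>x. A x * (correlate D \<rho> x - D x)) \<in> borel_measurable lborel" by simp
      have "(\<integral>\<^sup>+x. ennreal \<bar>A x * (correlate D \<rho> x - D x)\<bar> \<partial>lborel) < \<infinity>"
        using le by (rule le_less_trans) simp
      then show "(\<integral>\<^sup>+x. ennreal (norm (A x * (correlate D \<rho> x - D x))) \<partial>lborel) < \<infinity>" by simp
    qed
    have "ennreal (\<integral>x. \<bar>A x * (correlate D \<rho> x - D x)\<bar> \<partial>lborel) \<le> ennreal e"
      using le by (subst (asm) nn_integral_eq_integral) (use int in auto)
    then show ?thesis using int \<open>e > 0\<close> by simp
  qed
  then show ?thesis using d(1) by (intro exI[of _ d]) blast
qed

section \<open>The comparison principle\<close>

lemma integral_ge_on_cball: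
  fixes f :: "'a::euclidean_space \<Rightarrow> real"
  assumes i: "integrable lborel f" and nn: "\<And>x. 0 \<le> f x" and b: "\<And>x. x \<in> cball a r \<Longrightarrow> b \<le> f x"
  shows "b * measure lborel (cball a r) \<le> (\<integral>x. f x \<partial>lborel)"
proof -
  have "(\<integral>x. b * indicator (cball a r) x \<partial>lborel) \<le> (\<integral>x. f x \<partial>lborel)"
  proof (rule integral_mono[OF _ i])
    show "integrable lborel (\<lambda>x. b * indicator (cball a r) x)"
      using emeasure_compact_finite[of "cball a r"]
      by (intro integrable_mult_right integrable_real_indicator) auto
    show "b * indicator (cball a r) x \<le> f x" for x
      using nn[of x] b[of x] by (cases "x \<in> cball a r") auto
  qed
  then show ?thesis by simp
qed

lemma partial_deriv_shift:
  assumes "F differentiable (at (y - x))"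
  shows "partial_deriv i (\<lambda>y. F (y - x)) y = partial_deriv i F (y - x)"
proof -
  have "((\<lambda>y. y - x) has_derivative (\<lambda>h. h)) (at y)" by (auto intro!: derivative_eq_intros)
  from has_derivative_compose[OF this frechet_derivative_worksI[OF assms]]
  show ?thesis by (subst partial_deriv_eqI) (auto simp: partial_deriv_def)
qed

text \<open>The bump is divided by its integral, which is positive because the bump has a positive
  minimum on the ball of half the radius. The last clause makes a translate admissible in the weak
  gradient identity as soon as its supporting ball lies in the domain.\<close>

lemma mollifier_exists:
  fixes e :: real
  assumes "e > 0"
  obtains \<rho> :: "real ^ 'n::finite \<Rightarrow> real" where
    "test_fun UNIV \<rho>" "\<And>x. 0 \<le> \<rho> x" "\<And>x. e \<le> norm x \<Longrightarrow> \<rho> x = 0" "(\<integral>x. \<rho> x \<partial>lborel) = 1"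
    "\<And>\<Omega> x. cball x e \<subseteq> \<Omega> \<Longrightarrow> test_fun \<Omega> (\<lambda>y. \<rho> (y - x))"
proof -
  define I where "I = (\<integral>x. bump e (x :: real ^ 'n) \<partial>lborel)"
  have t: "test_fun UNIV (bump e :: real ^ 'n \<Rightarrow> real)"
    using test_fun_bump_shift[OF assms, of 0 UNIV] by simp
  have "compact (cball (0 :: real ^ 'n) e)" by simp
  then have i: "integrable lborel (bump e :: real ^ 'n \<Rightarrow> real)"
    by (rule integrable_compact_support[OF test_fun_continuous[OF t]]) (auto intro!: bump_zero assms)
  have "I > 0"
  proof -
    have bc: "continuous_on (cball 0 (e / 2)) (bump e :: real ^ 'n \<Rightarrow> real)"
      using test_fun_continuous[OF t] by (rule continuous_on_subset) simp
    have "cball (0 :: real ^ 'n) (e / 2) \<noteq> {}" using assms by simp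
    from continuous_attains_inf[OF compact_cball this bc]
    have "\<exists>x0\<in>cball (0 :: real ^ 'n) (e / 2). \<forall>x\<in>cball 0 (e / 2). bump e x0 \<le> bump e (x :: real ^ 'n)" .
    then obtain x0 :: "real ^ 'n" where x0: "x0 \<in> cball 0 (e / 2)" "\<And>x :: real ^ 'n. x \<in> cball 0 (e / 2) \<Longrightarrow> bump e x0 \<le> bump e x"
      by blast
    have "bump e x0 > 0" using x0(1) assms by (subst bump_pos_iff) auto
    then have "0 < bump e x0 * measure lborel (cball (0 :: real ^ 'n) (e / 2))"
      using assms by (intro mult_pos_pos content_cball_pos) auto
    also have "\<dots> \<le> I" unfolding I_def by (rule integral_ge_on_cball[OF i bump_nonneg x0(2)])
    finally show ?thesis .
  qed
  define \<rho> where "\<rho> x = inverse I * bump e x" for x :: "real ^ 'n"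
  have sh: "test_fun \<Omega> (\<lambda>y. \<rho> (y - x))" if "cball x e \<subseteq> \<Omega>" for \<Omega> x
    unfolding \<rho>_def
    by (rule test_funI[where K="cball x e", OF C_k_mult[OF C_k_const C_k_bump_shift]])
      (use that assms in \<open>auto simp: dist_norm norm_minus_commute intro!: bump_zero\<close>)
  have t\<rho>: "test_fun UNIV \<rho>" using sh[of 0 UNIV] by simp
  show ?thesis
  proof (rule that[OF t\<rho>])
    show "(\<integral>x. \<rho> x \<partial>lborel) = 1" using \<open>I > 0\<close> by (simp add: \<rho>_def I_def)
  qed (use \<open>I > 0\<close> bump_nonneg bump_zero[OF assms] sh in \<open>auto simp: \<rho>_def intro!: mult_nonneg_nonneg\<close>)
qed

lemma integrable_L2_mult:
  fixes f g :: "'a \<Rightarrow> real"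
  assumes [measurable]: "f \<in> borel_measurable M" "g \<in> borel_measurable M"
    and "integrable M (\<lambda>x. (f x)\<^sup>2)" "integrable M (\<lambda>x. (g x)\<^sup>2)"
  shows "integrable M (\<lambda>x. f x * g x)"
proof (rule Bochner_Integration.integrable_bound[where f="\<lambda>x. (f x)\<^sup>2 + (g x)\<^sup>2"])
  have "\<bar>a * b\<bar> \<le> \<bar>a\<^sup>2 + b\<^sup>2\<bar>" for a b :: real
  proof -
    have "2 * \<bar>a\<bar> * \<bar>b\<bar> \<le> a\<^sup>2 + b\<^sup>2" using sum_squares_bound[of "\<bar>a\<bar>" "\<bar>b\<bar>"] by simp
    moreover have "0 \<le> \<bar>a\<bar> * \<bar>b\<bar>" by simp
    ultimately show ?thesis unfolding abs_mult by linarith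
  qed
  then show "AE x in M. norm (f x * g x) \<le> norm ((f x)\<^sup>2 + (g x)\<^sup>2)" by simp
qed (use assms in auto)

text \<open>Continuity up to the closed ball gives boundedness. Cutting at the open ball lets
  functions known only near \<open>a\<close> enter integrals over the whole space, where translation
  invariance is available.\<close>

lemma cut_to_ball:
  fixes f :: "'a::euclidean_space \<Rightarrow> real"
  assumes "continuous_on (cball a r) f"
  shows "integrable lborel (\<lambda>x. if x \<in> ball a r then f x else 0)"
    and "(\<lambda>x. if x \<in> ball a r then f x else 0) \<in> borel_measurable borel"
    and "integrable lborel (\<lambda>x. (if x \<in> ball a r then f x else 0)\<^sup>2)"
proof -
  have *: "integrable lborel (\<lambda>x. if x \<in> ball a r then f x else 0)"
    if "continuous_on (cball a r) f" for f :: "'a \<Rightarrow> real"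
  proof -
    have "integrable lborel (\<lambda>x. indicator (ball a r) x *\<^sub>R (indicator (cball a r) x *\<^sub>R f x))"
      by (intro integrable_mult_indicator borel_integrable_compact that) auto
    moreover have "(\<lambda>x. indicator (ball a r) x *\<^sub>R (indicator (cball a r) x *\<^sub>R f x)) = (\<lambda>x. if x \<in> ball a r then f x else 0)"
      by (auto simp: fun_eq_iff indicator_def)
    ultimately show ?thesis by metis
  qed
  show "integrable lborel (\<lambda>x. if x \<in> ball a r then f x else 0)" by (rule *[OF assms])
  then show "(\<lambda>x. if x \<in> ball a r then f x else 0) \<in> borel_measurable borel"
    using borel_measurable_integrable by fastforce
  have "integrable lborel (\<lambda>x. if x \<in> ball a r then (f x)\<^sup>2 else 0)"
    by (intro * continuous_intros assms)
  moreover have "(\<lambda>x. if x \<in> ball a r then (f x)\<^sup>2 else 0) = (\<lambda>x. (if x \<in> ball a r then f x else 0)\<^sup>2)"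
    by (auto simp: fun_eq_iff)
  ultimately show "integrable lborel (\<lambda>x. (if x \<in> ball a r then f x else 0)\<^sup>2)" by metis
qed

lemma expoly_1_mono: "s \<le> t \<Longrightarrow> expoly 1 s \<le> expoly 1 t"
proof (rule DERIV_nonneg_imp_nondecreasing[of s t "expoly 1"])
  fix x show "\<exists>y. (expoly 1 has_real_derivative y) (at x) \<and> 0 \<le> y"
    using expoly_deriv[of 1 x] expoly_bounds(4)[of x] by (intro exI[of _ "expoly (monom 1 2) x"]) simp
qed

text \<open>Here \<open>l i\<close> is the flux in direction \<open>i\<close>, \<open>V\<close> the
  weak gradient of \<open>u\<close>, \<open>W\<close> consists of the partial derivatives of
  \<open>w\<close>, and \<open>\<kappa> i\<close> differentiates the flux
  \<open>l i (W x $ i)\<close> along axis \<open>i\<close>; a positive sum of the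
  \<open>\<kappa> i\<close> expresses a strict subsolution. Combining the integrated equation of
  \<open>w\<close> with the inequality for \<open>u\<close> leaves the flux difference
  \<open>A\<close> against the gradient of the test function. If that gradient were a nonnegative
  multiple of \<open>D\<close>, monotonicity of the flux would already contradict the positive
  source term; mollification replaces \<open>D\<close> by its average, and the L2 estimate controls
  the exchange.\<close>

lemma comparison_principle:
  fixes u w :: "real ^ 'n::finite \<Rightarrow> real" and V W :: "real ^ 'n \<Rightarrow> real ^ 'n"
    and l :: "'n \<Rightarrow> real \<Rightarrow> real" and \<kappa> :: "'n \<Rightarrow> real ^ 'n \<Rightarrow> real"
  assumes "\<delta> > 0" "open U" "cball a \<delta> \<subseteq> U"
    and uc: "continuous_on (cball a \<delta>) u"
    and Vm: "\<And>i. (\<lambda>x. V x $ i) \<in> borel_measurable borel"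
    and V2: "\<And>i. integrable lborel (\<lambda>x. (V x $ i)\<^sup>2)"
    and Vgrad: "\<And>\<phi> i. test_fun (ball a \<delta>) \<phi> \<Longrightarrow>
       (\<integral>x. (if x \<in> ball a \<delta> then u x * partial_deriv i \<phi> x else 0) \<partial>lborel) = - (\<integral>x. V x $ i * \<phi> x \<partial>lborel)"
    and super: "\<And>\<eta>. test_fun (ball a \<delta>) \<eta> \<Longrightarrow> (\<And>x. 0 \<le> \<eta> x) \<Longrightarrow>
       0 \<le> (\<integral>x. (\<Sum>i\<in>UNIV. l i (V x $ i) * partial_deriv i \<eta> x) \<partial>lborel)"
    and lc: "\<And>i. continuous_on UNIV (l i)" and lmono: "\<And>i. mono (l i)" and lgrow: "\<And>i s. \<bar>l i s\<bar> \<le> C * \<bar>s\<bar>"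
    and wc: "continuous_on U w" and Wc: "\<And>i. continuous_on U (\<lambda>x. W x $ i)"
    and wW: "\<And>i x. x \<in> U \<Longrightarrow> ((\<lambda>t. w (x + t *\<^sub>R axis i 1)) has_real_derivative W x $ i) (at 0)"
    and \<kappa>c: "\<And>i. continuous_on U (\<kappa> i)"
    and W\<kappa>: "\<And>i x. x \<in> U \<Longrightarrow> ((\<lambda>t. l i (W (x + t *\<^sub>R axis i 1) $ i)) has_real_derivative \<kappa> i x) (at 0)"
    and \<kappa>pos: "\<And>x. x \<in> cball a \<delta> \<Longrightarrow> 0 < (\<Sum>i\<in>UNIV. \<kappa> i x)"
    and sphere: "\<And>x. x \<in> sphere a \<delta> \<Longrightarrow> w x < u x"
  shows "w a < u a"
proof (rule ccontr)
  assume "\<not> w a < u a"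
  then have wu: "u a \<le> w a" by simp
  let ?B = "ball a \<delta>"
  have sub: "continuous_on (cball a \<delta>) f" if "continuous_on U f" for f :: "real ^ 'n \<Rightarrow> real"
    using that \<open>cball a \<delta> \<subseteq> U\<close> continuous_on_subset by blast
  have subB: "continuous_on ?B f" if "continuous_on U f" for f :: "real ^ 'n \<Rightarrow> real"
    using that \<open>cball a \<delta> \<subseteq> U\<close> ball_subset_cball continuous_on_subset by (metis order_trans)
  have BU: "x \<in> U" if "x \<in> ?B" for x using that \<open>cball a \<delta> \<subseteq> U\<close> by auto
  have dc: "continuous_on (cball a \<delta>) (\<lambda>x. w x - u x)" by (intro continuous_intros sub wc uc)
  obtain c where c: "c > 0" "\<And>x. x \<in> sphere a \<delta> \<Longrightarrow> w x - u x < - c"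
  proof (cases "sphere a \<delta> = {}")
    case True then show ?thesis using that[of 1] by simp
  next
    case False
    have "\<exists>z\<in>sphere a \<delta>. \<forall>x\<in>sphere a \<delta>. w x - u x \<le> w z - u z"
      by (rule continuous_attains_sup[OF compact_sphere False continuous_on_subset[OF dc sphere_cball]])
    then obtain z where z: "z \<in> sphere a \<delta>" "\<And>x. x \<in> sphere a \<delta> \<Longrightarrow> w x - u x \<le> w z - u z" by blast
    have "w z < u z" by (rule sphere[OF z(1)])
    show ?thesis
    proof (rule that[of "(u z - w z) / 2"])
      show "w x - u x < - ((u z - w z) / 2)" if "x \<in> sphere a \<delta>" for x
        using z(2)[OF that] \<open>w z < u z\<close> by (simp add: field_simps)
    qed (use \<open>w z < u z\<close> in simp)
  qed
  \<comment> \<open>The gap \<open>c\<close> on the sphere keeps this compact superlevel set inside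
    the open ball, so its farthest point from \<open>a\<close> has a distance \<open>r0\<close>
    below \<open>\<delta>\<close>.\<close>
  define K where "K = {x \<in> cball a \<delta>. - c \<le> w x - u x}"
  have "K = cball a \<delta> \<inter> (\<lambda>x. w x - u x) -` {- c..}" by (auto simp: K_def)
  moreover have "closed (cball a \<delta> \<inter> (\<lambda>x. w x - u x) -` {- c..})"
    by (intro continuous_closed_preimage dc) auto
  moreover have "bounded (cball a \<delta> \<inter> (\<lambda>x. w x - u x) -` {- c..})"
    by (rule bounded_subset[OF bounded_cball[of a \<delta>]]) auto
  ultimately have "compact K" by (simp add: compact_eq_bounded_closed)
  moreover have "a \<in> K" using wu c(1) \<open>\<delta> > 0\<close> by (simp add: K_def)
  ultimately have "\<exists>z\<in>K. \<forall>x\<in>K. dist a x \<le> dist a z"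
    by (intro continuous_attains_sup) (auto intro!: continuous_intros)
  then obtain z where z: "z \<in> K" "\<And>x. x \<in> K \<Longrightarrow> dist a x \<le> dist a z" by blast
  define r0 where "r0 = dist a z"
  have r0: "0 \<le> r0" "r0 < \<delta>"
  proof -
    have "r0 \<noteq> \<delta>" using c(2)[of z] z(1) by (auto simp: K_def r0_def)
    then show "r0 < \<delta>" using z(1) by (auto simp: K_def r0_def)
  qed (simp add: r0_def)
  have low: "w x - u x < - c" if "x \<in> ?B" "r0 < dist a x" for x
    by (rule ccontr) (use z(2)[of x] that in \<open>auto simp: K_def r0_def\<close>)
  \<comment> \<open>The radius halfway leaves room for averaging on both sides: inward to keep
    averages of \<open>Z\<close> at most 1, outward to keep the shifted kernel inside the
    ball.\<close>
  define r1 where "r1 = (r0 + \<delta>) / 2"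
  have r1: "r0 < r1" "r1 < \<delta>" using r0 by (auto simp: r1_def)
  \<comment> \<open>The shift by \<open>1 + c\<close> puts the values beyond \<open>r0\<close>, and
    the 0 outside the ball, at most at 1, while values near \<open>a\<close> are at least
    \<open>1 + c / 2\<close>.\<close>
  define Z where "Z x = (if x \<in> ?B then 1 + c + (w x - u x) else 0)" for x
  have iZ: "integrable lborel Z" unfolding Z_def[abs_def]
    by (intro cut_to_ball continuous_intros dc)
  have Zle: "Z x \<le> 1" if "r0 < dist a x" for x
    using low[of x] that by (cases "x \<in> ball a \<delta>") (simp_all add: Z_def)
  \<comment> \<open>\<open>D\<close> is the gradient of w - u, and \<open>A\<close> below is the
    flux of \<open>u\<close> minus the flux of \<open>w\<close>; both are extended by 0.\<close>
  define D where "D i x = (if x \<in> ?B then W x $ i else 0) + (if x \<in> ?B then - V x $ i else 0)" for i x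
  define A where "A i x = (if x \<in> ?B then l i (V x $ i) else 0) + (if x \<in> ?B then - l i (W x $ i) else 0)" for i x
  note Vm[measurable]
  have lm[measurable]: "l i \<in> borel_measurable borel" for i
    using lc by (auto intro: borel_measurable_continuous_onI)
  have lWc: "continuous_on U (\<lambda>x. l i (W x $ i))" for i
    by (rule continuous_on_compose2[OF lc Wc]) auto
  note cW = cut_to_ball[OF sub[OF Wc]]
  have lV2: "integrable lborel (\<lambda>x. (l i (V x $ i))\<^sup>2)" for i
  proof (rule Bochner_Integration.integrable_bound[where f="\<lambda>x. C\<^sup>2 * (V x $ i)\<^sup>2"])
    have "(l i s)\<^sup>2 \<le> C\<^sup>2 * s\<^sup>2" for s
    proof -
      have "\<bar>l i s\<bar>\<^sup>2 \<le> (C * \<bar>s\<bar>)\<^sup>2" by (intro power_mono lgrow) auto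
      then show ?thesis by (simp add: power_mult_distrib)
    qed
    then show "AE x in lborel. norm ((l i (V x $ i))\<^sup>2) \<le> norm (C\<^sup>2 * (V x $ i)\<^sup>2)" by simp
  qed (use V2 in auto)
  have cut2: "integrable lborel (\<lambda>x. (if x \<in> ?B then f x else 0)\<^sup>2)"
    if [measurable]: "f \<in> borel_measurable borel" and "integrable lborel (\<lambda>x. (f x)\<^sup>2)" for f :: "real ^ 'n \<Rightarrow> real"
    by (rule Bochner_Integration.integrable_bound[OF that(2)]) auto
  have cutm: "(\<lambda>x. if x \<in> ?B then f x else 0) \<in> borel_measurable borel"
    if "f \<in> borel_measurable borel" for f :: "real ^ 'n \<Rightarrow> real"
    by (rule measurable_If_set) (use that in auto)
  have cl: "continuous_on (cball a \<delta>) (\<lambda>x. - l i (W x $ i))" for i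
    by (intro continuous_intros sub lWc)
  note cL = cut_to_ball[OF cl]
  have Dm[measurable]: "D i \<in> borel_measurable borel" for i
    unfolding D_def[abs_def] by (intro borel_measurable_add cW(2) cutm) measurable
  have Am[measurable]: "A i \<in> borel_measurable borel" for i
    unfolding A_def[abs_def] by (intro borel_measurable_add cL(2) cutm) measurable
  have D2: "integrable lborel (\<lambda>x. (D i x)\<^sup>2)" for i
    unfolding D_def
  proof (rule integrable_sq_add(1))
    show "integrable lborel (\<lambda>x. (if x \<in> ?B then - V x $ i else 0)\<^sup>2)"
      by (rule cut2) (use V2[of i] in auto)
    have "(\<lambda>x. - V x $ i) \<in> borel_measurable borel" by measurable
    from cutm[OF this] show "(\<lambda>x. if x \<in> ?B then - V x $ i else 0) \<in> borel_measurable lborel" by simp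
    show "(\<lambda>x. if x \<in> ?B then W x $ i else 0) \<in> borel_measurable lborel" using cW(2)[of i] by simp
  qed (rule cW)
  have A2: "integrable lborel (\<lambda>x. (A i x)\<^sup>2)" for i
    unfolding A_def
  proof (rule integrable_sq_add(1))
    show "integrable lborel (\<lambda>x. (if x \<in> ?B then l i (V x $ i) else 0)\<^sup>2)"
      by (rule cut2) (use lV2[of i] in auto)
    have "(\<lambda>x. l i (V x $ i)) \<in> borel_measurable borel" by measurable
    from cutm[OF this] show "(\<lambda>x. if x \<in> ?B then l i (V x $ i) else 0) \<in> borel_measurable lborel" by simp
    show "(\<lambda>x. if x \<in> ?B then - l i (W x $ i) else 0) \<in> borel_measurable lborel" using cL(2)[of i] by simp
  qed (rule cL)
  have D1: "integrable lborel (D i)" for i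
  proof (rule Bochner_Integration.integrable_bound[where f="\<lambda>x. indicator ?B x + (D i x)\<^sup>2"])
    have "\<bar>s\<bar> \<le> 1 + s\<^sup>2" for s :: real
      using sum_squares_bound[of 1 "\<bar>s\<bar>"] by simp
    then show "AE x in lborel. norm (D i x) \<le> norm (indicator ?B x + (D i x)\<^sup>2)"
      by (intro AE_I2) (auto simp: indicator_def D_def)
    have "integrable lborel (indicat_real ?B)"
      using emeasure_bounded_finite[of ?B] by (intro integrable_real_indicator) auto
    then show "integrable lborel (\<lambda>x. indicator ?B x + (D i x)\<^sup>2)" using D2 by simp
  qed simp
  \<comment> \<open>The only place where ellipticity enters: it is enough that the flux is monotone.\<close>
  have AD: "A i x * D i x \<le> 0" for i x
  proof (cases "V x $ i \<le> W x $ i")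
    case True
    then have "l i (V x $ i) \<le> l i (W x $ i)" using lmono monoD by blast
    then show ?thesis using True by (simp add: A_def D_def mult_nonpos_nonneg)
  next
    case False
    then have "l i (W x $ i) \<le> l i (V x $ i)" using lmono[of i] by (auto elim: monoD)
    then show ?thesis using False by (simp add: A_def D_def mult_nonneg_nonpos)
  qed
  have test2: "integrable lborel (\<lambda>x. (\<phi> x)\<^sup>2)" "\<phi> \<in> borel_measurable borel"
    if t: "test_fun ?B \<phi>" for \<phi>
  proof -
    obtain K where K: "compact K" "K \<subseteq> ?B" "\<And>x. x \<notin> K \<Longrightarrow> \<phi> x = 0" using t by (rule test_funE) blast
    show "integrable lborel (\<lambda>x. (\<phi> x)\<^sup>2)"
      by (rule integrable_compact_support[OF _ K(1)]) (use K in \<open>auto intro!: continuous_intros test_fun_continuous[OF t]\<close>)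
    show "\<phi> \<in> borel_measurable borel" using test_fun_continuous[OF t] by (rule borel_measurable_continuous_onI)
  qed
  have out: "\<phi> x = 0" if t: "test_fun ?B \<phi>" and x: "x \<notin> ?B" for \<phi> x
  proof -
    obtain K where "K \<subseteq> ?B" "\<And>x. x \<notin> K \<Longrightarrow> \<phi> x = 0" using t by (rule test_funE) blast
    then show ?thesis using x by blast
  qed
  have gradZ: "(\<integral>x. Z x * partial_deriv i \<phi> x \<partial>lborel) = - (\<integral>x. D i x * \<phi> x \<partial>lborel)"
    if t: "test_fun ?B \<phi>" for \<phi> i
  proof -
    have "((\<lambda>t. 1 + c + w (x + t *\<^sub>R axis i 1)) has_real_derivative W x $ i) (at 0)" if "x \<in> ?B" for x
      using wW[OF BU[OF that], of i] by (auto intro!: derivative_eq_intros)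
    moreover have "continuous_on ?B (\<lambda>x. 1 + c + w x)" by (intro continuous_intros subB wc)
    ultimately
    have 1: "integrable lborel (\<lambda>x. if x \<in> ?B then (1 + c + w x) * partial_deriv i \<phi> x else 0)"
       "integrable lborel (\<lambda>x. if x \<in> ?B then W x $ i * \<phi> x else 0)"
       "(\<integral>x. (if x \<in> ?B then (1 + c + w x) * partial_deriv i \<phi> x else 0) \<partial>lborel) =
         - (\<integral>x. (if x \<in> ?B then W x $ i * \<phi> x else 0) \<partial>lborel)"
      using integral_by_parts[OF open_ball _ subB[OF Wc] _ t, of "\<lambda>x. 1 + c + w x" i i] by blast+
    have pc: "continuous_on (cball a \<delta>) (partial_deriv i \<phi>)"
      using test_fun_continuous[OF test_fun_partial_deriv[OF t]] continuous_on_subset by blast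
    have 2: "integrable lborel (\<lambda>x. if x \<in> ?B then u x * partial_deriv i \<phi> x else 0)"
      by (intro cut_to_ball continuous_intros uc pc)
    have 3: "integrable lborel (\<lambda>x. V x $ i * \<phi> x)"
      by (rule integrable_L2_mult) (use V2 test2[OF t] in auto)
    have "(\<integral>x. Z x * partial_deriv i \<phi> x \<partial>lborel) =
      (\<integral>x. (if x \<in> ?B then (1 + c + w x) * partial_deriv i \<phi> x else 0) -
         (if x \<in> ?B then u x * partial_deriv i \<phi> x else 0) \<partial>lborel)"
      by (rule Bochner_Integration.integral_cong) (auto simp: Z_def algebra_simps)
    also have "\<dots> = - (\<integral>x. (if x \<in> ?B then W x $ i * \<phi> x else 0) \<partial>lborel) + (\<integral>x. V x $ i * \<phi> x \<partial>lborel)"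
      using 1 2 Vgrad[OF t] by simp
    also have "\<dots> = - (\<integral>x. (if x \<in> ?B then W x $ i * \<phi> x else 0) - V x $ i * \<phi> x \<partial>lborel)"
      using 1 3 by simp
    also have "(\<integral>x. (if x \<in> ?B then W x $ i * \<phi> x else 0) - V x $ i * \<phi> x \<partial>lborel) = (\<integral>x. D i x * \<phi> x \<partial>lborel)"
      by (rule Bochner_Integration.integral_cong) (auto simp: D_def algebra_simps out[OF t])
    finally show ?thesis .
  qed
  \<comment> \<open>The lower bound \<open>\<beta>\<close> for the source term must be fixed before the mollification radius.\<close>
  have "isCont (\<lambda>x. w x - u x) a"
    using continuous_on_interior[OF dc] \<open>\<delta> > 0\<close> by simp
  then obtain s' where s': "s' > 0" "\<And>x. dist x a < s' \<Longrightarrow> dist (w x - u x) (w a - u a) < c / 2"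
    using c(1) unfolding continuous_at_eps_delta by (auto elim!: allE[of _ "c / 2"])
  \<comment> \<open>Averages with a radius below \<open>s\<close> at points of
    \<open>cball a s\<close> only see points within \<open>2 * s\<close> of \<open>a\<close>, where
    \<open>Z\<close> is at least \<open>1 + c / 2\<close>.\<close>
  define s where "s = min s' \<delta> / 3"
  have s: "0 < s" "2 * s < s'" "2 * s < \<delta>" using s'(1) \<open>\<delta> > 0\<close> by (auto simp: s_def)
  have Zbig: "1 + c / 2 \<le> Z x" if "dist a x < 2 * s" for x
  proof -
    have "dist (w x - u x) (w a - u a) < c / 2" using s'(2)[of x] that s by (simp add: dist_commute)
    then have "- (c / 2) < w x - u x" using wu unfolding dist_real_def abs_less_iff by linarith
    moreover have "x \<in> ?B" using that s by simp
    ultimately show ?thesis by (simp add: Z_def field_simps)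
  qed
  have sB: "cball a s \<subseteq> cball a \<delta>" using s by auto
  have \<kappa>sc: "continuous_on (cball a \<delta>) (\<lambda>x. \<Sum>i\<in>UNIV. \<kappa> i x)" by (intro continuous_intros sub \<kappa>c)
  have "\<exists>z\<in>cball a s. \<forall>x\<in>cball a s. (\<Sum>i\<in>UNIV. \<kappa> i z) \<le> (\<Sum>i\<in>UNIV. \<kappa> i x)"
    using s by (intro continuous_attains_inf continuous_on_subset[OF \<kappa>sc sB]) auto
  then obtain z where z: "z \<in> cball a s" "\<And>x. x \<in> cball a s \<Longrightarrow> (\<Sum>i\<in>UNIV. \<kappa> i z) \<le> (\<Sum>i\<in>UNIV. \<kappa> i x)" by blast
  define k0 where "k0 = (\<Sum>i\<in>UNIV. \<kappa> i z)"
  have k0: "k0 > 0" unfolding k0_def using \<kappa>pos z(1) sB by blast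
  \<comment> \<open>On \<open>cball a s\<close> the source is at least \<open>k0\<close> and the
    test function at least \<open>expoly 1 (c / 2)\<close>, for every kernel of radius below
    \<open>s\<close>.\<close>
  define \<beta> where "\<beta> = k0 * expoly 1 (c / 2) * measure lborel (cball a s)"
  have \<beta>: "\<beta> > 0" unfolding \<beta>_def using k0 c(1) s by (intro mult_pos_pos expoly_bounds content_cball_pos) auto
  define N where "N = real CARD('n)"
  have N: "N > 0" by (simp add: N_def)
  \<comment> \<open>The tolerance is doubled by the bound on \<open>q\<close> and summed over
    \<open>N\<close> directions, which leaves a total error of \<open>\<beta> / 2\<close>.\<close>
  have "\<exists>d>0. \<forall>\<rho>. test_fun UNIV \<rho> \<and> (\<forall>x. 0 \<le> \<rho> x) \<and> (\<forall>x. d \<le> norm x \<longrightarrow> \<rho> x = 0) \<and>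
      (\<integral>x. \<rho> x \<partial>lborel) = 1 \<longrightarrow>
      integrable lborel (\<lambda>x. A i x * (correlate (D i) \<rho> x - D i x)) \<and>
      (\<integral>x. \<bar>A i x * (correlate (D i) \<rho> x - D i x)\<bar> \<partial>lborel) \<le> \<beta> / (4 * N)" for i
    using \<beta> N by (intro mollify_L2 Am Dm A2 D2 D1) auto
  then have "\<forall>i. \<exists>d. d > 0 \<and> (\<forall>\<rho>. test_fun UNIV \<rho> \<and> (\<forall>x. 0 \<le> \<rho> x) \<and> (\<forall>x. d \<le> norm x \<longrightarrow> \<rho> x = 0) \<and>
      (\<integral>x. \<rho> x \<partial>lborel) = 1 \<longrightarrow>
      integrable lborel (\<lambda>x. A i x * (correlate (D i) \<rho> x - D i x)) \<and>
      (\<integral>x. \<bar>A i x * (correlate (D i) \<rho> x - D i x)\<bar> \<partial>lborel) \<le> \<beta> / (4 * N))" by blast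
  then obtain d where d: "\<forall>i. d i > 0 \<and> (\<forall>\<rho>. test_fun UNIV \<rho> \<and> (\<forall>x. 0 \<le> \<rho> x) \<and> (\<forall>x. d i \<le> norm x \<longrightarrow> \<rho> x = 0) \<and>
      (\<integral>x. \<rho> x \<partial>lborel) = 1 \<longrightarrow>
      integrable lborel (\<lambda>x. A i x * (correlate (D i) \<rho> x - D i x)) \<and>
      (\<integral>x. \<bar>A i x * (correlate (D i) \<rho> x - D i x)\<bar> \<partial>lborel) \<le> \<beta> / (4 * N))"
    unfolding choice_iff by blast
  define e where "e = min (Min (range d)) (min s (r1 - r0)) / 2"
  have Md: "0 < Min (range d)" "Min (range d) \<le> d i" for i using d by auto
  have e: "0 < e" "e < s" "e < r1 - r0" "\<And>i. e \<le> d i"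
  proof -
    show "0 < e" "e < s" "e < r1 - r0" using Md(1) s(1) r1 by (auto simp: e_def)
    have "2 * e \<le> Min (range d)" unfolding e_def using min.cobounded1 by auto
    then have "e \<le> Min (range d)" using \<open>0 < e\<close> by linarith
    then show "e \<le> d i" for i using Md(2)[of i] by simp
  qed
  have e2: "r1 + e < \<delta>" using e(3) by (simp add: r1_def field_simps)
  obtain \<rho> :: "real ^ 'n \<Rightarrow> real" where t: "test_fun UNIV \<rho>" and \<rho>: "\<And>x. 0 \<le> \<rho> x"
      "\<And>x. e \<le> norm x \<Longrightarrow> \<rho> x = 0" "(\<integral>x. \<rho> x \<partial>lborel) = 1"
    and tsh: "\<And>\<Omega> x. cball x e \<subseteq> \<Omega> \<Longrightarrow> test_fun \<Omega> (\<lambda>y. \<rho> (y - x))"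
    using e(1) by (rule mollifier_exists) blast
  have i\<rho>: "integrable lborel \<rho>" using \<rho>(3) not_integrable_integral_eq by fastforce
  have i\<rho>s: "integrable lborel (\<lambda>y. \<rho> (y - x))" "(\<integral>y. \<rho> (y - x) \<partial>lborel) = 1" for x
    using integrable_lborel_shift[OF i\<rho>, of "- x"] integral_lborel_shift[of \<rho> "- x"] \<rho>(3) i\<rho> by simp_all
  have moll: "integrable lborel (\<lambda>x. A i x * (correlate (D i) \<rho> x - D i x))"
      "(\<integral>x. \<bar>A i x * (correlate (D i) \<rho> x - D i x)\<bar> \<partial>lborel) \<le> \<beta> / (4 * N)" for i
  proof -
    have "\<forall>x. d i \<le> norm x \<longrightarrow> \<rho> x = 0" using \<rho>(2) e(4)[of i] by force
    then have "test_fun UNIV \<rho> \<and> (\<forall>x. 0 \<le> \<rho> x) \<and> (\<forall>x. d i \<le> norm x \<longrightarrow> \<rho> x = 0) \<and> (\<integral>x. \<rho> x \<partial>lborel) = 1"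
      using t \<rho> by simp
    from d[THEN spec, of i, THEN conjunct2, THEN spec, of \<rho>, THEN mp, OF this]
    show "integrable lborel (\<lambda>x. A i x * (correlate (D i) \<rho> x - D i x))"
      "(\<integral>x. \<bar>A i x * (correlate (D i) \<rho> x - D i x)\<bar> \<partial>lborel) \<le> \<beta> / (4 * N)" by simp_all
  qed
  let ?Z = "correlate Z \<rho>"
  have iZ\<rho>: "integrable lborel (\<lambda>y. Z y * \<rho> (y - x))" for x using integrable_correlate[OF iZ t] .
  have Zsmall: "?Z x \<le> 1" if x: "r1 < dist a x" for x
  proof -
    have "?Z x \<le> (\<integral>y. \<rho> (y - x) \<partial>lborel)" unfolding correlate_def
    proof (rule integral_mono[OF iZ\<rho> i\<rho>s(1)])
      fix y
      show "Z y * \<rho> (y - x) \<le> \<rho> (y - x)"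
      proof (cases "norm (y - x) < e")
        case True
        then have "r0 < dist a y" using x e(3) dist_triangle[of a x y] by (simp add: dist_norm)
        then show ?thesis using mult_right_mono[OF Zle \<rho>(1)] by fastforce
      qed (simp add: \<rho>)
    qed
    then show ?thesis by (simp add: i\<rho>s)
  qed
  have Zlarge: "1 + c / 2 \<le> ?Z x" if x: "x \<in> cball a s" for x
  proof -
    have "(\<integral>y. (1 + c / 2) * \<rho> (y - x) \<partial>lborel) \<le> ?Z x" unfolding correlate_def
    proof (rule integral_mono[OF _ iZ\<rho>])
      fix y
      show "(1 + c / 2) * \<rho> (y - x) \<le> Z y * \<rho> (y - x)"
      proof (cases "norm (y - x) < e")
        case True
        then have "dist a y < 2 * s" using x e(2) dist_triangle[of a y x] by (simp add: dist_norm norm_minus_commute)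
        then show ?thesis by (intro mult_right_mono Zbig \<rho>)
      qed (simp add: \<rho>)
    qed (simp add: i\<rho>s)
    then show ?thesis by (simp add: i\<rho>s)
  qed
  \<comment> \<open>Within radius \<open>r1\<close> the shifted kernel is a test function on the
    ball, so the weak gradient identity for \<open>Z\<close> applies to it; the two minus signs
    cancel.\<close>
  have dZ: "partial_deriv i ?Z x = correlate (D i) \<rho> x" if x: "dist a x \<le> r1" for i x
  proof -
    have "cball x e \<subseteq> ?B"
    proof
      fix y assume "y \<in> cball x e"
      then show "y \<in> ?B" using x e2 dist_triangle[of a y x] by simp
    qed
    note tx = tsh[OF this]
    have "partial_deriv i ?Z x = - (\<integral>y. Z y * partial_deriv i \<rho> (y - x) \<partial>lborel)"
      by (simp add: partial_deriv_correlate[OF iZ t] correlate_def)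
    also have "\<dots> = - (\<integral>y. Z y * partial_deriv i (\<lambda>y. \<rho> (y - x)) y \<partial>lborel)"
      by (simp add: partial_deriv_shift[OF test_fun_differentiable[OF t]])
    also have "\<dots> = (\<integral>y. D i y * \<rho> (y - x) \<partial>lborel)" by (simp add: gradZ[OF tx])
    finally show ?thesis by (simp add: correlate_def)
  qed
  \<comment> \<open>Since \<open>Z \<le> 1\<close> near the boundary of the ball, this is a test function without any cut-off.\<close>
  define \<eta> where "\<eta> x = expoly 1 (?Z x + (-1))" for x
  define q where "q x = expoly (monom 1 2) (?Z x + (-1))" for x
  have q: "0 \<le> q x" "q x \<le> 2" for x by (auto simp: q_def expoly_bounds)
  have \<eta>0: "0 \<le> \<eta> x" for x by (simp add: \<eta>_def expoly_bounds)
  have t\<eta>: "test_fun ?B \<eta>"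
  proof (rule test_funI[where K="cball a r1"])
    show "C_k k \<eta>" for k
      unfolding \<eta>_def[abs_def] by (intro C_k_expoly C_k_add C_k_const C_k_correlate[OF iZ t])
    show "cball a r1 \<subseteq> ?B" using r1 by auto
    show "\<eta> x = 0" if "x \<notin> cball a r1" for x
      using Zsmall[of x] that by (simp add: \<eta>_def expoly_bounds)
  qed simp
  have d\<eta>: "partial_deriv i \<eta> x = q x * correlate (D i) \<rho> x" for i x
  proof -
    have Zd: "?Z differentiable at x"
      using correlate_has_derivative[OF iZ t] differentiable_def by blast
    then have "(\<lambda>x. ?Z x + (-1)) differentiable at x" by simp
    from partial_deriv_expoly[OF this, of i 1]
    have "partial_deriv i \<eta> x = q x * partial_deriv i (\<lambda>x. ?Z x + (-1)) x"
      by (simp add: \<eta>_def[abs_def] q_def)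
    also have "partial_deriv i (\<lambda>x. ?Z x + (-1)) x = partial_deriv i ?Z x"
      using partial_deriv_add[OF Zd differentiable_const, of i "-1"] partial_deriv_eqI[OF has_derivative_const, of i "-1 :: real" x]
      by (simp only: add_0_right)
    finally show ?thesis
      using dZ[of x i] Zsmall[of x] by (cases "dist a x \<le> r1") (auto simp: q_def expoly_bounds)
  qed
  have td: "test_fun ?B (partial_deriv i \<eta>)" for i using t\<eta> by (rule test_fun_partial_deriv)
  have il: "integrable lborel (\<lambda>x. l i (V x $ i) * partial_deriv i \<eta> x)" for i
    by (rule integrable_L2_mult) (use lV2 test2[OF td] in auto)
  have parts: "integrable lborel (\<lambda>x. if x \<in> ?B then l i (W x $ i) * partial_deriv i \<eta> x else 0)"
      "integrable lborel (\<lambda>x. if x \<in> ?B then \<kappa> i x * \<eta> x else 0)"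
      "(\<integral>x. (if x \<in> ?B then l i (W x $ i) * partial_deriv i \<eta> x else 0) \<partial>lborel) =
       - (\<integral>x. (if x \<in> ?B then \<kappa> i x * \<eta> x else 0) \<partial>lborel)" for i
    by (rule integral_by_parts[OF open_ball subB[OF lWc] subB[OF \<kappa>c] W\<kappa>[OF BU] t\<eta>]; assumption)+
  have iA: "integrable lborel (\<lambda>x. A i x * partial_deriv i \<eta> x)" for i
    by (rule integrable_L2_mult) (use A2 test2[OF td] in auto)
  \<comment> \<open>The chain leads from the source term, through the flux of \<open>w\<close> and
    the supersolution inequality for \<open>u\<close>, to the flux difference \<open>A\<close>, and
    ends at \<open>\<beta> / 2\<close>.\<close>
  have "\<beta> \<le> (\<integral>x. (\<Sum>i\<in>UNIV. if x \<in> ?B then \<kappa> i x * \<eta> x else 0) \<partial>lborel)"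
    unfolding \<beta>_def
  proof (rule integral_ge_on_cball)
    show "integrable lborel (\<lambda>x. \<Sum>i\<in>UNIV. if x \<in> ?B then \<kappa> i x * \<eta> x else 0)"
      by (intro Bochner_Integration.integrable_sum parts)
    have eq: "(\<Sum>i\<in>UNIV. if x \<in> ?B then \<kappa> i x * \<eta> x else 0) = (if x \<in> ?B then (\<Sum>i\<in>UNIV. \<kappa> i x) * \<eta> x else 0)" for x
      by (simp add: sum_distrib_right)
    show "0 \<le> (\<Sum>i\<in>UNIV. if x \<in> ?B then \<kappa> i x * \<eta> x else 0)" for x
      unfolding eq using \<kappa>pos[of x] \<eta>0[of x] by (auto intro!: mult_nonneg_nonneg simp: less_imp_le)
    show "k0 * expoly 1 (c / 2) \<le> (\<Sum>i\<in>UNIV. if x \<in> ?B then \<kappa> i x * \<eta> x else 0)" if x: "x \<in> cball a s" for x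
    proof -
      have "x \<in> ?B" using x s by auto
      moreover have "expoly 1 (c / 2) \<le> \<eta> x"
        unfolding \<eta>_def using Zlarge[OF x] by (intro expoly_1_mono) auto
      then have "k0 * expoly 1 (c / 2) \<le> (\<Sum>i\<in>UNIV. \<kappa> i x) * \<eta> x"
        using z(2)[OF x] k0 by (intro mult_mono) (auto simp: k0_def expoly_bounds)
      ultimately show ?thesis unfolding eq by simp
    qed
  qed
  also have "\<dots> = (\<Sum>i\<in>UNIV. \<integral>x. (if x \<in> ?B then \<kappa> i x * \<eta> x else 0) \<partial>lborel)"
    by (intro Bochner_Integration.integral_sum parts)
  also have "\<dots> \<le> (\<integral>x. (\<Sum>i\<in>UNIV. l i (V x $ i) * partial_deriv i \<eta> x) \<partial>lborel)
       - (\<Sum>i\<in>UNIV. \<integral>x. (if x \<in> ?B then l i (W x $ i) * partial_deriv i \<eta> x else 0) \<partial>lborel)"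
  proof -
    have "(\<Sum>i\<in>UNIV. \<integral>x. (if x \<in> ?B then l i (W x $ i) * partial_deriv i \<eta> x else 0) \<partial>lborel) =
      - (\<Sum>i\<in>UNIV. \<integral>x. (if x \<in> ?B then \<kappa> i x * \<eta> x else 0) \<partial>lborel)"
      by (simp only: parts(3) sum_negf)
    then show ?thesis using super[OF t\<eta> \<eta>0] by linarith
  qed
  also have "\<dots> = (\<Sum>i\<in>UNIV. (\<integral>x. l i (V x $ i) * partial_deriv i \<eta> x \<partial>lborel)
       - (\<integral>x. (if x \<in> ?B then l i (W x $ i) * partial_deriv i \<eta> x else 0) \<partial>lborel))"
    using il by (simp add: Bochner_Integration.integral_sum sum_subtractf)
  also have "\<dots> = (\<Sum>i\<in>UNIV. \<integral>x. A i x * partial_deriv i \<eta> x \<partial>lborel)"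
  proof (rule sum.cong[OF refl])
    fix i
    have "(\<integral>x. l i (V x $ i) * partial_deriv i \<eta> x \<partial>lborel)
       - (\<integral>x. (if x \<in> ?B then l i (W x $ i) * partial_deriv i \<eta> x else 0) \<partial>lborel) =
       (\<integral>x. l i (V x $ i) * partial_deriv i \<eta> x - (if x \<in> ?B then l i (W x $ i) * partial_deriv i \<eta> x else 0) \<partial>lborel)"
      using il parts by simp
    also have "\<dots> = (\<integral>x. A i x * partial_deriv i \<eta> x \<partial>lborel)"
      by (rule Bochner_Integration.integral_cong) (auto simp: A_def algebra_simps out[OF td])
    finally show "(\<integral>x. l i (V x $ i) * partial_deriv i \<eta> x \<partial>lborel)
       - (\<integral>x. (if x \<in> ?B then l i (W x $ i) * partial_deriv i \<eta> x else 0) \<partial>lborel) =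
      (\<integral>x. A i x * partial_deriv i \<eta> x \<partial>lborel)" .
  qed
  also have "\<dots> \<le> (\<Sum>i\<in>(UNIV :: 'n set). 2 * (\<beta> / (4 * N)))"
  proof (rule sum_mono)
    fix i
    have "(\<integral>x. A i x * partial_deriv i \<eta> x \<partial>lborel) \<le> (\<integral>x. 2 * \<bar>A i x * (correlate (D i) \<rho> x - D i x)\<bar> \<partial>lborel)"
    proof (rule integral_mono[OF iA])
      show "integrable lborel (\<lambda>x. 2 * \<bar>A i x * (correlate (D i) \<rho> x - D i x)\<bar>)" using moll(1)[of i] by simp
      fix x
      \<comment> \<open>Exchanging the averaged gradient for \<open>D\<close> leaves a term that is
        nonpositive by monotonicity, and the mollification error with weight q \<le> 2.\<close>
      have "A i x * partial_deriv i \<eta> x = q x * (A i x * (correlate (D i) \<rho> x - D i x)) + q x * (A i x * D i x)"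
        by (simp add: d\<eta> algebra_simps)
      also have "q x * (A i x * D i x) \<le> 0" using q AD by (simp add: mult_nonneg_nonpos)
      also have "q x * (A i x * (correlate (D i) \<rho> x - D i x)) \<le> 2 * \<bar>A i x * (correlate (D i) \<rho> x - D i x)\<bar>"
        by (rule order_trans[OF mult_left_mono[OF abs_ge_self q(1)] mult_right_mono[OF q(2) abs_ge_zero]])
      finally show "A i x * partial_deriv i \<eta> x \<le> 2 * \<bar>A i x * (correlate (D i) \<rho> x - D i x)\<bar>" by simp
    qed
    also have "\<dots> \<le> 2 * (\<beta> / (4 * N))" using moll(2)[of i] by simp
    finally show "(\<integral>x. A i x * partial_deriv i \<eta> x \<partial>lborel) \<le> 2 * (\<beta> / (4 * N))" .
  qed
  also have "\<dots> = \<beta> / 2" using N by (simp add: N_def)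
  finally show False using \<beta> by simp
qed

section \<open>Radial barriers\<close>

text \<open>\<open>l\<close> is half the derivative of F(s) = f(s^2) s^2, and away from 0 the
  differential equation says l'(s) = g(s^2). At the origin \<open>f'\<close> may be singular: |F|
  \<le> M s^2 gives F'(0) = 0, and l'(0) = g(0) follows from the mean value theorem and continuity
  of \<open>g\<close>. The linear bound on \<open>l\<close> keeps the flux of a square-integrable
  gradient square integrable.\<close>

lemma flux_exists:
  fixes f g :: "real \<Rightarrow> real"
  assumes ode: "solves_ode g f" and bd: "bounded (f ` {0..})"
    and gc: "continuous_on {0..} g" and gnn: "\<And>t. t \<ge> 0 \<Longrightarrow> 0 \<le> g t"
  shows "\<exists>l C. (\<forall>s. ((\<lambda>s. f (s\<^sup>2) * s\<^sup>2) has_real_derivative 2 * l s) (at s)) \<and>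
     (\<forall>s. (l has_real_derivative g (s\<^sup>2)) (at s)) \<and> (\<forall>s. \<bar>l s\<bar> \<le> C * \<bar>s\<bar>)"
proof -
  obtain f' f'' where f': "\<And>t. t > 0 \<Longrightarrow> (f has_real_derivative f' t) (at t)"
    and f'': "\<And>t. t > 0 \<Longrightarrow> (f' has_real_derivative f'' t) (at t)"
    and eq: "\<And>t. t \<ge> 0 \<Longrightarrow> g t = f t + 5 * t * f' t + 2 * t\<^sup>2 * f'' t"
    using ode unfolding solves_ode_def by blast
  obtain M where M: "\<And>t. t \<ge> 0 \<Longrightarrow> \<bar>f t\<bar> \<le> M"
    using bd by (auto simp: bounded_iff)
  have M0: "M \<ge> 0" using M[of 0] by simp
  define F where "F s = f (s\<^sup>2) * s\<^sup>2" for s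
  \<comment> \<open>At 0 the result is 0 whatever value \<open>f' 0\<close> has, since it is
    multiplied by 0.\<close>
  define l where "l s = f (s\<^sup>2) * s + s ^ 3 * f' (s\<^sup>2)" for s
  have F0: "\<bar>F s\<bar> \<le> M * s\<^sup>2" for s
    unfolding F_def abs_mult using M[of "s\<^sup>2"] by (simp add: mult_right_mono)
  have sq: "((\<lambda>s. h (s\<^sup>2)) has_real_derivative h' * (2 * s)) (at s)"
    if "(h has_real_derivative h') (at (s\<^sup>2))" for h h' s
    by (rule DERIV_chain2[where f=h and g="\<lambda>s. s\<^sup>2", OF that]) (auto intro!: derivative_eq_intros)
  have dF: "(F has_real_derivative 2 * l s) (at s)" for s
  proof (cases "s = 0")
    case False
    then have "((\<lambda>s. f (s\<^sup>2)) has_real_derivative f' (s\<^sup>2) * (2 * s)) (at s)"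
      by (intro sq f') simp
    moreover have "((\<lambda>s. s\<^sup>2) has_real_derivative 2 * s) (at s)" by (auto intro!: derivative_eq_intros)
    ultimately have "((\<lambda>s. f (s\<^sup>2) * s\<^sup>2) has_real_derivative f' (s\<^sup>2) * (2 * s) * s\<^sup>2 + 2 * s * f (s\<^sup>2)) (at s)"
      by (rule DERIV_mult)
    also have "f' (s\<^sup>2) * (2 * s) * s\<^sup>2 + 2 * s * f (s\<^sup>2) = 2 * l s"
      by (simp add: l_def power2_eq_square power3_eq_cube algebra_simps)
    finally show ?thesis unfolding F_def[abs_def] .
  next
    case True
    have "((\<lambda>h. F h / h) \<longlongrightarrow> 0) (at 0)"
    proof (rule Lim_null_comparison)
      show "\<forall>\<^sub>F h in at 0. norm (F h / h) \<le> M * \<bar>h\<bar>"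
      proof (rule eventuallyI)
        fix h show "norm (F h / h) \<le> M * \<bar>h\<bar>"
          using F0[of h] by (cases "h = 0") (auto simp: divide_le_eq power2_eq_square abs_mult mult_ac)
      qed
      show "((\<lambda>h. M * \<bar>h\<bar>) \<longlongrightarrow> 0) (at (0::real))" by (auto intro!: tendsto_eq_intros)
    qed
    then show ?thesis using True by (simp add: has_field_derivative_iff F_def l_def)
  qed
  have dl: "(l has_real_derivative g (s\<^sup>2)) (at s)" if "s \<noteq> 0" for s
  proof -
    have "((\<lambda>s. f (s\<^sup>2)) has_real_derivative f' (s\<^sup>2) * (2 * s)) (at s)"
      using that by (intro sq f') simp
    from DERIV_mult[OF this DERIV_ident]
    have 1: "((\<lambda>s. f (s\<^sup>2) * s) has_real_derivative f' (s\<^sup>2) * (2 * s) * s + 1 * f (s\<^sup>2)) (at s)" .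
    have "((\<lambda>s. f' (s\<^sup>2)) has_real_derivative f'' (s\<^sup>2) * (2 * s)) (at s)"
      using that by (intro sq f'') simp
    moreover have "((\<lambda>s. s ^ 3) has_real_derivative 3 * s\<^sup>2) (at s)"
      by (auto intro!: derivative_eq_intros)
    ultimately have 2: "((\<lambda>s. s ^ 3 * f' (s\<^sup>2)) has_real_derivative
        3 * s\<^sup>2 * f' (s\<^sup>2) + f'' (s\<^sup>2) * (2 * s) * s ^ 3) (at s)"
      by (intro DERIV_mult)
    have "(l has_real_derivative f' (s\<^sup>2) * (2 * s) * s + 1 * f (s\<^sup>2) +
        (3 * s\<^sup>2 * f' (s\<^sup>2) + f'' (s\<^sup>2) * (2 * s) * s ^ 3)) (at s)"
      unfolding l_def[abs_def] by (rule DERIV_add[OF 1 2])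
    also have "f' (s\<^sup>2) * (2 * s) * s + 1 * f (s\<^sup>2) +
        (3 * s\<^sup>2 * f' (s\<^sup>2) + f'' (s\<^sup>2) * (2 * s) * s ^ 3) = g (s\<^sup>2)"
      using eq[of "s\<^sup>2"] by (simp add: power2_eq_square power3_eq_cube algebra_simps)
    finally show ?thesis .
  qed
  have lmono: "l s \<le> l t" if "0 < s" "s \<le> t" for s t
  proof (rule DERIV_nonneg_imp_nondecreasing[OF that(2)])
    fix x assume "s \<le> x" "x \<le> t"
    then show "\<exists>y. (l has_real_derivative y) (at x) \<and> 0 \<le> y"
      using dl[of x] gnn[of "x\<^sup>2"] that by (intro exI[of _ "g (x\<^sup>2)"]) auto
  qed
  have odd: "l (- s) = - l s" for s by (simp add: l_def power3_eq_cube)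
  \<comment> \<open>As \<open>l\<close> is nondecreasing on the positive axis, \<open>l s\<close>
    lies between the slopes of F / 2 over [s / 2, s] and over [s, 2 s]. The bound on F then gives -
    2 M s from below and 5 M s / 2 from above.\<close>
  have growpos: "\<bar>l s\<bar> \<le> 3 * M * s" if s: "s > 0" for s
  proof -
    obtain x where x: "s < x" "x < 2 * s" "F (2 * s) - F s = (2 * s - s) * (2 * l x)"
      using MVT2[of s "2 * s" F "\<lambda>s. 2 * l s"] dF s by auto
    have "2 * s * l s \<le> F (2 * s) - F s" using x lmono[of s x] s by simp
    also have "\<dots> \<le> M * (2 * s)\<^sup>2 + M * s\<^sup>2" using F0[of "2 * s"] F0[of s] by linarith
    finally have "s * (2 * l s) \<le> s * (5 * M * s)" by (simp add: power2_eq_square algebra_simps)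
    then have 1: "2 * l s \<le> 5 * M * s" using s by simp
    obtain x where x: "s / 2 < x" "x < s" "F s - F (s / 2) = (s - s / 2) * (2 * l x)"
      using MVT2[of "s / 2" s F "\<lambda>s. 2 * l s"] dF s by auto
    have "F s - F (s / 2) \<le> s * l s" using x lmono[of x s] s by simp
    moreover have "- (M * s\<^sup>2 + M * (s / 2)\<^sup>2) \<le> F s - F (s / 2)" using F0[of "s / 2"] F0[of s] by linarith
    moreover have "M * (s / 2)\<^sup>2 \<le> M * s\<^sup>2" using M0 by (simp add: power2_eq_square mult_left_mono)
    ultimately have "s * - (2 * M * s) \<le> s * l s" by (simp add: power2_eq_square algebra_simps)
    then have 2: "- (2 * M * s) \<le> l s" using s by (simp only: mult_le_cancel_left_pos)
    have "0 \<le> M * s" using M0 s by simp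
    then show ?thesis using 1 2 by linarith
  qed
  have grow: "\<bar>l s\<bar> \<le> 3 * M * \<bar>s\<bar>" for s
    using growpos[of s] growpos[of "- s"] odd[of s] by (cases s "0::real" rule: linorder_cases) (auto simp: l_def)
  have l0: "l 0 = 0" by (simp add: l_def)
  have lc: "isCont l s" for s
  proof (cases "s = 0")
    case True
    have "(l \<longlongrightarrow> 0) (at 0)"
    proof (rule Lim_null_comparison)
      show "\<forall>\<^sub>F s in at 0. norm (l s) \<le> 3 * M * \<bar>s\<bar>" using grow by simp
      show "((\<lambda>h. 3 * M * \<bar>h\<bar>) \<longlongrightarrow> 0) (at (0::real))" by (auto intro!: tendsto_eq_intros)
    qed
    then show ?thesis using True l0 by (simp add: isCont_def)
  qed (use dl DERIV_isCont in blast)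
  \<comment> \<open>The quotient is a value of \<open>g\<close> at an argument squeezed to 0, which
    will give the derivative of \<open>l\<close> at 0.\<close>
  have quot: "\<exists>x>0. x < s \<and> l s / s = g (x\<^sup>2)" if s: "s > 0" for s
  proof -
    have "\<exists>k z. 0 < z \<and> z < s \<and> (l has_real_derivative k) (at z) \<and> l s - l 0 = (s - 0) * k"
    proof (rule MVT[OF s])
      show "continuous_on {0..s} l" using lc by (simp add: continuous_at_imp_continuous_on)
      show "l differentiable at x" if "0 < x" "x < s" for x
        using dl[of x] that real_differentiable_def by blast
    qed
    then obtain k z where z: "0 < z" "z < s" "(l has_real_derivative k) (at z)" "l s - l 0 = (s - 0) * k" by blast
    then have "k = g (z\<^sup>2)" using dl[of z] DERIV_unique by blast
    then show ?thesis using z s l0 by (intro exI[of _ z]) simp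
  qed
  have "((\<lambda>h. l h / h) \<longlongrightarrow> g 0) (at 0)"
  proof (rule LIM_I)
    fix e :: real assume "e > 0"
    then have "\<exists>d>0. \<forall>t\<in>{0..}. dist t 0 < d \<longrightarrow> dist (g t) (g 0) < e"
      using bspec[OF gc[unfolded continuous_on_iff], of 0] by simp
    then obtain d where d: "d > 0" "\<And>t. t \<ge> 0 \<Longrightarrow> dist t 0 < d \<Longrightarrow> dist (g t) (g 0) < e"
      by auto
    have "\<bar>l h / h - g 0\<bar> < e" if h: "h \<noteq> 0" "\<bar>h\<bar> < min d 1" for h
    proof -
      obtain x where x: "x > 0" "x < \<bar>h\<bar>" "l \<bar>h\<bar> / \<bar>h\<bar> = g (x\<^sup>2)" using quot[of "\<bar>h\<bar>"] h by auto
      have "l \<bar>h\<bar> / \<bar>h\<bar> = l h / h" using odd[of h] by (simp add: abs_if)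
      moreover have "x\<^sup>2 < d"
      proof -
        have "x * x \<le> x * 1" using x h by (intro mult_left_mono) auto
        then show ?thesis unfolding power2_eq_square using x h by linarith
      qed
      ultimately show ?thesis using x d(2)[of "x\<^sup>2"] by (simp add: dist_real_def)
    qed
    then show "\<exists>s>0. \<forall>x. x \<noteq> 0 \<and> norm (x - 0) < s \<longrightarrow> norm (l x / x - g 0) < e"
      using d(1) by (intro exI[of _ "min d 1"]) auto
  qed
  then have "(l has_real_derivative g (s\<^sup>2)) (at s)" for s
    using dl[of s] l0 by (cases "s = 0") (auto simp: has_field_derivative_iff)
  then show ?thesis using dF grow unfolding F_def[abs_def]
    by (intro exI[of _ l] exI[of _ "3 * M"]) simp
qed

lemma grad_Lagr:
  assumes "\<And>i s. ((\<lambda>s. f i (s\<^sup>2) * s\<^sup>2) has_real_derivative 2 * l i s) (at s)"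
  shows "grad (Lagr f) p $ i = l i (p $ i)"
proof -
  have "((\<lambda>p. f j ((p $ j)\<^sup>2) * (p $ j)\<^sup>2) has_derivative (\<lambda>h. 2 * l j (p $ j) * h $ j)) (at p)" for j
    by (rule has_derivative_compose[where g="\<lambda>s. f j (s\<^sup>2) * s\<^sup>2",
      OF bounded_linear_imp_has_derivative[OF bounded_linear_vec_nth] assms[unfolded has_field_derivative_def]])
  then have "(Lagr f has_derivative (\<lambda>h. 1 / 2 * (\<Sum>j\<in>UNIV. 2 * l j (p $ j) * h $ j))) (at p)"
    unfolding Lagr_def[abs_def] by (intro has_derivative_mult_right has_derivative_sum)
  then have "frechet_derivative (Lagr f) (at p) = (\<lambda>h. 1 / 2 * (\<Sum>j\<in>UNIV. 2 * l j (p $ j) * h $ j))"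
    by (rule frechet_derivative_at[symmetric])
  then show ?thesis
    by (simp add: grad_def partial_deriv_def axis_def if_distrib[where f="\<lambda>x. _ * x"] cong: if_cong)
qed

section \<open>The profile equation\<close>

text \<open>\<open>G_int\<close> is a \<open>Lim\<close>, which says something about the integrals
  only once the limit is known to exist. By monotonicity in the lower end point it exists and is the
  supremum, so a uniform bound \<open>M\<close> would make it finite.\<close>

lemma G_int_unbounded:
  fixes g :: "'n::finite \<Rightarrow> real \<Rightarrow> real"
  assumes gc: "continuous_on {0..} (g m)" and gnn: "\<And>t. t \<ge> 0 \<Longrightarrow> 0 \<le> g m t"
    and G: "G_int g m \<xi> = \<infinity>" and "\<xi> > 0"
  shows "\<exists>e. 0 < e \<and> e < \<xi> \<and> M \<le> integral {e..\<xi>} (\<lambda>\<zeta>. g m (\<zeta>\<^sup>2 / real CARD('n)) / \<zeta>)"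
proof (rule ccontr)
  define \<phi> where "\<phi> \<zeta> = g m (\<zeta>\<^sup>2 / real CARD('n)) / \<zeta>" for \<zeta>
  assume "\<not> ?thesis"
  then have less: "integral {e..\<xi>} \<phi> < M" if "0 < e" "e < \<xi>" for e
    using that by (force simp: \<phi>_def[abs_def])
  have int: "\<phi> integrable_on {e..\<xi>}" if "0 < e" for e
    unfolding \<phi>_def[abs_def]
    by (intro integrable_continuous_interval continuous_intros continuous_on_compose2[OF gc]) (use that in auto)
  have mono: "integral {e2..\<xi>} \<phi> \<le> integral {e1..\<xi>} \<phi>" if "0 < e1" "e1 \<le> e2" for e1 e2
    by (rule integral_subset_le) (use that int gnn in \<open>auto simp: \<phi>_def\<close>)
  define S where "S = (SUP e\<in>{0<..<\<xi>}. ereal (integral {e..\<xi>} \<phi>))"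
  have "((\<lambda>e. ereal (integral {e..\<xi>} \<phi>)) \<longlongrightarrow> S) (at_right 0)"
  proof (rule order_tendstoI)
    fix a assume "a < S"
    then obtain e where e: "0 < e" "e < \<xi>" "a < ereal (integral {e..\<xi>} \<phi>)" by (auto simp: S_def less_SUP_iff)
    have "a < ereal (integral {x..\<xi>} \<phi>)" if "0 < x" "x < e" for x
      by (rule less_le_trans[OF e(3)]) (use mono[of x e] that in simp)
    then show "\<forall>\<^sub>F x in at_right 0. a < ereal (integral {x..\<xi>} \<phi>)"
      using e(1) by (auto simp: eventually_at_right_field)
  next
    fix a assume a: "S < a"
    have "ereal (integral {x..\<xi>} \<phi>) < a" if "0 < x" "x < \<xi>" for x
      using a by (rule le_less_trans[rotated]) (auto simp: S_def that intro!: SUP_upper)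
    then show "\<forall>\<^sub>F x in at_right 0. ereal (integral {x..\<xi>} \<phi>) < a"
      using \<open>\<xi> > 0\<close> by (auto simp: eventually_at_right_field)
  qed
  then have "G_int g m \<xi> = S"
    unfolding G_int_def \<phi>_def[abs_def] by (intro tendsto_Lim trivial_limit_at_right_real)
  moreover have "S \<le> ereal M" unfolding S_def by (rule SUP_least) (use less in \<open>auto intro: less_imp_le\<close>)
  ultimately show False using G by simp
qed

text \<open>Separation of variables: with \<open>J\<close> the primitive of \<gamma>(x) / x, the
  value J(z) must decrease at the constant rate \<open>K\<close>. The descent from \<open>b\<close>
  to \<open>e\<close> takes time J(b) / K, and \<open>e\<close> is chosen so small that this is at
  least \<open>L\<close>.\<close>

lemma decreasing_profile:
  fixes \<gamma> :: "real \<Rightarrow> real"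
  assumes "0 < b" and \<gamma>c: "continuous_on {0<..b} \<gamma>" and \<gamma>pos: "\<And>x. 0 < x \<Longrightarrow> x \<le> b \<Longrightarrow> 0 < \<gamma> x"
    and "0 < K" "0 < L"
    and unb: "\<And>M. \<exists>e. 0 < e \<and> e < b \<and> M \<le> integral {e..b} (\<lambda>x. \<gamma> x / x)"
  shows "\<exists>z. \<forall>t. 0 < t \<and> t < L \<longrightarrow> 0 < z t \<and> z t < b \<and>
     (z has_real_derivative - (K * z t / \<gamma> (z t))) (at t)"
proof -
  obtain e where e: "0 < e" "e < b" "K * L \<le> integral {e..b} (\<lambda>x. \<gamma> x / x)" using unb by blast
  define J where "J x = integral {e..x} (\<lambda>x. \<gamma> x / x)" for x
  have c: "continuous_on {e..b} (\<lambda>x. \<gamma> x / x)"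
    using e by (intro continuous_intros continuous_on_subset[OF \<gamma>c]) auto
  have dJ: "(J has_real_derivative \<gamma> x / x) (at x within {e..b})" if "x \<in> {e..b}" for x
    unfolding J_def[abs_def] by (rule integral_has_real_derivative[OF c that])
  have dJ': "(J has_real_derivative \<gamma> x / x) (at x)" if "e < x" "x < b" for x
    using dJ[of x] that by (simp add: at_within_Icc_at)
  have Jc: "continuous_on {e..b} J" by (rule DERIV_continuous_on[OF dJ])
  have J0: "J e = 0" by (simp add: J_def)
  have Jmono: "J x < J y" if "e \<le> x" "x < y" "y \<le> b" for x y
  proof -
    have "\<exists>k z. x < z \<and> z < y \<and> (J has_real_derivative k) (at z) \<and> J y - J x = (y - x) * k"
    proof (rule MVT[OF that(2)])
      show "continuous_on {x..y} J" using Jc by (rule continuous_on_subset) (use that in auto)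
      show "J differentiable at z" if "x < z" "z < y" for z
        using dJ'[of z] that \<open>e \<le> x\<close> \<open>y \<le> b\<close> real_differentiable_def by force
    qed
    then obtain k z where z: "x < z" "z < y" "(J has_real_derivative k) (at z)" "J y - J x = (y - x) * k" by blast
    then have "k = \<gamma> z / z" using dJ'[of z] that DERIV_unique by force
    moreover have "\<gamma> z / z > 0" using z that e \<gamma>pos[of z] by simp
    ultimately have "(y - x) * k > 0" using that by (intro mult_pos_pos) auto
    then show ?thesis using z by simp
  qed
  have inj: "inj_on J {e..b}"
  proof (rule inj_onI)
    fix x y assume "x \<in> {e..b}" "y \<in> {e..b}" "J x = J y"
    then show "x = y" using Jmono[of x y] Jmono[of y x] by (cases x y rule: linorder_cases) auto
  qed
  define y where "y = the_inv_into {e..b} J"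
  have yJ: "y (J x) = x" if "x \<in> {e..b}" for x
    unfolding y_def using inj that by (rule the_inv_into_f_f)
  have yc: "continuous_on (J ` {e..b}) y" by (rule continuous_on_inv[OF Jc]) (use yJ in auto)
  have im: "{0..J b} \<subseteq> J ` {e..b}"
  proof
    fix t assume "t \<in> {0..J b}"
    then have "\<exists>x\<ge>e. x \<le> b \<and> J x = t" using e J0 Jc by (intro IVT') auto
    then show "t \<in> J ` {e..b}" by auto
  qed
  have y: "e < y t" "y t < b" "J (y t) = t" if t: "0 < t" "t < J b" for t
  proof -
    have "t \<in> J ` {e..b}" using im t by auto
    then obtain x where x: "x \<in> {e..b}" "t = J x" by blast
    then have "x \<noteq> e" "x \<noteq> b" using t J0 by auto
    then show "e < y t" "y t < b" "J (y t) = t" using x yJ by auto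
  qed
  have dy: "(y has_real_derivative inverse (\<gamma> (y t) / y t)) (at t)" if t: "0 < t" "t < J b" for t
  proof (rule DERIV_inverse_function[where f=J and a=0 and b="J b"])
    show "(J has_real_derivative \<gamma> (y t) / y t) (at (y t))" using dJ' y[OF t] by blast
    show "\<gamma> (y t) / y t \<noteq> 0" using \<gamma>pos[of "y t"] y[OF t] e by simp
    have "continuous_on {0<..<J b} y" using yc by (rule continuous_on_subset) (use im in force)
    then show "isCont y t" using t by (simp add: continuous_on_eq_continuous_at)
  qed (use t y in auto)
  \<comment> \<open>Time 0 corresponds to the value \<open>b\<close>; running backwards at speed
    \<open>K\<close> turns the increasing inverse of \<open>J\<close> into a decreasing
    profile.\<close>
  define z where "z t = y (J b - K * t)" for t
  have "0 < z t \<and> z t < b \<and> (z has_real_derivative - (K * z t / \<gamma> (z t))) (at t)"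
    if t: "0 < t" "t < L" for t
  proof -
    have "K * t < K * L" using t \<open>0 < K\<close> by simp
    then have "K * t < J b" using e(3) unfolding J_def by (rule less_le_trans)
    moreover have "0 < K * t" using t \<open>0 < K\<close> by simp
    ultimately have r: "0 < J b - K * t" "J b - K * t < J b" by linarith+
    have "(z has_real_derivative inverse (\<gamma> (z t) / z t) * (- K)) (at t)"
      unfolding z_def[abs_def]
      by (rule DERIV_chain2[where f=y and g="\<lambda>t. J b - K * t", OF dy[OF r]])
        (auto intro!: derivative_eq_intros)
    also have "inverse (\<gamma> (z t) / z t) * (- K) = - (K * z t / \<gamma> (z t))" by simp
    finally have "(z has_real_derivative - (K * z t / \<gamma> (z t))) (at t)" .
    moreover have "0 < z t" "z t < b" using y[OF r] e(1) by (simp_all add: z_def)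
    ultimately show ?thesis by blast
  qed
  then show ?thesis by blast
qed

section \<open>Convexity from (L) and the barrier in an annulus\<close>

text \<open>By (L) the derivative of h(t) = t g_m(t) is nondecreasing, so \<open>h\<close> lies
  above its tangents. Evaluated at 0, where \<open>h\<close> vanishes, a tangent gives a nonnegative
  derivative of \<open>g m\<close>; summed over the \<open>r i\<close>, with the tangent taken at
  their mean \<open>\<tau>\<close>, the linear terms cancel and Jensen's inequality results.\<close>

lemma assumption_L_consequences:
  fixes g :: "'n::finite \<Rightarrow> real \<Rightarrow> real"
  assumes L: "assumption_L g m" and card: "CARD('n) \<ge> 2"
  obtains T where "T > 0"
    "\<And>i t. 0 \<le> t \<Longrightarrow> t \<le> T \<Longrightarrow> 0 \<le> g m t \<and> g m t \<le> g i t \<and> g i t \<le> 1"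
    "\<And>t. 0 < t \<Longrightarrow> t \<le> T \<Longrightarrow> 0 < g m t"
    "\<And>s t. 0 < s \<Longrightarrow> s \<le> t \<Longrightarrow> t < T \<Longrightarrow> g m s \<le> g m t"
    "\<And>(r::'n \<Rightarrow> real) \<tau>. (\<And>i. 0 \<le> r i \<and> r i < T) \<Longrightarrow> 0 < \<tau> \<Longrightarrow> \<tau> < T \<Longrightarrow> (\<Sum>i\<in>UNIV. r i) = real CARD('n) * \<tau>
       \<Longrightarrow> real CARD('n) * (\<tau> * g m \<tau>) \<le> (\<Sum>i\<in>UNIV. r i * g m (r i))"
proof -
  obtain T g' where T: "T > 0"
    and b: "\<And>t i. t \<in> {0..T} \<Longrightarrow> i \<noteq> m \<Longrightarrow> 0 \<le> g m t \<and> g m t \<le> g i t \<and> g i t \<le> 1"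
    and c: "continuous_on {0..T} (g m)" and pos: "\<And>t. t \<in> {0<..T} \<Longrightarrow> 0 < g m t"
    and d: "\<And>t. t \<in> {0<..T} \<Longrightarrow> (g m has_real_derivative g' t) (at t within {0<..T})"
    and mono: "mono_on {0<..T} (\<lambda>t. g m t + g' t * t)"
    using L unfolding assumption_L_def by blast
  \<comment> \<open>A second index supplies the bound g_m \<le> 1, which (L) states only through g_m
    \<le> g_j \<le> 1.\<close>
  obtain j :: 'n where j: "j \<noteq> m"
  proof -
    have "\<exists>j. j \<noteq> m"
    proof (rule ccontr)
      assume "\<nexists>j. j \<noteq> m"
      then have "(UNIV :: 'n set) = {m}" by auto
      then have "CARD('n) = card {m}" by simp
      then show False using card by simp
    qed
    then show ?thesis using that by blast
  qed
  have d': "(g m has_real_derivative g' t) (at t)" if "0 < t" "t < T" for t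
  proof -
    have "(g m has_real_derivative g' t) (at t within {0<..<T})"
      using d[of t] that by (intro has_field_derivative_subset[OF d]) auto
    then show ?thesis using that by (simp add: at_within_open[of t "{0<..<T}"])
  qed
  define h where "h t = t * g m t" for t
  define h' where "h' t = g m t + g' t * t" for t
  have dh: "(h has_real_derivative h' t) (at t)" if "0 < t" "t < T" for t
    unfolding h_def[abs_def] h'_def using d'[OF that]
    by (auto intro!: derivative_eq_intros)
  have hc: "continuous_on {0..T} h" unfolding h_def[abs_def] by (intro continuous_intros c)
  have hm: "h' s \<le> h' t" if "0 < s" "s \<le> t" "t \<le> T" for s t
    using mono_onD[OF mono, of s t] that by (simp add: h'_def)
  have mv: "\<exists>z. s < z \<and> z < t \<and> h t - h s = (t - s) * h' z" if "0 \<le> s" "s < t" "t < T" for s t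
  proof -
    have "\<exists>k z. s < z \<and> z < t \<and> (h has_real_derivative k) (at z) \<and> h t - h s = (t - s) * k"
    proof (rule MVT[OF that(2)])
      show "continuous_on {s..t} h" using hc by (rule continuous_on_subset) (use that in auto)
      show "h differentiable at z" if "s < z" "z < t" for z
        using dh[of z] that \<open>0 \<le> s\<close> \<open>t < T\<close> real_differentiable_def by force
    qed
    then obtain k z where z: "s < z" "z < t" "(h has_real_derivative k) (at z)" "h t - h s = (t - s) * k" by blast
    then have "k = h' z" using dh[of z] that DERIV_unique by force
    then show ?thesis using z by blast
  qed
  have tangent: "h \<tau> + h' \<tau> * (t - \<tau>) \<le> h t" if a: "0 \<le> t" "t < T" "0 < \<tau>" "\<tau> < T" for t \<tau>
  proof (cases t \<tau> rule: linorder_cases)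
    case less
    then obtain z where z: "t < z" "z < \<tau>" "h \<tau> - h t = (\<tau> - t) * h' z" using mv[of t \<tau>] a by blast
    have "(\<tau> - t) * h' z \<le> (\<tau> - t) * h' \<tau>" using z a hm[of z \<tau>] less by (intro mult_left_mono) auto
    then show ?thesis using z(3) by (simp add: algebra_simps)
  next
    case greater
    then obtain z where z: "\<tau> < z" "z < t" "h t - h \<tau> = (t - \<tau>) * h' z" using mv[of \<tau> t] a by auto
    have "(t - \<tau>) * h' \<tau> \<le> (t - \<tau>) * h' z" using z a hm[of \<tau> z] greater by (intro mult_left_mono) auto
    then show ?thesis using z(3) by (simp add: algebra_simps)
  qed simp
  have g'nn: "0 \<le> g' t" if "0 < t" "t < T" for t
  proof -
    have "h t + h' t * (0 - t) \<le> h 0" using tangent[of 0 t] that T by simp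
    then have "0 \<le> g' t * t * t" by (simp add: h_def h'_def algebra_simps)
    then show ?thesis using that by (simp add: zero_le_mult_iff)
  qed
  show ?thesis
  proof (rule that[OF T])
    fix i t assume t: "0 \<le> t" "t \<le> T"
    show "0 \<le> g m t \<and> g m t \<le> g i t \<and> g i t \<le> 1"
      using b[of t i] b[of t j] t j by (cases "i = m") auto
  next
    fix s t assume st: "0 < s" "s \<le> t" "t < T"
    show "g m s \<le> g m t"
    proof (rule DERIV_nonneg_imp_nondecreasing[OF st(2)])
      fix x assume "s \<le> x" "x \<le> t"
      then show "\<exists>y. (g m has_real_derivative y) (at x) \<and> 0 \<le> y" using d'[of x] g'nn[of x] st by auto
    qed
  next
    fix r :: "'n \<Rightarrow> real" and \<tau>
    assume r: "\<And>i. 0 \<le> r i \<and> r i < T" and \<tau>: "0 < \<tau>" "\<tau> < T" and s: "(\<Sum>i\<in>UNIV. r i) = real CARD('n) * \<tau>"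
    have "(\<Sum>i\<in>(UNIV :: 'n set). h \<tau> + h' \<tau> * (r i - \<tau>)) \<le> (\<Sum>i\<in>UNIV. h (r i))"
      by (intro sum_mono tangent \<tau>) (use r in auto)
    also have "(\<Sum>i\<in>(UNIV :: 'n set). h \<tau> + h' \<tau> * (r i - \<tau>)) = real CARD('n) * h \<tau> + h' \<tau> * ((\<Sum>i\<in>UNIV. r i) - real CARD('n) * \<tau>)"
      by (simp add: sum.distrib sum_subtractf flip: sum_distrib_left)
    finally show "real CARD('n) * (\<tau> * g m \<tau>) \<le> (\<Sum>i\<in>UNIV. r i * g m (r i))"
      using s by (simp add: h_def)
  qed (use pos in auto)
qed

text \<open>In the variable s = |x - y|^2 / 2, whose partial derivatives are the coordinates of x -
  y, one has W = - v(s) (x - y), and the i-th derivative of W_i is p (x - y)_i^2 - v with p = - v'.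
  After multiplication by g_i(W_i^2), the bounds g_m \<le> g_i \<le> 1 reduce strictness to bounding
  the sum of p (x - y)_i^2 g_m(W_i^2) below by (N + 1) v; Jensen's inequality and the profile
  equation achieve this.\<close>

lemma barrier_exists:
  fixes g l :: "'n::finite \<Rightarrow> real \<Rightarrow> real" and y :: "real ^ 'n" and R \<epsilon> :: real
  assumes L: "assumption_L g m" and card: "CARD('n) \<ge> 2"
    and gc: "\<And>i. continuous_on {0..} (g i)" and gnn: "\<forall>i. \<forall>t\<ge>0. 0 \<le> g i t"
    and Ginf: "\<forall>\<xi>>0. G_int g m \<xi> = \<infinity>"
    and dl: "\<And>i s. (l i has_real_derivative g i (s\<^sup>2)) (at s)"
    and "R > 0" "\<epsilon> > 0"
    and U: "U = {x. R / 2 < norm (x - y) \<and> norm (x - y) < 3 / 2 * R}"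
  shows "\<exists>w W \<kappa>. continuous_on U w \<and> (\<forall>i. continuous_on U (\<lambda>x. W x $ i)) \<and> (\<forall>i. continuous_on U (\<kappa> i)) \<and>
    (\<forall>i. \<forall>x\<in>U. ((\<lambda>t. w (x + t *\<^sub>R axis i 1)) has_real_derivative W x $ i) (at 0)) \<and>
    (\<forall>i. \<forall>x\<in>U. ((\<lambda>t. l i (W (x + t *\<^sub>R axis i 1) $ i)) has_real_derivative \<kappa> i x) (at 0)) \<and>
    (\<forall>x\<in>U. 0 < (\<Sum>i\<in>UNIV. \<kappa> i x)) \<and> (\<forall>x\<in>U. w x \<le> \<epsilon>) \<and>
    (\<forall>x\<in>U. R < norm (x - y) \<longrightarrow> w x < 0) \<and> (\<forall>x\<in>U. norm (x - y) = R \<longrightarrow> w x = 0)"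
proof -
  obtain T where T: "T > 0"
    and gb: "\<And>i t. 0 \<le> t \<Longrightarrow> t \<le> T \<Longrightarrow> 0 \<le> g m t \<and> g m t \<le> g i t \<and> g i t \<le> 1"
    and gpos: "\<And>t. 0 < t \<Longrightarrow> t \<le> T \<Longrightarrow> 0 < g m t"
    and gmono: "\<And>s t. 0 < s \<Longrightarrow> s \<le> t \<Longrightarrow> t < T \<Longrightarrow> g m s \<le> g m t"
    and gconv: "\<And>(r::'n \<Rightarrow> real) \<tau>. (\<And>i. 0 \<le> r i \<and> r i < T) \<Longrightarrow> 0 < \<tau> \<Longrightarrow> \<tau> < T \<Longrightarrow> (\<Sum>i\<in>UNIV. r i) = real CARD('n) * \<tau>
       \<Longrightarrow> real CARD('n) * (\<tau> * g m \<tau>) \<le> (\<Sum>i\<in>UNIV. r i * g m (r i))"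
    using assumption_L_consequences[OF L card] by blast
  define N where "N = real CARD('n)"
  have N: "N \<ge> 1" using card by (simp add: N_def)
  \<comment> \<open>The inner radius of the annulus: on \<open>U\<close> the value z = c v is at
    most the length r v of the gradient, since r > c.\<close>
  define c where "c = R / 2"
  have c: "c > 0" using \<open>R > 0\<close> by (simp add: c_def)
  \<comment> \<open>Any \<open>K\<close> with \<open>K * c\<^sup>2 > N\<close> makes the barrier a strict subsolution.\<close>
  define K where "K = (N + 1) / c\<^sup>2"
  have K: "K > 0" using N c by (simp add: K_def)
  \<comment> \<open>The first bound keeps the squared gradient below \<open>T\<close>, as the
    gradient is shorter than 3 b on \<open>U\<close>; the second keeps \<open>w\<close> at most
    \<open>\<epsilon>\<close>, as w \<le> (R^2 / 2) (b / c) = b R inside the sphere.\<close>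
  define b where "b = min (sqrt T / 4) (\<epsilon> / R)"
  have b: "b > 0" "b * R \<le> \<epsilon>" "9 * b\<^sup>2 < T" "b\<^sup>2 < T"
  proof -
    show "b > 0" using T \<open>R > 0\<close> \<open>\<epsilon> > 0\<close> by (simp add: b_def)
    have "b * R \<le> \<epsilon> / R * R" using \<open>R > 0\<close> by (intro mult_right_mono) (auto simp: b_def)
    then show "b * R \<le> \<epsilon>" using \<open>R > 0\<close> by simp
    have "b \<le> sqrt T / 4" unfolding b_def by (rule min.cobounded1)
    then have "b\<^sup>2 \<le> (sqrt T / 4)\<^sup>2" using \<open>b > 0\<close> by (intro power_mono) auto
    then have "b\<^sup>2 \<le> T / 16" using T by (simp add: power_divide)
    then show "9 * b\<^sup>2 < T" "b\<^sup>2 < T" using T by linarith+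
  qed
  define \<gamma> where "\<gamma> x = g m (x\<^sup>2 / N)" for x
  have sqN: "0 < x\<^sup>2 / N \<and> x\<^sup>2 / N < T" if "0 < x" "x \<le> b" for x
  proof -
    have "x\<^sup>2 \<le> b\<^sup>2" using that by (intro power_mono) auto
    moreover have "x\<^sup>2 / N \<le> x\<^sup>2 / 1" using N by (intro divide_left_mono) auto
    moreover have "0 < x\<^sup>2 / N" using that N by simp
    ultimately show ?thesis using b(4) by simp
  qed
  have \<gamma>pos: "0 < \<gamma> x" if "0 < x" "x \<le> b" for x
    using sqN[OF that] gpos by (simp add: \<gamma>_def)
  have \<gamma>c: "continuous_on {0<..b} \<gamma>"
    unfolding \<gamma>_def[abs_def] using N
    by (intro continuous_on_compose2[OF gc] continuous_intros) auto
  \<comment> \<open>On \<open>U\<close> the variable s stays below 9/8 R^2, well inside the interval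
    on which the profile is solved.\<close>
  define S where "S = 2 * R\<^sup>2"
  have S: "S > 0" using \<open>R > 0\<close> by (simp add: S_def)
  have "\<exists>z. \<forall>t. 0 < t \<and> t < S \<longrightarrow> 0 < z t \<and> z t < b \<and> (z has_real_derivative - (K * z t / \<gamma> (z t))) (at t)"
  proof (rule decreasing_profile[OF b(1) \<gamma>c \<gamma>pos K S])
    show "\<exists>e. 0 < e \<and> e < b \<and> M \<le> integral {e..b} (\<lambda>x. \<gamma> x / x)" for M
      unfolding \<gamma>_def N_def by (rule G_int_unbounded[OF gc _ _ b(1)]) (use gnn Ginf b(1) in auto)
  qed
  then obtain z where z: "\<And>t. 0 < t \<Longrightarrow> t < S \<Longrightarrow> 0 < z t" "\<And>t. 0 < t \<Longrightarrow> t < S \<Longrightarrow> z t < b"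
    "\<And>t. 0 < t \<Longrightarrow> t < S \<Longrightarrow> (z has_real_derivative - (K * z t / \<gamma> (z t))) (at t)" by blast
  define v where "v t = z t / c" for t
  define p where "p t = K * z t / \<gamma> (z t) / c" for t
  have v: "0 < v t" "v t < b / c" if "0 < t" "t < S" for t
    using z(1,2)[OF that] c by (simp_all add: v_def divide_strict_right_mono)
  have dv: "(v has_real_derivative - p t) (at t)" if "0 < t" "t < S" for t
    using DERIV_cdivide[OF z(3)[OF that], of c] by (simp add: v_def[abs_def] p_def)
  have zc: "continuous_on {0<..<S} z"
    by (intro continuous_at_imp_continuous_on ballI DERIV_isCont[OF z(3)]) auto
  have vc: "continuous_on {0<..<S} v"
    by (intro continuous_at_imp_continuous_on ballI DERIV_isCont[OF dv]) auto
  have pc: "continuous_on {0<..<S} p"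
    unfolding p_def[abs_def]
  proof (intro continuous_intros zc continuous_on_compose2[OF \<gamma>c zc])
    show "z ` {0<..<S} \<subseteq> {0<..b}" by (auto intro!: z(1) less_imp_le[OF z(2)])
    show "\<forall>t\<in>{0<..<S}. \<gamma> (z t) \<noteq> 0"
    proof
      fix t assume "t \<in> {0<..<S}"
      then show "\<gamma> (z t) \<noteq> 0" using \<gamma>pos[of "z t"] z(1,2)[of t] by simp
    qed
    show "\<forall>t\<in>{0<..<S}. c \<noteq> 0" using c by simp
  qed
  \<comment> \<open>The base point lies below all values of s on \<open>U\<close> and cancels in
    \<open>w\<close>.\<close>
  define \<Psi> where "\<Psi> t = integral {R\<^sup>2 / 16..t} v" for t
  have R2: "R\<^sup>2 > 0" using \<open>R > 0\<close> by simp
  have d\<Psi>: "(\<Psi> has_real_derivative v t) (at t)" if t: "R\<^sup>2 / 16 < t" "t < 3 / 2 * R\<^sup>2" for t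
  proof -
    have "(\<Psi> has_real_derivative v t) (at t within {R\<^sup>2 / 16..3 / 2 * R\<^sup>2})"
      unfolding \<Psi>_def[abs_def]
      by (rule integral_has_real_derivative)
        (use t R2 in \<open>auto intro!: continuous_on_subset[OF vc] simp: S_def\<close>)
    then show ?thesis using t by (simp add: at_within_Icc_at)
  qed
  define s where "s x = (norm (x - y))\<^sup>2 / 2" for x
  have sU: "R\<^sup>2 / 8 < s x \<and> s x < 9 / 8 * R\<^sup>2" if "x \<in> U" for x
  proof -
    have "(R / 2)\<^sup>2 < (norm (x - y))\<^sup>2" using that \<open>R > 0\<close> unfolding U by (intro power_strict_mono) auto
    moreover have "(norm (x - y))\<^sup>2 < (3 / 2 * R)\<^sup>2" using that unfolding U by (intro power_strict_mono) auto
    ultimately show ?thesis by (simp add: s_def power_mult_distrib power_divide)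
  qed
  have sS: "0 < s x" "s x < S" "R\<^sup>2 / 16 < s x" "s x < 3 / 2 * R\<^sup>2" if "x \<in> U" for x
    using sU[OF that] R2 by (auto simp: S_def)
  have sc: "continuous_on U s" unfolding s_def[abs_def] by (intro continuous_intros) auto
  have ds: "((\<lambda>t. s (x + t *\<^sub>R axis i 1)) has_real_derivative (x - y) $ i) (at 0)" for x i
  proof -
    have "s (x + t *\<^sub>R axis i 1) = ((norm (x - y))\<^sup>2 + 2 * t * (x - y) $ i + t\<^sup>2) / 2" for t
    proof -
      have "x + t *\<^sub>R axis i 1 - y = (x - y) + t *\<^sub>R axis i 1" by simp
      then show ?thesis
        unfolding s_def power2_norm_eq_inner
        by (simp only:) (simp add: inner_add_left inner_add_right inner_axis inner_axis' power2_eq_square algebra_simps)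
    qed
    then show ?thesis by (simp only:) (auto intro!: derivative_eq_intros)
  qed
  define w where "w x = \<Psi> (R\<^sup>2 / 2) - \<Psi> (s x)" for x
  define W where "W x = - v (s x) *\<^sub>R (x - y)" for x
  define \<kappa> where "\<kappa> i x = g i ((W x $ i)\<^sup>2) * (p (s x) * ((x - y) $ i)\<^sup>2 - v (s x))" for i x
  have vsc: "continuous_on U (\<lambda>x. v (s x))" by (rule continuous_on_compose2[OF vc sc]) (use sS in auto)
  have psc: "continuous_on U (\<lambda>x. p (s x))" by (rule continuous_on_compose2[OF pc sc]) (use sS in auto)
  have Wc: "continuous_on U (\<lambda>x. W x $ i)" for i unfolding W_def by (intro continuous_intros vsc)
  have "continuous_on {R\<^sup>2 / 16<..<3 / 2 * R\<^sup>2} \<Psi>"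
    by (intro continuous_at_imp_continuous_on ballI DERIV_isCont[OF d\<Psi>]) auto
  then have wc: "continuous_on U w"
    unfolding w_def[abs_def] by (intro continuous_intros continuous_on_compose2[OF _ sc]) (use sS in auto)
  have \<kappa>c: "continuous_on U (\<kappa> i)" for i
    unfolding \<kappa>_def[abs_def] by (intro continuous_intros continuous_on_compose2[OF gc] Wc psc vsc) auto
  have dw: "((\<lambda>t. w (x + t *\<^sub>R axis i 1)) has_real_derivative W x $ i) (at 0)" if x: "x \<in> U" for x i
  proof -
    have "((\<lambda>t. \<Psi> (s (x + t *\<^sub>R axis i 1))) has_real_derivative v (s x) * ((x - y) $ i)) (at 0)"
      by (rule DERIV_chain2[where f=\<Psi> and g="\<lambda>t. s (x + t *\<^sub>R axis i 1)", OF _ ds]) (use d\<Psi>[of "s x"] sS[OF x] in simp)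
    then show ?thesis
      unfolding w_def by (auto intro!: derivative_eq_intros simp: W_def)
  qed
  have dW: "((\<lambda>t. W (x + t *\<^sub>R axis i 1) $ i) has_real_derivative p (s x) * ((x - y) $ i)\<^sup>2 - v (s x)) (at 0)"
    if x: "x \<in> U" for x i
  proof -
    have 1: "((\<lambda>t. v (s (x + t *\<^sub>R axis i 1))) has_real_derivative - p (s x) * ((x - y) $ i)) (at 0)"
      by (rule DERIV_chain2[where f=v and g="\<lambda>t. s (x + t *\<^sub>R axis i 1)", OF _ ds]) (use dv[of "s x"] sS[OF x] in simp)
    have 2: "((\<lambda>t. - ((x - y) $ i + t)) has_real_derivative - 1) (at 0)"
      by (auto intro!: derivative_eq_intros)
    have "(\<lambda>t. W (x + t *\<^sub>R axis i 1) $ i) = (\<lambda>t. v (s (x + t *\<^sub>R axis i 1)) * - ((x - y) $ i + t))"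
      by (auto simp: W_def fun_eq_iff algebra_simps)
    then show ?thesis using DERIV_mult[OF 1 2] by (simp add: power2_eq_square algebra_simps)
  qed
  have d\<kappa>: "((\<lambda>t. l i (W (x + t *\<^sub>R axis i 1) $ i)) has_real_derivative \<kappa> i x) (at 0)" if x: "x \<in> U" for x i
    unfolding \<kappa>_def
    by (rule DERIV_chain2[where f="l i" and g="\<lambda>t. W (x + t *\<^sub>R axis i 1) $ i", OF _ dW[OF x]])
      (use dl[of i "W x $ i"] in simp)
  have \<kappa>pos: "0 < (\<Sum>i\<in>UNIV. \<kappa> i x)" if x: "x \<in> U" for x
  proof -
    define r where "r = norm (x - y)"
    have r: "c < r" "r < 3 * c" using x by (auto simp: U r_def c_def)
    define V where "V = v (s x)"
    have V: "0 < V" "V * c = z (s x)" "V * c < b" using v[OF sS(1,2)[OF x]] c by (auto simp: V_def v_def field_simps)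
    define P where "P = p (s x)"
    have zs: "0 < z (s x)" "z (s x) < b" using z(1,2)[OF sS(1,2)[OF x]] .
    have Pg: "P * c * \<gamma> (z (s x)) = K * z (s x)" and P: "P > 0"
      using \<gamma>pos[of "z (s x)"] zs c K by (auto simp: P_def p_def)
    define t where "t i = (W x $ i)\<^sup>2" for i
    \<comment> \<open>The mean of the numbers \<open>t i\<close>, that is, the squared length of the
      gradient divided by \<open>N\<close>; Jensen's inequality is applied at this point.\<close>
    define \<tau> where "\<tau> = V\<^sup>2 * r\<^sup>2 / N"
    have teq: "t i = V\<^sup>2 * ((x - y) $ i)\<^sup>2" for i by (simp add: t_def W_def V_def power_mult_distrib)
    have r2: "(\<Sum>i\<in>UNIV. ((x - y) $ i)\<^sup>2) = r\<^sup>2"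
      unfolding r_def power2_norm_eq_inner inner_vec_def by (simp add: power2_eq_square)
    have tsum: "(\<Sum>i\<in>UNIV. t i) = N * \<tau>"
    proof -
      have "(\<Sum>i\<in>UNIV. t i) = V\<^sup>2 * r\<^sup>2" unfolding teq r2[symmetric] by (rule sum_distrib_left[symmetric])
      then show ?thesis using N by (simp add: \<tau>_def)
    qed
    have "V * r \<le> V * (3 * c)" using V r by (intro mult_left_mono) auto
    then have "V * r \<le> 3 * (V * c)" by (simp add: algebra_simps)
    then have "V * r < 3 * b" using V(3) by linarith
    then have "(V * r)\<^sup>2 < (3 * b)\<^sup>2" using V r c by (intro power_strict_mono) auto
    then have Vr: "V\<^sup>2 * r\<^sup>2 < T" using b(3) by (simp add: power_mult_distrib)
    have tT: "0 \<le> t i \<and> t i < T" for i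
    proof -
      have "((x - y) $ i)\<^sup>2 \<le> r\<^sup>2" unfolding r_def
        using component_le_norm_cart[of "x - y" i] by (metis abs_le_square_iff abs_norm_cancel)
      then have "V\<^sup>2 * ((x - y) $ i)\<^sup>2 \<le> V\<^sup>2 * r\<^sup>2" by (intro mult_left_mono) auto
      then show ?thesis using Vr by (simp add: teq)
    qed
    have \<tau>T: "0 < \<tau>" "\<tau> < T"
    proof -
      show "0 < \<tau>" using V r c N by (simp add: \<tau>_def)
      have "\<tau> \<le> V\<^sup>2 * r\<^sup>2 / 1" unfolding \<tau>_def using N by (intro divide_left_mono) auto
      then show "\<tau> < T" using Vr by simp
    qed
    have conv: "N * (\<tau> * g m \<tau>) \<le> (\<Sum>i\<in>UNIV. t i * g m (t i))"
      unfolding N_def by (rule gconv[OF tT \<tau>T]) (use tsum in \<open>simp add: N_def\<close>)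
    \<comment> \<open>Monotonicity of \<open>g m\<close> passes from z^2 / N, the argument in the
      profile equation, to the mean \<open>\<tau>\<close>.\<close>
    have "\<gamma> (z (s x)) \<le> g m \<tau>" unfolding \<gamma>_def
    proof (rule gmono)
      show "0 < (z (s x))\<^sup>2 / N" using sqN zs by simp
      have "(V * c)\<^sup>2 \<le> (V * r)\<^sup>2" using V(1) r c by (intro power_mono mult_left_mono) auto
      then show "(z (s x))\<^sup>2 / N \<le> \<tau>" unfolding \<tau>_def V(2)[symmetric] using N
        by (intro divide_right_mono) (auto simp: power_mult_distrib)
    qed (rule \<tau>T)
    moreover have "0 \<le> \<gamma> (z (s x))" using \<gamma>pos[of "z (s x)"] zs by simp
    ultimately have "c\<^sup>2 * \<gamma> (z (s x)) \<le> r\<^sup>2 * g m \<tau>"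
      using r c by (intro mult_mono power_mono) auto
    then have "P * (c\<^sup>2 * \<gamma> (z (s x))) \<le> P * (r\<^sup>2 * g m \<tau>)" using P by (intro mult_left_mono) auto
    \<comment> \<open>The profile equation and the choice of \<open>K\<close> enter here: P c
      \<gamma> = K z and K c^2 = N + 1.\<close>
    moreover have "P * (c\<^sup>2 * \<gamma> (z (s x))) = (N + 1) * V"
    proof -
      have "P * (c\<^sup>2 * \<gamma> (z (s x))) = c * (P * c * \<gamma> (z (s x)))" by (simp add: power2_eq_square)
      also have "\<dots> = c * K * (V * c)" unfolding Pg V(2) by simp
      also have "\<dots> = (K * c\<^sup>2) * V" by (simp add: power2_eq_square)
      also have "K * c\<^sup>2 = N + 1" using c by (simp add: K_def)
      finally show ?thesis .
    qed
    moreover have "P * (r\<^sup>2 * g m \<tau>) = P / V\<^sup>2 * (N * (\<tau> * g m \<tau>))"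
      using V N by (simp add: \<tau>_def)
    moreover have "P / V\<^sup>2 * (N * (\<tau> * g m \<tau>)) \<le> P / V\<^sup>2 * (\<Sum>i\<in>UNIV. t i * g m (t i))"
      using P by (intro mult_left_mono conv) auto
    moreover have "P / V\<^sup>2 * (\<Sum>i\<in>UNIV. t i * g m (t i)) = (\<Sum>i\<in>UNIV. P * ((x - y) $ i)\<^sup>2 * g m (t i))"
      unfolding sum_distrib_left using V by (intro sum.cong refl) (simp add: teq)
    ultimately have low: "(N + 1) * V \<le> (\<Sum>i\<in>UNIV. P * ((x - y) $ i)\<^sup>2 * g m (t i))" by linarith
    have "(\<Sum>i\<in>(UNIV::'n set). P * ((x - y) $ i)\<^sup>2 * g m (t i) - V) \<le> (\<Sum>i\<in>UNIV. \<kappa> i x)"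
    proof (rule sum_mono)
      fix i
      have gi: "g m (t i) \<le> g i (t i)" "g i (t i) \<le> 1" using gb[of "t i" i] tT[of i] by auto
      have "P * ((x - y) $ i)\<^sup>2 * g m (t i) \<le> P * ((x - y) $ i)\<^sup>2 * g i (t i)"
        using P gi by (intro mult_left_mono) auto
      moreover have "V * g i (t i) \<le> V * 1" using V gi by (intro mult_left_mono) auto
      ultimately show "P * ((x - y) $ i)\<^sup>2 * g m (t i) - V \<le> \<kappa> i x"
        unfolding \<kappa>_def P_def V_def t_def by (simp add: algebra_simps)
    qed
    also have "(\<Sum>i\<in>(UNIV::'n set). P * ((x - y) $ i)\<^sup>2 * g m (t i) - V) = (\<Sum>i\<in>UNIV. P * ((x - y) $ i)\<^sup>2 * g m (t i)) - N * V"
      by (simp add: sum_subtractf N_def)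
    finally have "(N + 1) * V - N * V \<le> (\<Sum>i\<in>UNIV. \<kappa> i x)" using low by linarith
    then show ?thesis using V(1) by (simp add: algebra_simps)
  qed
  have up: "w x \<le> \<epsilon>" if x: "x \<in> U" and sx: "s x < R\<^sup>2 / 2" for x
  proof -
    obtain q where q: "s x < q" "q < R\<^sup>2 / 2" "\<Psi> (R\<^sup>2 / 2) - \<Psi> (s x) = (R\<^sup>2 / 2 - s x) * v q"
      using MVT2[OF sx, of \<Psi> v] d\<Psi> sS[OF x] R2 by force
    have "0 < q" "q < S" using q sS[OF x] R2 by (auto simp: S_def)
    then have vq: "v q \<le> b / c" "0 < v q" using v by (auto intro: less_imp_le)
    have "w x \<le> R\<^sup>2 / 2 * (b / c)" unfolding w_def q(3) using vq sS[OF x] by (intro mult_mono) auto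
    also have "\<dots> = b * R" using \<open>R > 0\<close> by (simp add: c_def power2_eq_square)
    finally show ?thesis using b(2) by simp
  qed
  have down: "w x < 0" if x: "x \<in> U" and sx: "R\<^sup>2 / 2 < s x" for x
  proof -
    obtain q where q: "R\<^sup>2 / 2 < q" "q < s x" "\<Psi> (s x) - \<Psi> (R\<^sup>2 / 2) = (s x - R\<^sup>2 / 2) * v q"
      using MVT2[OF sx, of \<Psi> v] d\<Psi> sS[OF x] R2 by force
    have "0 < q" "q < S" using q sS[OF x] R2 by (auto simp: S_def)
    then have "0 < (s x - R\<^sup>2 / 2) * v q" using v sx by simp
    then show ?thesis using q(3) by (simp add: w_def)
  qed
  have wle: "w x \<le> \<epsilon>" if "x \<in> U" for x
  proof (cases "s x" "R\<^sup>2 / 2" rule: linorder_cases)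
    case equal
    then have "w x = 0" by (simp only: w_def)
    then show ?thesis using \<open>\<epsilon> > 0\<close> by simp
  qed (use up[OF that] down[OF that] \<open>\<epsilon> > 0\<close> in auto)
  have wneg: "w x < 0" if "x \<in> U" "R < norm (x - y)" for x
  proof (rule down[OF that(1)])
    have "R\<^sup>2 < (norm (x - y))\<^sup>2" using that \<open>R > 0\<close> by (intro power_strict_mono) auto
    then show "R\<^sup>2 / 2 < s x" by (simp add: s_def)
  qed
  have w0: "w x = 0" if "norm (x - y) = R" for x using that by (simp add: w_def s_def)
  show ?thesis
    by (rule exI[of _ w], rule exI[of _ W], rule exI[of _ \<kappa>])
      (use wc Wc \<kappa>c dw d\<kappa> \<kappa>pos wle wneg w0 in simp)
qed

section \<open>The strong maximum principle\<close>

text \<open>The definitions integrate over \<open>lebesgue_on \<Omega>\<close>, whereas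
  mollification uses translation invariance and Tonelli for \<open>lborel\<close> on the whole
  space; extension by 0 and Borel representatives connect the two.\<close>

lemma lebesgue_on_eq_lborel_integral:
  fixes F G :: "real ^ 'n::finite \<Rightarrow> real"
  assumes \<Omega>: "open \<Omega>" and F: "F \<in> borel_measurable (lebesgue_on \<Omega>)" and G: "G \<in> borel_measurable borel"
    and eq: "AE x in lborel. x \<in> \<Omega> \<longrightarrow> F x = G x" and out: "\<And>x. x \<notin> \<Omega> \<Longrightarrow> G x = 0"
  shows "integral\<^sup>L (lebesgue_on \<Omega>) F = (\<integral>x. G x \<partial>lborel)"
proof -
  have \<Omega>': "\<Omega> \<inter> space lebesgue \<in> sets lebesgue" using \<Omega> by simp
  have Gm: "G \<in> borel_measurable lborel" using G by simp
  have "integral\<^sup>L (lebesgue_on \<Omega>) F = (\<integral>x. indicator \<Omega> x *\<^sub>R F x \<partial>lebesgue)"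
    by (rule integral_restrict_space[OF \<Omega>'])
  also have "\<dots> = (\<integral>x. G x \<partial>lebesgue)"
  proof (rule integral_cong_AE)
    show "(\<lambda>x. indicator \<Omega> x *\<^sub>R F x) \<in> borel_measurable lebesgue"
      by (rule borel_measurable_restrict_space_iff[OF \<Omega>', THEN iffD1, OF F])
    show "G \<in> borel_measurable lebesgue" using Gm by (rule measurable_completion)
    have "AE x in lebesgue. x \<in> \<Omega> \<longrightarrow> F x = G x" using eq by (rule AE_completion)
    then show "AE x in lebesgue. indicator \<Omega> x *\<^sub>R F x = G x"
    proof eventually_elim
      fix x assume "x \<in> \<Omega> \<longrightarrow> F x = G x"
      then show "indicator \<Omega> x *\<^sub>R F x = G x" using out[of x] by (cases "x \<in> \<Omega>") auto
    qed
  qed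
  also have "\<dots> = (\<integral>x. G x \<partial>lborel)" by (rule integral_completion[OF Gm])
  finally show ?thesis .
qed

text \<open>A weak gradient matters only up to null sets, so after extension by 0 each component may
  be replaced by a Borel function that agrees with it almost everywhere.\<close>

lemma borel_representative:
  fixes v :: "real ^ 'n::finite \<Rightarrow> real ^ 'n"
  assumes \<Omega>: "open \<Omega>" and v: "v square_integrable_on \<Omega>"
  obtains V :: "real ^ 'n \<Rightarrow> real ^ 'n" where
    "\<And>i. (\<lambda>x. V x $ i) \<in> borel_measurable borel" "\<And>i. integrable lborel (\<lambda>x. (V x $ i)\<^sup>2)"
    "AE x in lborel. x \<in> \<Omega> \<longrightarrow> v x = V x" "\<And>x. x \<notin> \<Omega> \<Longrightarrow> V x = 0"
proof -
  have \<Omega>': "\<Omega> \<inter> space lebesgue \<in> sets lebesgue" using \<Omega> by simp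
  have vm: "v \<in> borel_measurable (lebesgue_on \<Omega>)" and vi: "integrable (lebesgue_on \<Omega>) (\<lambda>x. (norm (v x))\<^sup>2)"
    using v by (auto simp: square_integrable_on_def)
  have vm': "(\<lambda>x. indicator \<Omega> x *\<^sub>R v x) \<in> borel_measurable lebesgue"
    by (rule borel_measurable_restrict_space_iff[OF \<Omega>', THEN iffD1, OF vm])
  have "\<exists>v'\<in>borel_measurable lborel. AE x in lborel. (indicator \<Omega> x *\<^sub>R v x) $ i = v' x" for i
  proof (rule completion_ex_borel_measurable_real)
    show "(\<lambda>x. (indicator \<Omega> x *\<^sub>R v x) $ i) \<in> borel_measurable lebesgue"
      using vm' by (rule borel_measurable_continuous_on[OF continuous_on_component[OF continuous_on_id]])
  qed
  then have "\<forall>i. \<exists>v'. v' \<in> borel_measurable lborel \<and> (AE x in lborel. (indicator \<Omega> x *\<^sub>R v x) $ i = v' x)" by blast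
  then obtain v' where v': "\<forall>i. v' i \<in> borel_measurable lborel \<and> (AE x in lborel. (indicator \<Omega> x *\<^sub>R v x) $ i = v' i x)"
    unfolding choice_iff by blast
  define V where "V x = (\<chi> i. if x \<in> \<Omega> then v' i x else 0)" for x
  have Vm: "(\<lambda>x. V x $ i) \<in> borel_measurable borel" for i
  proof -
    have "v' i \<in> borel_measurable borel" using v' by simp
    then have "(\<lambda>x. if x \<in> \<Omega> then v' i x else 0) \<in> borel_measurable borel"
      by (intro measurable_If_set) (use \<Omega> in auto)
    then show ?thesis by (simp add: V_def)
  qed
  have "AE x in lborel. \<forall>i\<in>UNIV. (indicator \<Omega> x *\<^sub>R v x) $ i = v' i x"
    by (rule AE_finite_allI) (use v' in auto)
  then have ae: "AE x in lborel. x \<in> \<Omega> \<longrightarrow> v x = V x"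
  proof eventually_elim
    fix x assume "\<forall>i\<in>UNIV. (indicator \<Omega> x *\<^sub>R v x) $ i = v' i x"
    then show "x \<in> \<Omega> \<longrightarrow> v x = V x" by (cases "x \<in> \<Omega>") (simp_all add: V_def vec_eq_iff)
  qed
  have V2: "integrable lborel (\<lambda>x. (V x $ i)\<^sup>2)" for i
  proof -
    have m: "(\<lambda>x. (V x $ i)\<^sup>2) \<in> borel_measurable lborel" using Vm[of i] by simp
    have "integrable lebesgue (\<lambda>x. indicator \<Omega> x *\<^sub>R (norm (v x))\<^sup>2)"
      by (rule integrable_restrict_space[OF \<Omega>', THEN iffD1, OF vi])
    then have "integrable lebesgue (\<lambda>x. (V x $ i)\<^sup>2)"
    proof (rule Bochner_Integration.integrable_bound)
      show "(\<lambda>x. (V x $ i)\<^sup>2) \<in> borel_measurable lebesgue" using m by (rule measurable_completion)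
      have "AE x in lebesgue. x \<in> \<Omega> \<longrightarrow> v x = V x" using ae by (rule AE_completion)
      then show "AE x in lebesgue. norm ((V x $ i)\<^sup>2) \<le> norm (indicator \<Omega> x *\<^sub>R (norm (v x))\<^sup>2)"
      proof eventually_elim
        fix x assume x: "x \<in> \<Omega> \<longrightarrow> v x = V x"
        have "\<bar>V x $ i\<bar>\<^sup>2 \<le> (norm (V x))\<^sup>2" by (intro power_mono component_le_norm_cart) auto
        then show "norm ((V x $ i)\<^sup>2) \<le> norm (indicator \<Omega> x *\<^sub>R (norm (v x))\<^sup>2)"
          using x by (cases "x \<in> \<Omega>") (auto simp: V_def)
      qed
    qed
    then show ?thesis by (rule integrable_completion[OF m, THEN iffD1])
  qed
  show ?thesis
  proof (rule that[of V])
    show "V x = 0" if "x \<notin> \<Omega>" for x using that by (simp add: V_def vec_eq_iff)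
  qed (fact Vm V2 ae)+
qed

text \<open>The comparison ball around \<open>a\<close> has radius at most R / 4 and so stays in the
  annulus of the barrier. The part of its sphere inside the closed ball about \<open>y\<close> is
  compact and avoids \<open>a\<close>; this yields a positive \<open>\<epsilon>\<close>, to which
  the barrier is fitted afterwards.\<close>

lemma no_interior_contact:
  fixes \<Omega> :: "(real ^ 'n::finite) set" and g f :: "'n \<Rightarrow> real \<Rightarrow> real" and u :: "real ^ 'n \<Rightarrow> real"
  assumes card: "CARD('n) \<ge> 2" and \<Omega>: "open \<Omega>"
    and g: "\<And>i. continuous_on {0..} (g i)" "\<forall>i. \<forall>t\<ge>0. 0 \<le> g i t"
    and L: "assumption_L g m" and ode: "\<And>i. solves_ode (g i) (f i)" and G: "assumption_G f"
    and Ginf: "\<forall>\<xi>>0. G_int g m \<xi> = \<infinity>"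
    and uc: "continuous_on \<Omega> u" and super: "weak_supersolution \<Omega> f u"
    and a: "a \<in> \<Omega>" "\<And>x. x \<in> \<Omega> \<Longrightarrow> u a \<le> u x"
    and R: "R > 0" "norm (a - y) = R" and ball: "\<And>x. x \<in> \<Omega> \<Longrightarrow> norm (x - y) \<le> R \<Longrightarrow> x \<noteq> a \<Longrightarrow> u a < u x"
  shows False
proof -
  have "\<forall>i. \<exists>l. \<exists>C. (\<forall>s. ((\<lambda>s. f i (s\<^sup>2) * s\<^sup>2) has_real_derivative 2 * l s) (at s)) \<and>
     (\<forall>s. (l has_real_derivative g i (s\<^sup>2)) (at s)) \<and> (\<forall>s. \<bar>l s\<bar> \<le> C * \<bar>s\<bar>)"
  proof
    fix i
    have "bounded (f i ` {0..})" using G by (simp add: assumption_G_def)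
    then show "\<exists>l. \<exists>C. (\<forall>s. ((\<lambda>s. f i (s\<^sup>2) * s\<^sup>2) has_real_derivative 2 * l s) (at s)) \<and>
     (\<forall>s. (l has_real_derivative g i (s\<^sup>2)) (at s)) \<and> (\<forall>s. \<bar>l s\<bar> \<le> C * \<bar>s\<bar>)"
      by (rule flux_exists[OF ode _ g(1)]) (use g(2) in blast)
  qed
  then obtain l C0 where l: "\<forall>i. (\<forall>s. ((\<lambda>s. f i (s\<^sup>2) * s\<^sup>2) has_real_derivative 2 * l i s) (at s)) \<and>
     (\<forall>s. (l i has_real_derivative g i (s\<^sup>2)) (at s)) \<and> (\<forall>s. \<bar>l i s\<bar> \<le> C0 i * \<bar>s\<bar>)"
    unfolding choice_iff by blast
  then have lF: "\<And>i s. ((\<lambda>s. f i (s\<^sup>2) * s\<^sup>2) has_real_derivative 2 * l i s) (at s)"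
    and dl: "\<And>i s. (l i has_real_derivative g i (s\<^sup>2)) (at s)" and lC: "\<And>i s. \<bar>l i s\<bar> \<le> C0 i * \<bar>s\<bar>"
    by blast+
  have lc: "continuous_on UNIV (l i)" for i
    by (intro continuous_at_imp_continuous_on ballI DERIV_isCont[OF dl])
  have lmono: "mono (l i)" for i
  proof (rule monoI)
    fix s t :: real assume "s \<le> t"
    then show "l i s \<le> l i t"
    proof (rule DERIV_nonneg_imp_nondecreasing)
      show "\<exists>y. (l i has_real_derivative y) (at x) \<and> 0 \<le> y" for x
        using dl[of i x] g(2) by auto
    qed
  qed
  define C where "C = (\<Sum>i\<in>UNIV. \<bar>C0 i\<bar>)"
  have lgrow: "\<bar>l i s\<bar> \<le> C * \<bar>s\<bar>" for i s
  proof -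
    have "C0 i \<le> \<bar>C0 i\<bar>" by simp
    also have "\<bar>C0 i\<bar> \<le> C" unfolding C_def by (rule member_le_sum) auto
    finally have "C0 i * \<bar>s\<bar> \<le> C * \<bar>s\<bar>" by (intro mult_right_mono) auto
    then show ?thesis using lC[of i s] by linarith
  qed
  obtain Du where Du: "has_L2_gradient \<Omega> u Du"
    and sup: "\<And>\<eta>. test_fun \<Omega> \<eta> \<Longrightarrow> (\<And>x. 0 \<le> \<eta> x) \<Longrightarrow>
        0 \<le> (\<integral>x. grad (Lagr f) (Du x) \<bullet> grad \<eta> x \<partial>lebesgue_on \<Omega>)"
    using super unfolding weak_supersolution_def by blast
  have Du2: "Du square_integrable_on \<Omega>" and um: "u \<in> borel_measurable (lebesgue_on \<Omega>)"
    and Dug: "\<And>\<phi> i. test_fun \<Omega> \<phi> \<Longrightarrow> (\<integral>x. u x * partial_deriv i \<phi> x \<partial>lebesgue_on \<Omega>)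
          = - (\<integral>x. Du x $ i * \<phi> x \<partial>lebesgue_on \<Omega>)"
    using Du unfolding has_L2_gradient_def square_integrable_on_def by blast+
  obtain V :: "real ^ 'n \<Rightarrow> real ^ 'n" where
    Vm: "\<And>i. (\<lambda>x. V x $ i) \<in> borel_measurable borel" and V2: "\<And>i. integrable lborel (\<lambda>x. (V x $ i)\<^sup>2)"
    and Vae: "AE x in lborel. x \<in> \<Omega> \<longrightarrow> Du x = V x" and Vout: "\<And>x. x \<notin> \<Omega> \<Longrightarrow> V x = 0"
    by (rule borel_representative[OF \<Omega> Du2]) blast
  have Dum: "(\<lambda>x. Du x $ i) \<in> borel_measurable (lebesgue_on \<Omega>)" for i
  proof -
    have "Du \<in> borel_measurable (lebesgue_on \<Omega>)" using Du2 by (simp add: square_integrable_on_def)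
    then show ?thesis by (rule borel_measurable_continuous_on[OF continuous_on_component[OF continuous_on_id]])
  qed
  have bl: "h \<in> borel_measurable (lebesgue_on \<Omega>)" if "h \<in> borel_measurable borel" for h :: "real ^ 'n \<Rightarrow> real"
    using that by (intro measurable_restrict_space1 measurable_completion) simp
  have tm: "\<phi> \<in> borel_measurable borel" if "test_fun A \<phi>" for A \<phi>
    using test_fun_continuous[OF that] by (rule borel_measurable_continuous_onI)

  obtain d where d: "d > 0" "cball a d \<subseteq> \<Omega>" using \<Omega> a(1) open_contains_cball by blast
  define \<delta> where "\<delta> = min d (R / 4)"
  have \<delta>: "\<delta> > 0" "cball a \<delta> \<subseteq> \<Omega>" "\<delta> \<le> R / 4" using d R by (auto simp: \<delta>_def)
  let ?B = "ball a \<delta>"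
  have B\<Omega>: "?B \<subseteq> \<Omega>" using \<delta>(2) ball_subset_cball by blast
  have ucB: "continuous_on (cball a \<delta>) u" using uc \<delta>(2) by (rule continuous_on_subset)
  define U where "U = {x. R / 2 < norm (x - y) \<and> norm (x - y) < 3 / 2 * R}"
  have Uo: "open U"
  proof -
    have "U = {x. R / 2 < norm (x - y)} \<inter> {x. norm (x - y) < 3 / 2 * R}" by (auto simp: U_def)
    then show ?thesis by (auto intro!: open_Int open_Collect_less continuous_intros)
  qed
  have BU: "cball a \<delta> \<subseteq> U"
  proof
    fix x assume x: "x \<in> cball a \<delta>"
    then have "norm (x - a) \<le> R / 4" using \<delta>(3) by (simp add: dist_norm norm_minus_commute)
    moreover have "norm (a - y) \<le> norm (x - a) + norm (x - y)"
      using norm_triangle_ineq[of "a - x" "x - y"] by (simp add: norm_minus_commute)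
    moreover have "norm (x - y) \<le> norm (x - a) + norm (a - y)"
      using norm_triangle_ineq[of "x - a" "a - y"] by simp
    ultimately show "x \<in> U" using R by (simp add: U_def)
  qed

  obtain \<epsilon> where \<epsilon>: "\<epsilon> > 0" "\<And>x. x \<in> sphere a \<delta> \<Longrightarrow> norm (x - y) \<le> R \<Longrightarrow> u a + \<epsilon> < u x"
  proof (cases "sphere a \<delta> \<inter> cball y R = {}")
    case True
    show ?thesis
    proof (rule that[of 1])
      fix x assume "x \<in> sphere a \<delta>" "norm (x - y) \<le> R"
      then have "x \<in> sphere a \<delta> \<inter> cball y R" by (simp add: dist_norm norm_minus_commute)
      then show "u a + 1 < u x" using True by blast
    qed simp
  next
    case False
    have k: "compact (sphere a \<delta> \<inter> cball y R)" by (intro compact_Int) auto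
    have "sphere a \<delta> \<inter> cball y R \<subseteq> cball a \<delta>" by auto
    then have "continuous_on (sphere a \<delta> \<inter> cball y R) u" using ucB continuous_on_subset by blast
    from continuous_attains_inf[OF k False this]
    obtain z where z: "z \<in> sphere a \<delta>" "z \<in> cball y R"
      "\<And>x. x \<in> sphere a \<delta> \<inter> cball y R \<Longrightarrow> u z \<le> u x" by blast
    have "z \<in> \<Omega>" using z(1) \<delta>(2) by auto
    moreover have "z \<noteq> a" using z(1) \<delta>(1) by auto
    moreover have "norm (z - y) \<le> R" using z(2) by (simp add: dist_norm norm_minus_commute)
    ultimately have uz: "u a < u z" using ball by blast
    show ?thesis
    proof (rule that[of "(u z - u a) / 2"])
      fix x assume "x \<in> sphere a \<delta>" "norm (x - y) \<le> R"
      then have "u z \<le> u x" by (intro z(3)) (simp add: dist_norm norm_minus_commute)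
      then show "u a + (u z - u a) / 2 < u x" using uz by (simp add: field_simps)
    qed (use uz in simp)
  qed
  obtain w W \<kappa> where wc: "continuous_on U w" and Wc: "\<forall>i. continuous_on U (\<lambda>x. W x $ i)" and \<kappa>c: "\<forall>i. continuous_on U (\<kappa> i)"
    and dw: "\<forall>i. \<forall>x\<in>U. ((\<lambda>t. w (x + t *\<^sub>R axis i 1)) has_real_derivative W x $ i) (at 0)"
    and d\<kappa>: "\<forall>i. \<forall>x\<in>U. ((\<lambda>t. l i (W (x + t *\<^sub>R axis i 1) $ i)) has_real_derivative \<kappa> i x) (at 0)"
    and \<kappa>pos: "\<forall>x\<in>U. 0 < (\<Sum>i\<in>UNIV. \<kappa> i x)" and wle: "\<forall>x\<in>U. w x \<le> \<epsilon>"
    and wneg: "\<forall>x\<in>U. R < norm (x - y) \<longrightarrow> w x < 0" and w0: "\<forall>x\<in>U. norm (x - y) = R \<longrightarrow> w x = 0"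
    using barrier_exists[OF L card g Ginf dl R(1) \<epsilon>(1) U_def] by (elim exE conjE) (rule that)
  have "w a + u a < u a"
  proof (rule comparison_principle[where U=U and V=V and W=W and l=l and \<kappa>=\<kappa> and C=C and w="\<lambda>x. w x + u a", OF \<delta>(1) Uo BU ucB Vm V2])
    fix \<phi> i assume t: "test_fun ?B \<phi>"
    then have t\<Omega>: "test_fun \<Omega> \<phi>" using B\<Omega> by (rule test_fun_mono)
    note tp = test_fun_partial_deriv[OF t, of i]
    have out: "\<psi> x = 0" if \<psi>: "test_fun ?B \<psi>" and x: "x \<notin> ?B" for \<psi> x
    proof -
      obtain K where "K \<subseteq> ?B" "\<And>x. x \<notin> K \<Longrightarrow> \<psi> x = 0" using \<psi> by (rule test_funE) blast
      then show ?thesis using x by blast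
    qed
    have "(\<integral>x. (if x \<in> ?B then u x * partial_deriv i \<phi> x else 0) \<partial>lborel) = (\<integral>x. u x * partial_deriv i \<phi> x \<partial>lebesgue_on \<Omega>)"
    proof (rule lebesgue_on_eq_lborel_integral[OF \<Omega>, symmetric])
      show "(\<lambda>x. u x * partial_deriv i \<phi> x) \<in> borel_measurable (lebesgue_on \<Omega>)"
        by (intro borel_measurable_times um bl tm[OF tp])
      have "continuous_on (cball a \<delta>) (partial_deriv i \<phi>)"
        using test_fun_continuous[OF tp] continuous_on_subset by blast
      then show "(\<lambda>x. if x \<in> ?B then u x * partial_deriv i \<phi> x else 0) \<in> borel_measurable borel"
        by (intro cut_to_ball(2) continuous_intros ucB)
    qed (use B\<Omega> out[OF tp] in auto)
    also have "\<dots> = - (\<integral>x. Du x $ i * \<phi> x \<partial>lebesgue_on \<Omega>)" by (rule Dug[OF t\<Omega>])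
    also have "(\<integral>x. Du x $ i * \<phi> x \<partial>lebesgue_on \<Omega>) = (\<integral>x. V x $ i * \<phi> x \<partial>lborel)"
    proof (rule lebesgue_on_eq_lborel_integral[OF \<Omega>])
      show "(\<lambda>x. Du x $ i * \<phi> x) \<in> borel_measurable (lebesgue_on \<Omega>)"
        by (intro borel_measurable_times Dum bl tm[OF t])
      show "(\<lambda>x. V x $ i * \<phi> x) \<in> borel_measurable borel" by (intro borel_measurable_times Vm tm[OF t])
      show "AE x in lborel. x \<in> \<Omega> \<longrightarrow> Du x $ i * \<phi> x = V x $ i * \<phi> x" using Vae by eventually_elim simp
    qed (use Vout in simp)
    finally show "(\<integral>x. (if x \<in> ?B then u x * partial_deriv i \<phi> x else 0) \<partial>lborel) = - (\<integral>x. V x $ i * \<phi> x \<partial>lborel)" .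
  next
    fix \<eta> assume t: "test_fun ?B \<eta>" and nn: "\<And>x. 0 \<le> \<eta> x"
    have t\<Omega>: "test_fun \<Omega> \<eta>" using t B\<Omega> by (rule test_fun_mono)
    have F: "grad (Lagr f) (Du x) \<bullet> grad \<eta> x = (\<Sum>i\<in>UNIV. l i (Du x $ i) * partial_deriv i \<eta> x)" for x
      unfolding inner_vec_def grad_Lagr[of f l, OF lF] by (simp add: grad_def)
    have lm: "l i \<in> borel_measurable borel" for i using lc by (rule borel_measurable_continuous_onI)
    have "(\<integral>x. grad (Lagr f) (Du x) \<bullet> grad \<eta> x \<partial>lebesgue_on \<Omega>) = (\<integral>x. (\<Sum>i\<in>UNIV. l i (V x $ i) * partial_deriv i \<eta> x) \<partial>lborel)"
      unfolding F
    proof (rule lebesgue_on_eq_lborel_integral[OF \<Omega>])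
      show "(\<lambda>x. \<Sum>i\<in>UNIV. l i (Du x $ i) * partial_deriv i \<eta> x) \<in> borel_measurable (lebesgue_on \<Omega>)"
        by (intro borel_measurable_sum borel_measurable_times measurable_compose[OF Dum lm] bl tm[OF test_fun_partial_deriv[OF t]])
      show "(\<lambda>x. \<Sum>i\<in>UNIV. l i (V x $ i) * partial_deriv i \<eta> x) \<in> borel_measurable borel"
        by (intro borel_measurable_sum borel_measurable_times measurable_compose[OF Vm lm] tm[OF test_fun_partial_deriv[OF t]])
      show "AE x in lborel. x \<in> \<Omega> \<longrightarrow> (\<Sum>i\<in>UNIV. l i (Du x $ i) * partial_deriv i \<eta> x) = (\<Sum>i\<in>UNIV. l i (V x $ i) * partial_deriv i \<eta> x)"
        using Vae by eventually_elim simp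
      fix x assume "x \<notin> \<Omega>"
      \<comment> \<open>The linear growth bound at 0 forces \<open>l i 0 = 0\<close>.\<close>
      then have "l i (V x $ i) = 0" for i using Vout lgrow[of i 0] by simp
      then show "(\<Sum>i\<in>UNIV. l i (V x $ i) * partial_deriv i \<eta> x) = 0" by simp
    qed
    then show "0 \<le> (\<integral>x. (\<Sum>i\<in>UNIV. l i (V x $ i) * partial_deriv i \<eta> x) \<partial>lborel)"
      using sup[OF t\<Omega> nn] by simp
  next
    fix x assume x: "x \<in> sphere a \<delta>"
    then have xU: "x \<in> U" and x\<Omega>: "x \<in> \<Omega>" using BU \<delta>(2) by auto
    show "w x + u a < u x"
    proof (cases "norm (x - y) \<le> R")
      case True
      then show ?thesis using \<epsilon>(2)[OF x True] bspec[OF wle xU] by linarith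
    next
      case False
      then show ?thesis using bspec[OF wneg xU] a(2)[OF x\<Omega>] by simp
    qed
  next
    fix i x assume "x \<in> U"
    then show "((\<lambda>t. w (x + t *\<^sub>R axis i 1) + u a) has_real_derivative W x $ i) (at 0)"
      using DERIV_add[OF dw[rule_format] DERIV_const[of "u a"]] by simp
  next
    show "continuous_on U (\<lambda>x. w x + u a)" by (intro continuous_intros wc)
    show "0 < (\<Sum>i\<in>UNIV. \<kappa> i x)" if "x \<in> cball a \<delta>" for x using \<kappa>pos BU that by blast
  qed (fact lc lmono lgrow Wc[rule_format] \<kappa>c[rule_format] d\<kappa>[rule_format])+
  moreover have "a \<in> U" using BU \<delta>(1) by auto
  then have "w a = 0" using w0 R(2) by blast
  ultimately show False by simp
qed

text \<open>The contact set is nonempty and relatively closed in the connected set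
  \<open>\<Omega>\<close>, so only its openness has to be shown; the equality passes to the closure
  by continuity.\<close>

theorem theorem1:
  fixes \<Omega> :: "(real ^ 'n::finite) set"
    and g f :: "'n \<Rightarrow> real \<Rightarrow> real"
    and m :: 'n
    and u :: "real ^ 'n \<Rightarrow> real"
  assumes "CARD('n) \<ge> 2"
    and "connected \<Omega>" and "open \<Omega>" and "bounded \<Omega>"
    and "\<forall>i. continuous_on {0..} (g i) \<and> (\<forall>t\<ge>0. 0 \<le> g i t)"
    and "assumption_L g m"
    and "\<forall>i. solves_ode (g i) (f i)"
    and "assumption_G f"
    and "\<forall>\<xi>>0. G_int g m \<xi> = \<infinity>"
    and "u \<in> W12 \<Omega>" and "continuous_on (closure \<Omega>) u"
    and "weak_supersolution \<Omega> f u"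
    and "\<exists>x0\<in>\<Omega>. \<forall>x\<in>closure \<Omega>. u x0 \<le> u x"
  shows "u constant_on closure \<Omega>"
proof -
  obtain x0 where x0: "x0 \<in> \<Omega>" "\<And>x. x \<in> closure \<Omega> \<Longrightarrow> u x0 \<le> u x" using assms(13) by blast
  have min: "u x0 \<le> u x" if "x \<in> \<Omega>" for x using x0(2) closure_subset that by blast
  have uc: "continuous_on \<Omega> u" using assms(11) closure_subset by (rule continuous_on_subset)
  define S where "S = {x \<in> \<Omega>. u x = u x0}"
  have "\<exists>r>0. ball x r \<subseteq> S" if x: "x \<in> S" for x
  proof -
    have x\<Omega>: "x \<in> \<Omega>" and ux: "u x = u x0" using x by (auto simp: S_def)
    obtain r where r: "r > 0" "ball x r \<subseteq> \<Omega>" using x\<Omega> \<open>open \<Omega>\<close> open_contains_ball by blast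
    \<comment> \<open>Halving the radius keeps the closed ball about \<open>b\<close> through
      \<open>x\<close> inside \<open>\<Omega>\<close>, since its points are at most twice
      \<open>dist b x\<close> away from \<open>x\<close>.\<close>
    have "b \<in> S" if b: "b \<in> ball x (r / 2)" for b
    proof (rule ccontr)
      assume "b \<notin> S"
      have b\<Omega>: "cball b (dist b x) \<subseteq> \<Omega>"
      proof
        fix z assume "z \<in> cball b (dist b x)"
        then have "dist x z < r" using b dist_triangle[of x z b] by (simp add: dist_commute)
        then show "z \<in> \<Omega>" using r(2) by auto
      qed
      have "b \<in> \<Omega>" using subsetD[OF b\<Omega>, of b] by simp
      then have ub: "u b \<noteq> u x0" using \<open>b \<notin> S\<close> by (simp add: S_def)
      \<comment> \<open>These are the contact points in the closed ball about \<open>b\<close>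
        through \<open>x\<close>; as \<open>x\<close> is one of them, there is one nearest to
        \<open>b\<close>.\<close>
      let ?C = "cball b (dist b x) \<inter> {z \<in> cball b (dist b x). u z = u x0}"
      have "closed {z \<in> cball b (dist b x). u z = u x0}"
        by (intro continuous_closed_preimage_constant continuous_on_subset[OF uc b\<Omega>]) auto
      then have "compact ?C" by (intro compact_Int_closed) auto
      moreover have "x \<in> ?C" using ux by simp
      ultimately have "\<exists>a\<in>?C. \<forall>z\<in>?C. dist b a \<le> dist b z"
        by (intro continuous_attains_inf) (auto intro!: continuous_intros)
      then obtain a where a: "a \<in> ?C" "\<And>z. z \<in> ?C \<Longrightarrow> dist b a \<le> dist b z" by blast
      have a\<Omega>: "a \<in> \<Omega>" and ua: "u a = u x0" using a(1) b\<Omega> by auto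
      have pos: "u a < u z" if "z \<in> \<Omega>" "dist b z < dist b a" for z
        using a(2)[of z] a(1) that min[of z] ua by force
      \<comment> \<open>The ball around \<open>b\<close> may touch the contact set in several points; the internally tangent
        ball of half its radius touches it in \<open>a\<close> only.\<close>
      define y where "y = midpoint b a"
      define R where "R = dist b a / 2"
      have "a \<noteq> b" using ua ub by auto
      then have R: "R > 0" by (simp add: R_def)
      have ya: "norm (a - y) = R" "norm (y - b) = R"
        unfolding R_def y_def by (simp_all add: dist_norm[symmetric] dist_midpoint dist_commute)
      have ay: "a - y = y - b" unfolding y_def midpoint_def by (simp add: algebra_simps flip: scaleR_2)
      show False
      proof (rule no_interior_contact[where u=u and y=y and a=a and R=R, OF assms(1) \<open>open \<Omega>\<close>])
        fix z assume z: "z \<in> \<Omega>" "norm (z - y) \<le> R" "z \<noteq> a"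
        \<comment> \<open>Otherwise the triangle inequality from \<open>b\<close> over
          \<open>y\<close> to \<open>z\<close> would be an equality; then z - y and y - b are
          parallel and of equal length, which forces z = a.\<close>
        have "dist b z < dist b a"
        proof (rule ccontr)
          assume "\<not> dist b z < dist b a"
          then have "2 * R \<le> norm ((y - b) + (z - y))" by (simp add: R_def dist_norm norm_minus_commute)
          moreover have "norm ((y - b) + (z - y)) \<le> norm (y - b) + norm (z - y)" by (rule norm_triangle_ineq)
          ultimately have "norm (z - y) = R" "norm ((y - b) + (z - y)) = norm (y - b) + norm (z - y)"
            using z(2) ya(2) by linarith+
          then have "R *\<^sub>R (z - y) = R *\<^sub>R (y - b)" using norm_triangle_eq ya(2) by metis
          then have "z - y = a - y" using R ay by simp
          then show False using z(3) by simp
        qed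
        then show "u a < u z" by (rule pos[OF z(1)])
      next
        show "u a \<le> u z" if "z \<in> \<Omega>" for z using min[OF that] ua by simp
        show "continuous_on {0..} (g i)" for i using assms(5) by blast
        show "\<forall>i. \<forall>t\<ge>0. 0 \<le> g i t" using assms(5) by blast
        show "solves_ode (g i) (f i)" for i using assms(7) by blast
      qed (fact assms uc a\<Omega> R ya)+
    qed
    then have "ball x (r / 2) \<subseteq> S" by blast
    then show ?thesis using r(1) by (intro exI[of _ "r / 2"]) simp
  qed
  then have "open S" by (simp add: open_contains_ball)
  then have "openin (top_of_set \<Omega>) S" by (intro open_subset) (auto simp: S_def)
  moreover have "closedin (top_of_set \<Omega>) S"
    unfolding S_def by (rule continuous_closedin_preimage_constant[OF uc])
  ultimately have "S = {} \<or> S = \<Omega>" using assms(2) by (simp add: connected_clopen)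
  moreover have "x0 \<in> S" using x0(1) by (simp add: S_def)
  ultimately have "S = \<Omega>" by blast
  then have "u x = u x0" if "x \<in> \<Omega>" for x using that by (auto simp: S_def)
  then have "u x = u x0" if "x \<in> closure \<Omega>" for x
    using continuous_constant_on_closure[OF assms(11)] that by blast
  then show ?thesis unfolding constant_on_def by blast
qed

end
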